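(* Let $G$ be a Lie group with Lie algebra $\mathfrak{g}$ and let $M$ be a homogeneous $G$-space. For every basis $\{v_i\}_{i=1}^m$ of $\mathfrak{g}$, the induced vector fields $\{\widetilde v_i\}_{i=1}^m$ form a generating set for the smooth vector fields on $M$.
   Context: A homogeneous $G$-space is a smooth manifold $M$ with a smooth transitive left action $G\times M\to M$, $(a,x)\mapsto a.x$. For $v\in\mathfrak{g}$, the induced vector field on $M$ is $\widetilde v_x:=\frac{d}{dt}\big|_{t=0}\exp(tv).x$. A finite set $\{X_i\}_{i=1}^m$ of smooth vector fields on $M$ is a generating set if every smooth vector field $X$ on $M$ can be written $X=f_1X_1+\cdots+f_mX_m$ with $f_i\in C^\infty(M)$. *)

theory Defs
  imports "HOL-Analysis.Analysis" "HOL-Algebra.Group_Action"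
begin

section \<open>Smooth maps between open subsets of normed spaces\<close>

text \<open>
  These are used only for open \<open>S\<close> in finite-dimensional spaces. There, existence and continuity
  of all iterated directional derivatives is the usual notion of being \<open>k\<close> times continuously
  differentiable.
\<close>

primrec Ck_on ::
  "nat \<Rightarrow> 'a::real_normed_vector set \<Rightarrow> ('a \<Rightarrow> 'b::real_normed_vector) \<Rightarrow> bool"
where
  "Ck_on 0 S f \<longleftrightarrow> continuous_on S f"
| "Ck_on (Suc k) S f \<longleftrightarrow>
     (\<forall>x\<in>S. f differentiable (at x)) \<and> (\<forall>v. Ck_on k S (\<lambda>x. frechet_derivative f (at x) v))"

definition smooth_on ::
  "'a::real_normed_vector set \<Rightarrow> ('a \<Rightarrow> 'b::real_normed_vector) \<Rightarrow> bool"
where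
  "smooth_on S f \<longleftrightarrow> (\<forall>k. Ck_on k S f)"

section \<open>Smooth manifolds\<close>

text \<open>
  The underlying set of a manifold is a whole type. The model space is a finite-dimensional normed
  space rather than an \<open>euclidean_space\<close>, because the latter class excludes dimension 0.
  A chart is its domain together with a total function, which is relevant only on the domain.
  An atlas need not be maximal.
\<close>

type_synonym ('m, 'e) chart = "'m set \<times> ('m \<Rightarrow> 'e)"

definition chart_inv :: "('m, 'e) chart \<Rightarrow> 'e \<Rightarrow> 'm" where
  "chart_inv c = inv_into (fst c) (snd c)"

definition chart_image :: "('m, 'e) chart \<Rightarrow> 'e set" where
  "chart_image c = snd c ` fst c"

definition is_chart :: "('m::topological_space, 'e::real_normed_vector) chart \<Rightarrow> bool" where
  "is_chart c \<longleftrightarrow> open (fst c) \<and> open (chart_image c) \<and>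
     homeomorphism (fst c) (chart_image c) (snd c) (chart_inv c)"

definition transition :: "('m, 'e) chart \<Rightarrow> ('m, 'e) chart \<Rightarrow> 'e \<Rightarrow> 'e" where
  "transition c d = snd d \<circ> chart_inv c"

locale smooth_manifold =
  fixes A :: "('m::{t2_space,second_countable_topology}, 'e::real_normed_vector) chart set"
  assumes finite_dim: "\<exists>B::'e set. finite B \<and> span B = UNIV"
    and charts: "c \<in> A \<Longrightarrow> is_chart c"
    and cover: "(\<Union>c\<in>A. fst c) = UNIV"
    and compatible: "c \<in> A \<Longrightarrow> d \<in> A \<Longrightarrow> smooth_on (snd c ` (fst c \<inter> fst d)) (transition c d)"

definition std_atlas :: "('e, 'e) chart set" where
  "std_atlas = {(UNIV, \<lambda>x. x)}"

definition prod_atlas ::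
  "('m, 'e) chart set \<Rightarrow> ('n, 'f) chart set \<Rightarrow> ('m \<times> 'n, 'e \<times> 'f) chart set"
where
  "prod_atlas A B = {(fst c \<times> fst d, map_prod (snd c) (snd d)) |c d. c \<in> A \<and> d \<in> B}"

definition smooth_map ::
  "('m::topological_space, 'e::real_normed_vector) chart set \<Rightarrow>
   ('n::topological_space, 'f::real_normed_vector) chart set \<Rightarrow> ('m \<Rightarrow> 'n) \<Rightarrow> bool"
where
  "smooth_map A B f \<longleftrightarrow> continuous_on UNIV f \<and>
     (\<forall>c\<in>A. \<forall>d\<in>B. smooth_on (snd c ` (fst c \<inter> f -` fst d)) (snd d \<circ> f \<circ> chart_inv c))"

section \<open>Tangent vectors and vector fields\<close>

text \<open>
  A tangent vector at \<open>p\<close> is the family of its coordinate vectors in the charts of the atlas around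
  \<open>p\<close>, which are related by the derivatives of the transition maps. The value at all other
  arguments is 0, so that equality of families is equality of tangent vectors.
\<close>

type_synonym ('m, 'e) tangent = "('m, 'e) chart \<Rightarrow> 'e"

definition charts_at :: "('m, 'e) chart set \<Rightarrow> 'm \<Rightarrow> ('m, 'e) chart set" where
  "charts_at A p = {c \<in> A. p \<in> fst c}"

definition tangent_space ::
  "('m, 'e::real_normed_vector) chart set \<Rightarrow> 'm \<Rightarrow> ('m, 'e) tangent set"
where
  "tangent_space A p = {v.
     (\<forall>c. c \<notin> charts_at A p \<longrightarrow> v c = 0) \<and>
     (\<forall>c\<in>charts_at A p. \<forall>d\<in>charts_at A p.
        v d = frechet_derivative (transition c d) (at (snd c p)) (v c))}"

definition lincomb ::
  "'i set \<Rightarrow> ('i \<Rightarrow> real) \<Rightarrow> ('i \<Rightarrow> ('m, 'e::real_normed_vector) tangent) \<Rightarrow> ('m, 'e) tangent"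
where
  "lincomb I a v = (\<lambda>c. \<Sum>i\<in>I. a i *\<^sub>R v i c)"

definition velocity ::
  "('m, 'e::real_normed_vector) chart set \<Rightarrow> (real \<Rightarrow> 'm) \<Rightarrow> real \<Rightarrow> ('m, 'e) tangent"
where
  "velocity A \<gamma> t =
     (\<lambda>c. if c \<in> charts_at A (\<gamma> t) then vector_derivative (snd c \<circ> \<gamma>) (at t) else 0)"

definition smooth_vector_field ::
  "('m, 'e::real_normed_vector) chart set \<Rightarrow> ('m \<Rightarrow> ('m, 'e) tangent) \<Rightarrow> bool"
where
  "smooth_vector_field A X \<longleftrightarrow>
     (\<forall>p. X p \<in> tangent_space A p) \<and>
     (\<forall>c\<in>A. smooth_on (chart_image c) (\<lambda>y. X (chart_inv c y) c))"

definition generating_set ::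
  "('m::topological_space, 'e::real_normed_vector) chart set \<Rightarrow>
   'i set \<Rightarrow> ('i \<Rightarrow> 'm \<Rightarrow> ('m, 'e) tangent) \<Rightarrow> bool"
where
  "generating_set A I X \<longleftrightarrow> finite I \<and> (\<forall>i\<in>I. smooth_vector_field A (X i)) \<and>
     (\<forall>Y. smooth_vector_field A Y \<longrightarrow>
        (\<exists>f. (\<forall>i\<in>I. smooth_map A (std_atlas :: (real, real) chart set) (f i)) \<and>
             (\<forall>p. Y p = lincomb I (\<lambda>i. f i p) (\<lambda>i. X i p))))"

section \<open>Lie groups and homogeneous spaces\<close>

locale lie_group = group G + smooth_manifold A
  for G :: "'g::{t2_space,second_countable_topology} monoid"
    and A :: "('g, 'e::real_normed_vector) chart set" +
  assumes carrier_UNIV: "carrier G = UNIV"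
    and smooth_mult: "smooth_map (prod_atlas A A) A (\<lambda>(a, b). a \<otimes>\<^bsub>G\<^esub> b)"
    and smooth_inv: "smooth_map A A (\<lambda>a. inv\<^bsub>G\<^esub> a)"

definition lie_algebra ::
  "'g monoid \<Rightarrow> ('g, 'e::real_normed_vector) chart set \<Rightarrow> ('g, 'e) tangent set"
where
  "lie_algebra G A = tangent_space A \<one>\<^bsub>G\<^esub>"

definition lie_algebra_basis ::
  "'g monoid \<Rightarrow> ('g, 'e::real_normed_vector) chart set \<Rightarrow>
   'i set \<Rightarrow> ('i \<Rightarrow> ('g, 'e) tangent) \<Rightarrow> bool"
where
  "lie_algebra_basis G A I v \<longleftrightarrow> finite I \<and> (\<forall>i\<in>I. v i \<in> lie_algebra G A) \<and>
     (\<forall>a. lincomb I a v = (\<lambda>_. 0) \<longrightarrow> (\<forall>i\<in>I. a i = 0)) \<and>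
     (\<forall>w\<in>lie_algebra G A. \<exists>a. w = lincomb I a v)"

definition one_parameter_subgroup ::
  "'g::topological_space monoid \<Rightarrow> ('g, 'e::real_normed_vector) chart set \<Rightarrow> (real \<Rightarrow> 'g) \<Rightarrow> bool"
where
  "one_parameter_subgroup G A \<gamma> \<longleftrightarrow>
     smooth_map std_atlas A \<gamma> \<and> (\<forall>s t. \<gamma> (s + t) = \<gamma> s \<otimes>\<^bsub>G\<^esub> \<gamma> t)"

definition lie_exp ::
  "'g::topological_space monoid \<Rightarrow> ('g, 'e::real_normed_vector) chart set \<Rightarrow>
   ('g, 'e) tangent \<Rightarrow> 'g"
where
  "lie_exp G A v = (THE \<gamma>. one_parameter_subgroup G A \<gamma> \<and> velocity A \<gamma> 0 = v) 1"

text \<open>The action is written \<open>act a x\<close> for $a.x$.\<close>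

locale homogeneous_space =
  lie_group G A + M: smooth_manifold B + transitive_action G UNIV act
  for G :: "'g::{t2_space,second_countable_topology} monoid"
    and A :: "('g, 'e::real_normed_vector) chart set"
    and B :: "('m::{t2_space,second_countable_topology}, 'f::real_normed_vector) chart set"
    and act :: "'g \<Rightarrow> 'm \<Rightarrow> 'm" +
  assumes smooth_act: "smooth_map (prod_atlas A B) B (\<lambda>(a, x). act a x)"

definition induced_field ::
  "'g::topological_space monoid \<Rightarrow> ('g, 'e::real_normed_vector) chart set \<Rightarrow>
   ('m, 'f::real_normed_vector) chart set \<Rightarrow> ('g \<Rightarrow> 'm \<Rightarrow> 'm) \<Rightarrow>
   ('g, 'e) tangent \<Rightarrow> 'm \<Rightarrow> ('m, 'f) tangent"
where
  "induced_field G A B act v x =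
     velocity B (\<lambda>t. act (lie_exp G A (\<lambda>c. t *\<^sub>R v c)) x) 0"

end

theory Submission
  imports Defs
begin

text \<open>
  Write \<open>L\<^sub>x\<close> for the derivative at \<open>1\<close> of the orbit map \<open>a \<mapsto> a.x\<close>. The induced field of \<open>v\<close> is \<open>x \<mapsto> L\<^sub>x v\<close>,
  which is smooth in \<open>x\<close>, so the point is that \<open>L\<^sub>x\<close> is onto. Elements \<open>v\<close> of its kernel satisfy
  \<open>exp(tv).x = x\<close> for all \<open>t\<close>. Extend a basis of the kernel to a basis of the Lie algebra; in the
  corresponding coordinates of the second kind \<open>exp(t\<^sub>1v\<^sub>1)\<dots>exp(t\<^sub>mv\<^sub>m)\<close>, with the kernel elements last, a
  neighbourhood \<open>U\<close> of \<open>1\<close> moves \<open>x\<close> inside the smooth image of a cube of dimension the rank of \<open>L\<^sub>x\<close>.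
  Countably many translates of \<open>U\<close> cover the group, hence countably many translates of that image cover the
  manifold, and by Baire and a pigeonhole count the rank is at least the dimension of the manifold.

  If vector fields span every tangent space, then the coefficients of a smooth field that are orthogonal to all
  linear relations between the fields at the point are unique and depend smoothly on the point.
\<close>

section \<open>Finite-dimensional normed spaces\<close>

text \<open>Transitivity alone does not make an orbit map submersive: the real line with the
  discrete topology acts transitively on the usual line and has trivial Lie algebra. Second
  countability of the group excludes this; it is what makes countably many translates suffice.
  Lipschitz bounds, Baire and counting then take the place that rank theorems and measure-zero
  arguments have in textbooks. Coordinates of the second kind are chosen because their smoothness
  follows from that of single one-parameter subgroups, each a function of its own parameter; that of
  \<open>lie_exp\<close> itself would require smooth dependence of flows on the initial data.
  \<open>lie_exp\<close> is a definite description, so existence and uniqueness of one-parameter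
  subgroups have to be established, by ordinary differential equations in a chart. The model spaces
  are normed spaces with a finite spanning set, of no complete or Euclidean type class, which is why
  the basic facts about finite dimension are derived here.\<close>

definition fin_dim :: "'a::real_normed_vector itself \<Rightarrow> bool" where
  "fin_dim _ \<longleftrightarrow> (\<exists>B::'a set. finite B \<and> span B = UNIV)"

text \<open>By induction on the basis: the bound for \<open>B\<close> makes its span closed, so a
  further independent vector has positive distance from it, and this distance controls the new
  coordinate. Continuity of linear maps and completeness in finite dimension rest on this
  estimate.\<close>

lemma independent_coord_bound:
  fixes B :: "'a::real_normed_vector set"
  assumes "finite B" "independent B"
  shows "\<exists>C>0. \<forall>a. (\<Sum>b\<in>B. \<bar>a b\<bar>) \<le> C * norm (\<Sum>b\<in>B. a b *\<^sub>R b)"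
  using assms
proof (induction B)
  case empty
  then show ?case by (auto intro: exI[of _ 1])
next
  case (insert x B)
  then have indB: "independent B" and xB: "x \<notin> span B"
    by (auto simp: independent_insert)
  then obtain C where C: "C > 0" "\<And>a. (\<Sum>b\<in>B. \<bar>a b\<bar>) \<le> C * norm (\<Sum>b\<in>B. a b *\<^sub>R b)"
    using insert.IH by blast
  \<comment> \<open>Otherwise combinations \<open>s n\<close> of \<open>B\<close> tend to
    \<open>x\<close>; by the induction hypothesis their coefficients are Cauchy, and the limits
    would put \<open>x\<close> into the span.\<close>
  have "\<exists>d>0. \<forall>a. d \<le> norm (x - (\<Sum>b\<in>B. a b *\<^sub>R b))"
  proof (rule ccontr)
    assume neg: "\<not> ?thesis"
    have "\<exists>a. norm (x - (\<Sum>b\<in>B. a b *\<^sub>R b)) < inverse (real (Suc n))" for n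
      using neg by (metis inverse_positive_iff_positive not_le of_nat_0_less_iff zero_less_Suc)
    then obtain a where a: "\<And>n. norm (x - (\<Sum>b\<in>B. a n b *\<^sub>R b)) < inverse (real (Suc n))"
      by metis
    define s where "s n = (\<Sum>b\<in>B. a n b *\<^sub>R b)" for n
    have "(\<lambda>n. x - s n) \<longlonglongrightarrow> 0"
      by (rule Lim_null_comparison[OF _ LIMSEQ_inverse_real_of_nat])
        (use a in \<open>auto simp: s_def intro!: always_eventually less_imp_le\<close>)
    then have "(\<lambda>n. x - (x - s n)) \<longlonglongrightarrow> x - 0"
      by (intro tendsto_intros)
    then have sx: "s \<longlonglongrightarrow> x" by simp
    then have cs: "Cauchy s" by (rule LIMSEQ_imp_Cauchy)
    have "convergent (\<lambda>n. a n b)" if b: "b \<in> B" for b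
    proof -
      have le: "\<bar>a n b - a k b\<bar> \<le> C * norm (s n - s k)" for n k
      proof -
        have "\<bar>a n b - a k b\<bar> \<le> (\<Sum>b\<in>B. \<bar>a n b - a k b\<bar>)"
          using b insert.hyps(1) by (intro member_le_sum) auto
        also have "\<dots> \<le> C * norm (\<Sum>b\<in>B. (a n b - a k b) *\<^sub>R b)" by (rule C(2))
        also have "(\<Sum>b\<in>B. (a n b - a k b) *\<^sub>R b) = s n - s k"
          by (simp add: s_def scaleR_diff_left sum_subtractf)
        finally show ?thesis .
      qed
      have "Cauchy (\<lambda>n. a n b)"
      proof (rule CauchyI)
        fix e :: real assume "e > 0"
        then obtain M where M: "\<And>m n. m \<ge> M \<Longrightarrow> n \<ge> M \<Longrightarrow> norm (s m - s n) < e / C"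
          using CauchyD[OF cs, of "e / C"] C(1) by (metis divide_pos_pos)
        show "\<exists>M. \<forall>m\<ge>M. \<forall>n\<ge>M. norm (a m b - a n b) < e"
        proof (intro exI allI impI)
          fix m n assume "M \<le> m" "M \<le> n"
          then have "C * norm (s m - s n) < C * (e / C)"
            using M C(1) by (intro mult_strict_left_mono) auto
          then show "norm (a m b - a n b) < e"
            using le[of m n] C(1) by simp
        qed
      qed
      then show ?thesis by (rule real_Cauchy_convergent)
    qed
    then obtain l where l: "\<And>b. b \<in> B \<Longrightarrow> (\<lambda>n. a n b) \<longlonglongrightarrow> l b"
      unfolding convergent_def by metis
    have "(\<lambda>n. \<Sum>b\<in>B. a n b *\<^sub>R b) \<longlonglongrightarrow> (\<Sum>b\<in>B. l b *\<^sub>R b)"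
      by (intro tendsto_sum tendsto_scaleR l tendsto_const)
    then have "x = (\<Sum>b\<in>B. l b *\<^sub>R b)"
      using sx LIMSEQ_unique unfolding s_def by blast
    then show False
      using xB by (metis (mono_tags, lifting) span_base span_scale span_sum)
  qed
  then obtain d where d: "d > 0" "\<And>a. d \<le> norm (x - (\<Sum>b\<in>B. a b *\<^sub>R b))" by blast
  \<comment> \<open>The first summand of the constant pays for the coefficient of \<open>x\<close>,
    the second for the remaining vector \<open>u - a x *\<^sub>R x\<close>, whose norm is at most
    \<open>(1 + norm x / d) * norm u\<close>.\<close>
  show ?case
  proof (intro exI[of _ "1/d + C * (1 + norm x / d)"] conjI allI)
    show "0 < 1/d + C * (1 + norm x / d)"
      using d(1) C(1) by (intro add_pos_nonneg) auto
    fix a :: "'a \<Rightarrow> real"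
    define s where "s = (\<Sum>b\<in>B. a b *\<^sub>R b)"
    define u where "u = a x *\<^sub>R x + s"
    have 1: "\<bar>a x\<bar> \<le> norm u / d"
    proof (cases "a x = 0")
      case False
      have "u = a x *\<^sub>R (x - (\<Sum>b\<in>B. (- a b / a x) *\<^sub>R b))"
        using False by (simp add: u_def s_def scaleR_right_distrib scaleR_sum_right sum_negf)
      then have "norm u = \<bar>a x\<bar> * norm (x - (\<Sum>b\<in>B. (- a b / a x) *\<^sub>R b))" by simp
      also have "\<dots> \<ge> \<bar>a x\<bar> * d" by (intro mult_left_mono d(2)) auto
      finally show ?thesis using d(1) by (simp add: field_simps)
    qed (use d in simp)
    have "norm s = norm (u - a x *\<^sub>R x)" by (simp add: u_def)
    also have "\<dots> \<le> norm u + \<bar>a x\<bar> * norm x" by (metis norm_triangle_ineq4 norm_scaleR)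
    also have "\<dots> \<le> norm u + norm u / d * norm x"
      using 1 by (intro add_left_mono mult_right_mono) auto
    finally have "C * norm s \<le> C * (norm u + norm u / d * norm x)"
      using C(1) by (intro mult_left_mono) auto
    then have "(\<Sum>b\<in>B. \<bar>a b\<bar>) \<le> C * (1 + norm x / d) * norm u"
      using C(2)[of a] unfolding s_def[symmetric] by (simp add: algebra_simps)
    moreover have ueq: "(\<Sum>b\<in>insert x B. a b *\<^sub>R b) = u" and "(\<Sum>b\<in>insert x B. \<bar>a b\<bar>) = \<bar>a x\<bar> + (\<Sum>b\<in>B. \<bar>a b\<bar>)"
      using insert.hyps by (simp_all add: u_def s_def)
    moreover have "(1/d + C * (1 + norm x / d)) * norm u = norm u / d + C * (1 + norm x / d) * norm u"
      by (simp add: distrib_right)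
    ultimately have "(\<Sum>b\<in>insert x B. \<bar>a b\<bar>) \<le> (1/d + C * (1 + norm x / d)) * norm u"
      using 1 by linarith
    then show "(\<Sum>b\<in>insert x B. \<bar>a b\<bar>)
        \<le> (1/d + C * (1 + norm x / d)) * norm (\<Sum>b\<in>insert x B. a b *\<^sub>R b)"
      unfolding ueq .
  qed
qed

lemma fin_dim_basis:
  assumes "fin_dim TYPE('a::real_normed_vector)"
  obtains B :: "'a::real_normed_vector set" where "finite B" "independent B" "span B = UNIV"
proof -
  obtain S :: "'a set" where S: "finite S" "span S = UNIV"
    using assms by (auto simp: fin_dim_def)
  obtain B where "B \<subseteq> S" "independent B" "S \<subseteq> span B"
    using maximal_independent_subset[of S] by blast
  then show ?thesis
    using that[of B] S by (metis finite_subset span_mono span_span top.extremum_unique)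
qed

lemma linear_representation:
  fixes B :: "'a::real_normed_vector set"
  assumes "independent B" "span B = UNIV"
  shows "linear (\<lambda>u. representation B u b)"
  using assms by (intro linearI) (auto simp: representation_add representation_scale)

lemma sum_representation:
  fixes B :: "'a::real_normed_vector set"
  assumes "finite B" "independent B" "span B = UNIV"
  shows "(\<Sum>b\<in>B. representation B u b *\<^sub>R b) = u"
  using sum_representation_eq[of B u B] assms by auto

lemma representation_bound:
  fixes B :: "'a::real_normed_vector set"
  assumes B: "finite B" "independent B" "span B = UNIV"
  obtains C where "C > 0" "\<And>u. (\<Sum>b\<in>B. \<bar>representation B u b\<bar>) \<le> C * norm u"
    "\<And>u b. \<bar>representation B u b\<bar> \<le> C * norm u"
proof -
  obtain C where C: "C > 0" "\<And>a. (\<Sum>b\<in>B. \<bar>a b\<bar>) \<le> C * norm (\<Sum>b\<in>B. a b *\<^sub>R b)"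
    using independent_coord_bound[OF B(1,2)] by blast
  have sum: "(\<Sum>b\<in>B. \<bar>representation B u b\<bar>) \<le> C * norm u" for u
    using C(2)[of "representation B u"] sum_representation[OF B] by simp
  show thesis
  proof (rule that[OF C(1) sum])
    fix u b
    show "\<bar>representation B u b\<bar> \<le> C * norm u"
    proof (cases "b \<in> B")
      case True
      then have "\<bar>representation B u b\<bar> \<le> (\<Sum>b\<in>B. \<bar>representation B u b\<bar>)"
        using B(1) by (intro member_le_sum) auto
      then show ?thesis using sum[of u] by simp
    next
      case False
      then have "representation B u b = 0" using representation_ne_zero by blast
      then show ?thesis using C(1) by simp
    qed
  qed
qed

lemma bounded_linear_representation:
  fixes B :: "'a::real_normed_vector set"
  assumes B: "finite B" "independent B" "span B = UNIV"
  shows "bounded_linear (\<lambda>u. representation B u b)"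
proof -
  obtain C where "\<And>u b. \<bar>representation B u b\<bar> \<le> C * norm u" using representation_bound[OF B] by metis
  then show ?thesis using B
    by (intro bounded_linear_intro[where K = C]) (auto simp: representation_add representation_scale mult.commute)
qed

lemma linear_eq_sum_representation:
  fixes f :: "'a::real_normed_vector \<Rightarrow> 'b::real_normed_vector"
  assumes "finite B" "independent B" "span B = UNIV" "linear f"
  shows "f w = (\<Sum>b\<in>B. representation B w b *\<^sub>R f b)"
  by (subst sum_representation[OF assms(1-3), of w, symmetric])
    (simp add: linear_sum[OF assms(4)] linear_scale[OF assms(4)])

lemma fin_dim_linear_bounded:
  fixes f :: "'a::real_normed_vector \<Rightarrow> 'b::real_normed_vector"
  assumes "fin_dim TYPE('a)" "linear f"
  shows "bounded_linear f"
proof -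
  obtain B :: "'a set" where B: "finite B" "independent B" "span B = UNIV"
    using fin_dim_basis[OF assms(1)] .
  have "f = (\<lambda>u. \<Sum>b\<in>B. representation B u b *\<^sub>R f b)"
    by (rule ext) (rule linear_eq_sum_representation[OF B assms(2)])
  moreover have "bounded_linear (\<lambda>u. \<Sum>b\<in>B. representation B u b *\<^sub>R f b)"
    by (intro bounded_linear_sum bounded_linear_scaleR_const bounded_linear_representation B)
  ultimately show ?thesis by simp
qed

text \<open>Since \<open>'a\<close> is not an instance of \<open>banach\<close>, theorems on Banach spaces are transferred
  to it along this isomorphism with its dual.\<close>

lemma fin_dim_dual_embedding:
  assumes "fin_dim TYPE('a::real_normed_vector)"
  obtains i :: "'a::real_normed_vector \<Rightarrow> ('a \<Rightarrow>\<^sub>L real)" and p :: "('a \<Rightarrow>\<^sub>L real) \<Rightarrow> 'a"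
  where "bounded_linear i" "bounded_linear p" "\<And>u. p (i u) = u"
proof -
  obtain B :: "'a set" where B: "finite B" "independent B" "span B = UNIV"
    using fin_dim_basis[OF assms(1)] .
  define F where "F b = Blinfun (\<lambda>u. representation B u b)" for b
  have F: "blinfun_apply (F b) u = representation B u b" for b u
    using bounded_linear_Blinfun_apply[OF bounded_linear_representation[OF B, of b]]
    by (simp add: F_def)
  show thesis
  proof (rule that[of "\<lambda>u. \<Sum>b\<in>B. representation B u b *\<^sub>R F b" "\<lambda>h. \<Sum>b\<in>B. blinfun_apply h b *\<^sub>R b"])
    show "bounded_linear (\<lambda>u. \<Sum>b\<in>B. representation B u b *\<^sub>R F b)"
      by (intro bounded_linear_sum bounded_linear_scaleR_const bounded_linear_representation B)
    show "bounded_linear (\<lambda>h::'a \<Rightarrow>\<^sub>L real. \<Sum>b\<in>B. blinfun_apply h b *\<^sub>R b)"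
      by (intro bounded_linear_sum bounded_linear_scaleR_const blinfun.bounded_linear_left)
    fix u
    have "(\<Sum>b'\<in>B. representation B u b' * representation B b b') = representation B u b"
      if "b \<in> B" for b
      using that B by (simp add: representation_basis if_distrib[of "\<lambda>x. _ * x"] sum.delta cong: if_cong)
    then show "(\<Sum>b\<in>B. blinfun_apply (\<Sum>b\<in>B. representation B u b *\<^sub>R F b) b *\<^sub>R b) = u"
      using sum_representation[OF B, of u]
      by (simp add: blinfun.sum_left blinfun.scaleR_left F)
  qed
qed

lemma fin_dim_complete:
  assumes "fin_dim TYPE('a::real_normed_vector)"
  shows "complete (UNIV :: 'a set)"
proof -
  obtain i :: "'a \<Rightarrow> ('a \<Rightarrow>\<^sub>L real)" and p where ip: "bounded_linear i" "bounded_linear p" "\<And>u. p (i u) = u"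
    using fin_dim_dual_embedding[OF assms] by blast
  show ?thesis
    unfolding complete_def
  proof (intro allI impI, elim conjE)
    fix f :: "nat \<Rightarrow> 'a" assume "Cauchy f"
    then have "Cauchy (\<lambda>n. i (f n))" by (rule bounded_linear.Cauchy[OF ip(1)])
    then obtain l where "(\<lambda>n. i (f n)) \<longlonglongrightarrow> l"
      using Cauchy_convergent convergent_def by blast
    then have "(\<lambda>n. p (i (f n))) \<longlonglongrightarrow> p l" by (rule bounded_linear.tendsto[OF ip(2)])
    then show "\<exists>l\<in>UNIV. f \<longlonglongrightarrow> l" by (auto simp: ip(3))
  qed
qed

lemma fin_dim_Times:
  assumes "fin_dim TYPE('a::real_normed_vector)" "fin_dim TYPE('b::real_normed_vector)"
  shows "fin_dim TYPE('a \<times> 'b)"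
proof -
  obtain B :: "'a set" and C :: "'b set" where B: "finite B" "span B = UNIV" "finite C" "span C = UNIV"
    using assms by (auto simp: fin_dim_def)
  let ?S = "(\<lambda>b. (b, 0)) ` B \<union> (\<lambda>c. (0, c)) ` C"
  have 1: "linear (\<lambda>b. (b, 0::'b))" "linear (\<lambda>c. (0::'a, c))"
    by (auto intro!: linearI)
  have "(a, b) \<in> span ?S" for a b
  proof -
    have "(a, 0::'b) \<in> span ((\<lambda>b. (b, 0)) ` B)" "(0::'a, b) \<in> span ((\<lambda>c. (0, c)) ` C)"
      unfolding linear_span_image[OF 1(1), of B] linear_span_image[OF 1(2), of C] B by auto
    then have "(a, 0) + (0, b) \<in> span ?S"
      using span_mono[of _ ?S] by (intro span_add) auto
    then show ?thesis by simp
  qed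
  then have "span ?S = UNIV" by auto
  then show ?thesis using B unfolding fin_dim_def by (metis finite_UnI finite_imageI)
qed

lemma fin_dim_real: "fin_dim TYPE(real)"
  unfolding fin_dim_def by (rule exI[of _ "{1}"]) (auto simp: span_singleton)

lemma fin_dim_independent_card:
  fixes B S :: "'a::real_normed_vector set"
  assumes B: "finite B" "independent B" "span B = UNIV" and S: "independent S" "span S \<noteq> UNIV"
  shows "finite S \<and> card S < card B"
proof -
  have fS: "finite S \<and> card S \<le> card B"
    using independent_span_bound[OF B(1) S(1)] B(3) by auto
  moreover have "card S \<noteq> card B"
  proof
    assume eq: "card S = card B"
    obtain x where x: "x \<notin> span S" using S(2) by auto
    then have "independent (insert x S)" "x \<notin> S"
      using S(1) by (auto simp: independent_insertI span_base)
    then have "card (insert x S) \<le> card B"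
      using independent_span_bound[OF B(1)] B(3) by auto
    then show False using eq fS \<open>x \<notin> S\<close> by simp
  qed
  ultimately show ?thesis by simp
qed

lemma fin_dim_linear_inj_surj:
  fixes f :: "'a::real_normed_vector \<Rightarrow> 'a"
  assumes "fin_dim TYPE('a)" "linear f" "inj f"
  shows "surj f"
proof -
  obtain B :: "'a set" where B: "finite B" "independent B" "span B = UNIV"
    using fin_dim_basis[OF assms(1)] .
  have "independent (f ` B)"
    using linear_independent_injective_image[OF assms(2) B(2)] assms(3) by (simp add: inj_on_subset)
  moreover have "card (f ` B) = card B" by (meson assms(3) card_image inj_on_subset subset_UNIV)
  ultimately have "span (f ` B) = UNIV" using fin_dim_independent_card[OF B] by fastforce
  then show ?thesis using linear_span_image[OF assms(2), of B] B by simp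
qed

section \<open>Calculus of smooth maps\<close>

lemma frechet_derivative_at_eq:
  "(f has_derivative f') (at x) \<Longrightarrow> frechet_derivative f (at x) = f'"
  using frechet_derivative_at by metis

lemma Ck_on_subset: "Ck_on k S f \<Longrightarrow> T \<subseteq> S \<Longrightarrow> Ck_on k T f"
  by (induction k arbitrary: f) (auto intro: continuous_on_subset)

lemma Ck_on_cong:
  assumes "open S" "\<And>x. x \<in> S \<Longrightarrow> f x = g x" "Ck_on k S f"
  shows "Ck_on k S g"
  using assms(2,3)
proof (induction k arbitrary: f g)
  case 0
  then show ?case using continuous_on_cong by (metis Ck_on.simps(1))
next
  case (Suc k)
  have D: "(g has_derivative frechet_derivative f (at x)) (at x)" if "x \<in> S" for x
  proof (rule has_derivative_transform_within_open)
    show "(f has_derivative frechet_derivative f (at x)) (at x)"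
      using that Suc.prems(2) by (simp flip: frechet_derivative_works)
  qed (fact assms(1) that Suc.prems(1))+
  have "Ck_on k S (\<lambda>x. frechet_derivative g (at x) v)" for v
  proof (rule Suc.IH)
    show "Ck_on k S (\<lambda>x. frechet_derivative f (at x) v)"
      using Suc.prems(2) by simp
  qed (simp add: frechet_derivative_at_eq[OF D])
  then show ?case using D unfolding Ck_on.simps differentiable_def by blast
qed

lemma Ck_on_local:
  assumes "\<And>x. x \<in> S \<Longrightarrow> \<exists>T. open T \<and> x \<in> T \<and> Ck_on k T f"
  shows "Ck_on k S f"
  using assms
proof (induction k arbitrary: f)
  case 0
  then have "isCont f x" if "x \<in> S" for x
    using that by (metis Ck_on.simps(1) continuous_on_eq_continuous_at)
  then show ?case by (simp add: continuous_at_imp_continuous_on)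
next
  case (Suc k)
  have "Ck_on k S (\<lambda>x. frechet_derivative f (at x) v)" for v
    using Suc.prems by (intro Suc.IH) (metis Ck_on.simps(2))
  then show ?case using Suc.prems by (metis Ck_on.simps(2))
qed

lemma Ck_on_SucD: "Ck_on (Suc k) S f \<Longrightarrow> Ck_on k S f"
proof (induction k arbitrary: f)
  case 0
  then show ?case
    by (auto intro!: continuous_at_imp_continuous_on differentiable_imp_continuous_within)
next
  case (Suc k)
  from Suc.prems have "\<forall>x\<in>S. f differentiable (at x)"
    and "Ck_on (Suc k) S (\<lambda>x. frechet_derivative f (at x) v)" for v by (subst (asm) Ck_on.simps(2), blast)+
  then show ?case using Suc.IH by (subst Ck_on.simps(2)) blast
qed

lemma Ck_on_SucI:
  assumes "open S" "\<And>x. x \<in> S \<Longrightarrow> (f has_derivative f' x) (at x)" "\<And>v. Ck_on k S (\<lambda>x. f' x v)"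
  shows "Ck_on (Suc k) S f"
proof -
  have "Ck_on k S (\<lambda>x. frechet_derivative f (at x) v)" for v
    by (rule Ck_on_cong[OF assms(1) _ assms(3)[of v]]) (simp add: frechet_derivative_at_eq[OF assms(2)])
  then show ?thesis using assms(2) by (auto simp: differentiable_def)
qed

lemma Ck_on_SucE:
  assumes "Ck_on (Suc k) S f"
  shows "\<And>x. x \<in> S \<Longrightarrow> (f has_derivative frechet_derivative f (at x)) (at x)"
    and "\<And>v. Ck_on k S (\<lambda>x. frechet_derivative f (at x) v)"
  using assms by (auto simp: frechet_derivative_works[symmetric])

lemma Ck_on_const: "Ck_on k S (\<lambda>x. c)"
  by (induction k arbitrary: c) auto

lemma Ck_on_linear_compose:
  assumes "open S" "bounded_linear L" "Ck_on k S f"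
  shows "Ck_on k S (\<lambda>x. L (f x))"
  using assms(3)
proof (induction k arbitrary: f)
  case 0
  then show ?case using assms(2) by (auto intro: bounded_linear.continuous_on)
next
  case (Suc k)
  show ?case
    by (rule Ck_on_SucI[OF assms(1), where f' = "\<lambda>x v. L (frechet_derivative f (at x) v)"])
      (use Ck_on_SucE[OF Suc.prems] Suc.IH in \<open>auto intro: bounded_linear.has_derivative[OF assms(2)]\<close>)
qed

lemma Ck_on_ident: "open S \<Longrightarrow> Ck_on k S (\<lambda>x. x)"
proof (induction k)
  case (Suc k)
  then show ?case by (intro Ck_on_SucI[where f' = "\<lambda>x v. v"]) (auto intro: Ck_on_const)
qed auto

lemma Ck_on_add:
  assumes "open S" "Ck_on k S f" "Ck_on k S g"
  shows "Ck_on k S (\<lambda>x. f x + g x)"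
  using assms(2,3)
proof (induction k arbitrary: f g)
  case 0
  then show ?case by (auto intro: continuous_intros)
next
  case (Suc k)
  show ?case
    by (rule Ck_on_SucI[OF assms(1), where f' = "\<lambda>x v. frechet_derivative f (at x) v + frechet_derivative g (at x) v"])
      (use Ck_on_SucE[OF Suc.prems(1)] Ck_on_SucE[OF Suc.prems(2)] Suc.IH in \<open>auto intro: has_derivative_add\<close>)
qed

lemma Ck_on_sum:
  assumes "open S" "\<And>i. i \<in> I \<Longrightarrow> Ck_on k S (f i)"
  shows "Ck_on k S (\<lambda>x. \<Sum>i\<in>I. f i x)"
  using assms(2) by (induction I rule: infinite_finite_induct) (auto intro: Ck_on_const Ck_on_add assms(1))

lemma Ck_on_scaleR:
  assumes "open S" "Ck_on k S a" "Ck_on k S f"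
  shows "Ck_on k S (\<lambda>x. a x *\<^sub>R f x)"
  using assms(2,3)
proof (induction k arbitrary: a f)
  case 0
  then show ?case by (auto intro: continuous_intros)
next
  case (Suc k)
  have "((\<lambda>x. a x *\<^sub>R f x) has_derivative
      (\<lambda>v. a x *\<^sub>R frechet_derivative f (at x) v + frechet_derivative a (at x) v *\<^sub>R f x)) (at x)"
    if "x \<in> S" for x
    by (intro has_derivative_scaleR Ck_on_SucE(1)[OF Suc.prems(1) that] Ck_on_SucE(1)[OF Suc.prems(2) that])
  moreover have "Ck_on k S (\<lambda>x. a x *\<^sub>R frechet_derivative f (at x) v + frechet_derivative a (at x) v *\<^sub>R f x)" for v
    by (intro Ck_on_add assms(1) Suc.IH Ck_on_SucE(2)[OF Suc.prems(1)] Ck_on_SucE(2)[OF Suc.prems(2)]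
        Ck_on_SucD[OF Suc.prems(1)] Ck_on_SucD[OF Suc.prems(2)])
  ultimately show ?case by (rule Ck_on_SucI[OF assms(1)])
qed

text \<open>In the chain rule the direction in which \<open>g\<close> is differentiated varies with
  \<open>x\<close>, whereas \<open>Ck_on\<close> speaks of fixed directions. Expanding it in a basis
  of the middle space leaves sums of scalars times derivatives of \<open>g\<close> in fixed
  directions, to which the induction hypothesis applies; hence the hypothesis on the
  dimension.\<close>

lemma Ck_on_compose:
  fixes g :: "'b::real_normed_vector \<Rightarrow> 'c::real_normed_vector"
  assumes fd: "fin_dim TYPE('b)" and "open S" "open T"
    and "Ck_on k S f" "Ck_on k T g" "f ` S \<subseteq> T"
  shows "Ck_on k S (\<lambda>x. g (f x))"
  using assms(4-)
proof (induction k arbitrary: f g)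
  case 0
  then show ?case by (auto intro: continuous_on_compose2)
next
  case (Suc k)
  obtain B :: "'b set" where B: "finite B" "independent B" "span B = UNIV"
    using fin_dim_basis[OF fd] .
  note f = Ck_on_SucE[OF Suc.prems(1)] and g = Ck_on_SucE[OF Suc.prems(2)]
  let ?f' = "\<lambda>x. frechet_derivative f (at x)" and ?g' = "\<lambda>y. frechet_derivative g (at y)"
  have D: "((\<lambda>x. g (f x)) has_derivative
      (\<lambda>v. \<Sum>b\<in>B. representation B (?f' x v) b *\<^sub>R ?g' (f x) b)) (at x)" if "x \<in> S" for x
  proof -
    have fx: "f x \<in> T" using that Suc.prems(3) by auto
    have lin: "linear (?g' (f x))" using g(1)[OF fx] has_derivative_linear by blast
    have eq: "(\<lambda>v. ?g' (f x) (?f' x v)) = (\<lambda>v. \<Sum>b\<in>B. representation B (?f' x v) b *\<^sub>R ?g' (f x) b)"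
      by (rule ext) (rule linear_eq_sum_representation[OF B lin])
    show ?thesis
      unfolding eq[symmetric] by (rule has_derivative_compose[OF f(1)[OF that] g(1)[OF fx]])
  qed
  show ?case
    by (rule Ck_on_SucI[OF \<open>open S\<close> D])
      (auto intro!: Ck_on_sum Ck_on_scaleR \<open>open S\<close> f g Suc.IH Ck_on_SucD[OF Suc.prems(1)] Suc.prems(3)
        Ck_on_linear_compose[OF \<open>open S\<close> bounded_linear_representation[OF B]])
qed

lemma smooth_on_subset: "smooth_on S f \<Longrightarrow> T \<subseteq> S \<Longrightarrow> smooth_on T f"
  unfolding smooth_on_def using Ck_on_subset by blast

lemma smooth_on_cong: "open S \<Longrightarrow> (\<And>x. x \<in> S \<Longrightarrow> f x = g x) \<Longrightarrow> smooth_on S f \<Longrightarrow> smooth_on S g"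
  unfolding smooth_on_def using Ck_on_cong by blast

lemma smooth_on_local:
  "(\<And>x. x \<in> S \<Longrightarrow> \<exists>T. open T \<and> x \<in> T \<and> smooth_on T f) \<Longrightarrow> smooth_on S f"
  unfolding smooth_on_def by (intro allI Ck_on_local) blast

lemma smooth_on_const: "smooth_on S (\<lambda>x. c)"
  by (simp add: smooth_on_def Ck_on_const)

lemma smooth_on_ident: "open S \<Longrightarrow> smooth_on S (\<lambda>x. x)"
  by (simp add: smooth_on_def Ck_on_ident)

lemma smooth_on_linear_compose:
  "open S \<Longrightarrow> bounded_linear L \<Longrightarrow> smooth_on S f \<Longrightarrow> smooth_on S (\<lambda>x. L (f x))"
  by (simp add: smooth_on_def Ck_on_linear_compose)

lemma smooth_on_linear: "open S \<Longrightarrow> bounded_linear L \<Longrightarrow> smooth_on S L"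
  using smooth_on_linear_compose[OF _ _ smooth_on_ident] by blast

lemma smooth_on_add:
  "open S \<Longrightarrow> smooth_on S f \<Longrightarrow> smooth_on S g \<Longrightarrow> smooth_on S (\<lambda>x. f x + g x)"
  by (simp add: smooth_on_def Ck_on_add)

lemma smooth_on_scaleR:
  "open S \<Longrightarrow> smooth_on S a \<Longrightarrow> smooth_on S f \<Longrightarrow> smooth_on S (\<lambda>x. a x *\<^sub>R f x)"
  by (simp add: smooth_on_def Ck_on_scaleR)

lemma smooth_on_sum:
  "open S \<Longrightarrow> (\<And>i. i \<in> I \<Longrightarrow> smooth_on S (f i)) \<Longrightarrow> smooth_on S (\<lambda>x. \<Sum>i\<in>I. f i x)"
  by (simp add: smooth_on_def Ck_on_sum)

lemma smooth_on_Pair: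
  assumes "open S" "smooth_on S f" "smooth_on S g"
  shows "smooth_on S (\<lambda>x. (f x, g x))"
proof -
  have "smooth_on S (\<lambda>x. (f x, 0) + (0, g x))"
    by (rule smooth_on_add[OF assms(1) 
        smooth_on_linear_compose[OF assms(1) bounded_linear_Pair[OF bounded_linear_ident bounded_linear_zero] assms(2)]
        smooth_on_linear_compose[OF assms(1) bounded_linear_Pair[OF bounded_linear_zero bounded_linear_ident] assms(3)]])
  then show ?thesis by simp
qed

lemma smooth_on_compose:
  fixes g :: "'b::real_normed_vector \<Rightarrow> 'c::real_normed_vector"
  assumes "fin_dim TYPE('b)" "open S" "open T" "smooth_on S f" "smooth_on T g" "f ` S \<subseteq> T"
  shows "smooth_on S (\<lambda>x. g (f x))"
  using assms Ck_on_compose unfolding smooth_on_def by blast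

lemma smooth_on_imp_continuous_on: "smooth_on S f \<Longrightarrow> continuous_on S f"
  unfolding smooth_on_def by (metis Ck_on.simps(1))

lemma smooth_on_has_derivative:
  "smooth_on S f \<Longrightarrow> x \<in> S \<Longrightarrow> (f has_derivative frechet_derivative f (at x)) (at x)"
  unfolding smooth_on_def by (metis Ck_on_SucE(1))

lemma smooth_on_frechet_derivative: "smooth_on S f \<Longrightarrow> smooth_on S (\<lambda>x. frechet_derivative f (at x) v)"
  unfolding smooth_on_def by (metis Ck_on_SucE(2))

text \<open>Continuity of the derivative in the finitely many basis directions amounts to continuity
  in operator norm, so the mean value inequality for \<open>f\<close> minus its derivative at
  \<open>x\<close> gives an estimate uniform in both points.\<close>

lemma smooth_on_strict_derivative:
  fixes f :: "'a::real_normed_vector \<Rightarrow> 'b::real_normed_vector"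
  assumes fd: "fin_dim TYPE('a)" and S: "open S" "x \<in> S" and f: "smooth_on S f" and e: "e > 0"
  obtains d where "d > 0" "cball x d \<subseteq> S"
    "\<And>y z. y \<in> cball x d \<Longrightarrow> z \<in> cball x d \<Longrightarrow>
      norm (f y - f z - frechet_derivative f (at x) (y - z)) \<le> e * norm (y - z)"
proof -
  let ?f' = "\<lambda>x. frechet_derivative f (at x)"
  obtain B :: "'a set" where B: "finite B" "independent B" "span B = UNIV"
    using fin_dim_basis[OF fd] .
  \<comment> \<open>\<open>C\<close> bounds the sum of the absolute coordinates, so a change of less
    than \<open>e / C\<close> in each basis direction changes the derivative by at most
    \<open>e\<close> in operator norm.\<close>
  obtain C where C: "C > 0" "\<And>u. (\<Sum>b\<in>B. \<bar>representation B u b\<bar>) \<le> C * norm u"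
    "\<And>u b. \<bar>representation B u b\<bar> \<le> C * norm u"
    using representation_bound[OF B] by metis
  have "\<forall>\<^sub>F y in at x. norm (?f' y b - ?f' x b) < e / C" for b
  proof -
    have "continuous_on S (\<lambda>y. ?f' y b)"
      using f smooth_on_frechet_derivative smooth_on_imp_continuous_on by blast
    then have "((\<lambda>y. ?f' y b) \<longlongrightarrow> ?f' x b) (at x)"
      using S by (metis continuous_on_eq_continuous_at continuous_within)
    then show ?thesis
      using e C(1) by (auto simp: tendsto_iff dist_norm)
  qed
  then have "\<forall>\<^sub>F y in at x. \<forall>b\<in>B. norm (?f' y b - ?f' x b) < e / C"
    using B(1) by (simp add: eventually_ball_finite_distrib)
  moreover have "\<forall>\<^sub>F y in at x. y \<in> S"
    using S by (intro eventually_at_in_open') auto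
  ultimately have "\<forall>\<^sub>F y in at x. y \<in> S \<and> (\<forall>b\<in>B. norm (?f' y b - ?f' x b) < e / C)"
    by (simp add: eventually_conj)
  then obtain d0 where d0: "d0 > 0" "\<And>y. dist y x < d0 \<Longrightarrow> y \<noteq> x \<Longrightarrow>
      y \<in> S \<and> (\<forall>b\<in>B. norm (?f' y b - ?f' x b) < e / C)"
    unfolding eventually_at by auto
  have d0': "y \<in> S \<and> (\<forall>b\<in>B. norm (?f' y b - ?f' x b) < e / C)" if "dist y x < d0" for y
    using d0(2)[OF that] S e C(1) by (cases "y = x") auto
  show thesis
  proof (rule that[of "d0 / 2"])
    show "0 < d0 / 2" using d0 by simp
    show "cball x (d0 / 2) \<subseteq> S" using d0' d0(1) by (auto simp: dist_commute)
    fix y z assume yz: "y \<in> cball x (d0 / 2)" "z \<in> cball x (d0 / 2)"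
    let ?g = "\<lambda>y. f y - ?f' x y"
    have linx: "bounded_linear (?f' x)"
      using smooth_on_has_derivative[OF f S(2)] has_derivative_bounded_linear by blast
    have "norm (?g y - ?g z) \<le> e * norm (y - z)"
    proof (rule differentiable_bound[where f' = "\<lambda>y v. ?f' y v - ?f' x v" and S = "cball x (d0/2)"])
      fix u assume "u \<in> cball x (d0/2)"
      then have u: "u \<in> S" "\<And>b. b \<in> B \<Longrightarrow> norm (?f' u b - ?f' x b) < e / C"
        using d0'[of u] d0(1) by (auto simp: dist_commute)
      show "(?g has_derivative (\<lambda>v. ?f' u v - ?f' x v)) (at u within cball x (d0/2))"
        by (intro has_derivative_diff has_derivative_at_withinI[OF smooth_on_has_derivative[OF f u(1)]]
            bounded_linear_imp_has_derivative linx)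
      have linu: "bounded_linear (\<lambda>v. ?f' u v - ?f' x v)"
        using smooth_on_has_derivative[OF f u(1)] has_derivative_bounded_linear
        by (intro bounded_linear_sub linx) blast
      show "onorm (\<lambda>v. ?f' u v - ?f' x v) \<le> e"
      proof (rule onorm_bound)
        fix v
        let ?h = "\<lambda>v. ?f' u v - ?f' x v"
        have "?h v = (\<Sum>b\<in>B. representation B v b *\<^sub>R ?h b)"
          by (rule linear_eq_sum_representation[OF B bounded_linear.linear[OF linu]])
        also have "norm \<dots> \<le> (\<Sum>b\<in>B. \<bar>representation B v b\<bar> * (e / C))"
          by (rule sum_norm_le, unfold norm_scaleR, rule mult_left_mono[OF less_imp_le[OF u(2)]]) auto
        also have "\<dots> = (\<Sum>b\<in>B. \<bar>representation B v b\<bar>) * (e / C)" by (rule sum_distrib_right[symmetric])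
        also have "\<dots> \<le> (C * norm v) * (e / C)"
          using C(2)[of v] e C(1) by (intro mult_right_mono) auto
        also have "\<dots> = e * norm v" using C(1) by simp
        finally show "norm (?h v) \<le> e * norm v" .
      qed (use e in simp)
    qed (use yz in auto)
    moreover have "?f' x y - ?f' x z = ?f' x (y - z)"
      using linear_diff[OF bounded_linear.linear[OF linx]] by simp
    ultimately show "norm (f y - f z - ?f' x (y - z)) \<le> e * norm (y - z)"
      by (simp add: algebra_simps)
  qed
qed

lemma smooth_on_locally_lipschitz:
  fixes f :: "'a::real_normed_vector \<Rightarrow> 'b::real_normed_vector"
  assumes fd: "fin_dim TYPE('a)" and S: "open S" "x \<in> S" and f: "smooth_on S f"
  obtains d L where "d > 0" "L > 0" "cball x d \<subseteq> S"
    "\<And>y z. y \<in> cball x d \<Longrightarrow> z \<in> cball x d \<Longrightarrow> norm (f y - f z) \<le> L * norm (y - z)"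
proof -
  let ?f' = "frechet_derivative f (at x)"
  obtain d where d: "d > 0" "cball x d \<subseteq> S"
    "\<And>y z. y \<in> cball x d \<Longrightarrow> z \<in> cball x d \<Longrightarrow> norm (f y - f z - ?f' (y - z)) \<le> 1 * norm (y - z)"
    using smooth_on_strict_derivative[OF fd S f, of 1] by auto
  have bl: "bounded_linear ?f'"
    using smooth_on_has_derivative[OF f S(2)] has_derivative_bounded_linear by blast
  obtain K where K: "K > 0" "\<And>v. norm (?f' v) \<le> norm v * K"
    using bounded_linear.pos_bounded[OF bl] by blast
  show thesis
  proof (rule that[of d "1 + K"])
    fix y z assume "y \<in> cball x d" "z \<in> cball x d"
    then have "norm (f y - f z) \<le> norm (f y - f z - ?f' (y - z)) + norm (?f' (y - z))"
      by (metis add.commute norm_triangle_sub)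
    also have "\<dots> \<le> norm (y - z) + norm (y - z) * K"
      using d(3)[of y z] K(2)[of "y - z"] \<open>y \<in> cball x d\<close> \<open>z \<in> cball x d\<close> by auto
    finally show "norm (f y - f z) \<le> (1 + K) * norm (y - z)" by (simp add: algebra_simps)
  qed (use d K in auto)
qed

text \<open>The surjective half of the inverse function theorem: a preimage of \<open>w\<close> is a
  fixed point of \<open>y - f y + w\<close>, and this map contracts by 1/2 near \<open>x\<close>
  since the derivative of \<open>y - f y\<close> vanishes there.\<close>

lemma smooth_on_local_surj:
  fixes f :: "'a::real_normed_vector \<Rightarrow> 'a"
  assumes fd: "fin_dim TYPE('a)" and S: "open S" "x \<in> S" and f: "smooth_on S f"
    and id: "(f has_derivative (\<lambda>v. v)) (at x)" and r: "r > 0"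
  obtains s where "s > 0" "ball (f x) s \<subseteq> f ` (cball x r \<inter> S)"
proof -
  obtain d where d: "d > 0" "cball x d \<subseteq> S"
    "\<And>y z. y \<in> cball x d \<Longrightarrow> z \<in> cball x d \<Longrightarrow> norm (f y - f z - (y - z)) \<le> 1/2 * norm (y - z)"
    using smooth_on_strict_derivative[OF fd S f, of "1/2"] frechet_derivative_at_eq[OF id] by auto
  define t where "t = min d r"
  have t: "t > 0" "t \<le> d" "t \<le> r" using d(1) r by (auto simp: t_def)
  \<comment> \<open>For \<open>w\<close> within \<open>t / 2\<close> of \<open>f x\<close> the map
    moves the centre by less than \<open>t / 2\<close>; contraction keeps the rest within the other
    half, so the closed ball of radius \<open>t\<close> is mapped into itself.\<close>
  show thesis
  proof (rule that[of "t / 2"])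
    show "t / 2 > 0" using t by simp
    show "ball (f x) (t / 2) \<subseteq> f ` (cball x r \<inter> S)"
    proof
      fix w assume w: "w \<in> ball (f x) (t / 2)"
      let ?h = "\<lambda>y. y - f y + w"
      have contr: "dist (?h y) (?h z) \<le> 1/2 * dist y z" if "y \<in> cball x t" "z \<in> cball x t" for y z
      proof -
        have "dist (?h y) (?h z) = norm (f y - f z - (y - z))"
          unfolding dist_norm by (subst norm_minus_commute) (simp add: algebra_simps)
        also have "\<dots> \<le> 1/2 * dist y z" using d(3)[of y z] that t by (auto simp: dist_norm)
        finally show ?thesis .
      qed
      have "\<exists>!y. y \<in> cball x t \<and> ?h y = y"
      proof (rule Banach_fix[where c = "1/2"])
        show "complete (cball x t)"
          using fin_dim_complete[OF fd] complete_Int_closed[of UNIV "cball x t"] by auto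
        show "?h ` cball x t \<subseteq> cball x t"
        proof clarify
          fix y assume y: "y \<in> cball x t"
          have "dist (?h y) (?h x) \<le> 1/2 * t"
            using contr[OF y, of x] y t by (auto simp: dist_commute)
          moreover have "dist (?h x) x = norm (w - f x)" by (simp add: dist_norm)
          then have "dist (?h x) x < t / 2" using w by (simp add: dist_norm norm_minus_commute)
          ultimately have "dist (?h y) x \<le> t" using dist_triangle[of "?h y" x "?h x"] by simp
          then show "?h y \<in> cball x t" by (simp add: dist_commute)
        qed
      qed (use t contr in \<open>auto simp del: mem_cball\<close>)
      then obtain y where y: "y \<in> cball x t" "?h y = y" by blast
      then have "f y = w" by simp
      moreover have "y \<in> cball x r \<inter> S" using y(1) t d(2) by auto
      ultimately show "w \<in> f ` (cball x r \<inter> S)" by blast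
    qed
  qed
qed

section \<open>Smooth dependence of linear systems and ordinary differential equations\<close>

text \<open>A product rule in which \<open>a\<close> is only continuous at \<open>x\<close>: the
  differentiable factor vanishes there and is already of first order. It serves where the derivative
  of \<open>a\<close> is not yet known to exist.\<close>

lemma has_derivative_scaleR_zero:
  assumes a: "(a \<longlongrightarrow> (0::real)) (at x)" "a x = 0" and g: "(g has_derivative g') (at x)" "g x = 0"
  shows "((\<lambda>y. a y *\<^sub>R g y) has_derivative (\<lambda>_. 0)) (at x)"
proof -
  obtain K where K: "K > 0" "\<And>v. norm (g' v) \<le> norm v * K"
    using bounded_linear.pos_bounded[OF has_derivative_bounded_linear[OF g(1)]] by blast
  have "((\<lambda>y. norm (g y - g x - g' (y - x)) / norm (y - x)) \<longlongrightarrow> 0) (at x)"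
    using g(1) unfolding has_derivative_iff_norm by simp
  then have ev: "\<forall>\<^sub>F y in at x. norm (g y - g x - g' (y - x)) / norm (y - x) < 1"
    by (rule order_tendstoD) simp
  have "((\<lambda>y. norm (a y *\<^sub>R g y - a x *\<^sub>R g x - 0) / norm (y - x)) \<longlongrightarrow> 0) (at x)"
  proof (rule Lim_null_comparison)
    show "((\<lambda>y. \<bar>a y\<bar> * (1 + K)) \<longlongrightarrow> 0) (at x)"
      using tendsto_mult[OF tendsto_rabs[OF a(1)] tendsto_const[of "1 + K"]] by simp
    have *: "\<forall>\<^sub>F y in at x. y \<noteq> x" by (simp add: eventually_at_filter)
    show "\<forall>\<^sub>F y in at x. norm (norm (a y *\<^sub>R g y - a x *\<^sub>R g x - 0) / norm (y - x)) \<le> \<bar>a y\<bar> * (1 + K)"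
      using ev *
    proof eventually_elim
      case (elim y)
      then have "norm (g y - g' (y - x)) < norm (y - x)" using g(2) by (simp add: field_simps)
      then have "norm (g y) \<le> norm (y - x) + norm (y - x) * K"
        using K(2)[of "y - x"] norm_triangle_sub[of "g y" "g' (y - x)"] by linarith
      then have "\<bar>a y\<bar> * norm (g y) \<le> \<bar>a y\<bar> * (norm (y - x) * (1 + K))"
        by (intro mult_left_mono) (auto simp: algebra_simps)
      then show ?case using elim a(2) by (simp add: divide_le_eq mult_ac)
    qed
  qed
  then show ?thesis using a(2) unfolding has_derivative_iff_norm by simp
qed

lemma fin_dim_bounded_linear_inv:
  fixes f :: "'a::real_normed_vector \<Rightarrow> 'a"
  assumes "fin_dim TYPE('a)" "linear f" "inj f"
  shows "bounded_linear (inv_into UNIV f)"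
proof -
  have "f (inv_into UNIV f w) = w" for w
    using fin_dim_linear_inj_surj[OF assms] by (simp add: surj_f_inv_f)
  then have "linear (inv_into UNIV f)"
    by (intro linearI)
      (metis assms(3) inv_f_f linear_add[OF assms(2)], metis assms(3) inv_f_f linear_scale[OF assms(2)])
  then show ?thesis using fin_dim_linear_bounded assms(1) by blast
qed

text \<open>Split \<open>A x (v - u)\<close> into \<open>A y v - A y u\<close> and the error
  \<open>(A x - A y) (v - u)\<close>, then apply the inverse of \<open>A x\<close>. The error is a
  product of two factors that are small when \<open>y\<close> is near \<open>x\<close> and
  \<open>v\<close> near \<open>u\<close>; the basis expansion reduces \<open>A x - A y\<close> to
  fixed directions.\<close>

lemma linear_solve_difference:
  fixes A :: "'a \<Rightarrow> 'b::real_normed_vector \<Rightarrow> 'b"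
  assumes B: "finite B" "independent B" "span B = UNIV" and A: "linear (A x)" "inj (A x)" "linear (A y)"
  shows "v - u = inv_into UNIV (A x) (A y v - A y u)
    + inv_into UNIV (A x) (\<Sum>b\<in>B. representation B (v - u) b *\<^sub>R (A x b - A y b))"
proof -
  have fd: "fin_dim TYPE('b)" using B unfolding fin_dim_def by blast
  let ?e = "\<Sum>b\<in>B. representation B (v - u) b *\<^sub>R (A x b - A y b)"
  have "?e = A x (v - u) - A y (v - u)"
    unfolding linear_eq_sum_representation[OF B A(1), of "v - u"] linear_eq_sum_representation[OF B A(3), of "v - u"]
    by (simp add: scaleR_diff_right sum_subtractf)
  then have "A x (v - u) = (A y v - A y u) + ?e" by (simp add: linear_diff[OF A(3)])
  then show ?thesis
    using fin_dim_bounded_linear_inv[OF fd A(1,2), THEN bounded_linear.linear, THEN linear_add] A(2) by (metis inv_f_f)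
qed

text \<open>With \<open>K\<close> bounding the inverse of \<open>A x\<close> and \<open>C\<close>
  the coordinates, the threshold \<open>1 / (2 * K * C)\<close> on \<open>m y\<close> makes the
  error at most half of \<open>norm (d y)\<close>. It is absorbed, and \<open>d y\<close> is
  controlled by the residual \<open>h y\<close> of the old solution, which tends to 0.\<close>

lemma linear_solve_tendsto:
  fixes A :: "'a::real_normed_vector \<Rightarrow> 'b::real_normed_vector \<Rightarrow> 'b"
  assumes fd: "fin_dim TYPE('b)" and S: "open S" "x \<in> S"
    and A: "\<And>y. y \<in> S \<Longrightarrow> linear (A y)" "inj (A x)"
    and cA: "\<And>b. ((\<lambda>y. A y b) \<longlongrightarrow> A x b) (at x)"
    and cY: "(Y \<longlongrightarrow> Y x) (at x)"
    and u: "\<And>y. y \<in> S \<Longrightarrow> A y (u y) = Y y"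
  shows "(u \<longlongrightarrow> u x) (at x)"
proof -
  obtain B :: "'b set" where B: "finite B" "independent B" "span B = UNIV"
    using fin_dim_basis[OF fd] .
  define R where "R = inv_into UNIV (A x)"
  have R: "bounded_linear R" unfolding R_def using fin_dim_bounded_linear_inv fd A S by blast
  obtain K where K: "K > 0" "\<And>v. norm (R v) \<le> norm v * K"
    using bounded_linear.pos_bounded[OF R] by blast
  obtain C where C: "C > 0" "\<And>u. (\<Sum>b\<in>B. \<bar>representation B u b\<bar>) \<le> C * norm u"
    "\<And>u b. \<bar>representation B u b\<bar> \<le> C * norm u"
    using representation_bound[OF B] by metis
  note A_eq = linear_eq_sum_representation[OF B A(1)]
  define h where "h y = Y y - A y (u x)" for y
  define d where "d y = u y - u x" for y
  define e where "e y = (\<Sum>b\<in>B. representation B (d y) b *\<^sub>R (A x b - A y b))" for y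
  have inS: "\<forall>\<^sub>F y in at x. y \<in> S" using S by (intro eventually_at_in_open') auto
  have d_eq: "d y = R (h y) + R (e y)" if y: "y \<in> S" for y
    unfolding d_def h_def e_def R_def u[OF y, symmetric]
    by (rule linear_solve_difference[where A = A, OF B A(1)[OF S(2)] A(2) A(1)[OF y]])
  define m where "m y = (\<Sum>b\<in>B. norm (A x b - A y b))" for y
  have "(m \<longlongrightarrow> (\<Sum>b\<in>B. norm (A x b - A x b))) (at x)"
    unfolding m_def by (intro tendsto_intros cA)
  then have "(m \<longlongrightarrow> 0) (at x)" by simp
  then have m: "\<forall>\<^sub>F y in at x. m y < 1 / (2 * K * C)"
    by (rule order_tendstoD) (use K C in simp)
  have d_le: "\<forall>\<^sub>F y in at x. norm (d y) \<le> 2 * K * norm (h y)"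
    using m inS
  proof eventually_elim
    case (elim y)
    have "norm (e y) \<le> (\<Sum>b\<in>B. (C * norm (d y)) * norm (A x b - A y b))"
      unfolding e_def by (rule sum_norm_le) (simp add: mult_right_mono C(3))
    also have "\<dots> = (C * norm (d y)) * m y" by (simp add: m_def sum_distrib_left)
    also have "\<dots> \<le> (C * norm (d y)) * (1 / (2 * K * C))"
      using elim C(1) by (intro mult_left_mono) auto
    also have "\<dots> = norm (d y) / (2 * K)" using C(1) by simp
    finally have "norm (e y) * K \<le> norm (d y) / 2" using K(1) by (simp add: field_simps)
    moreover have "norm (d y) \<le> norm (h y) * K + norm (e y) * K"
      unfolding d_eq[OF elim(2)] using norm_triangle_ineq[of "R (h y)" "R (e y)"] K(2)[of "h y"] K(2)[of "e y"]
      by linarith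
    moreover have "2 * K * norm (h y) = 2 * (norm (h y) * K)" by simp
    ultimately show ?case by linarith
  qed
  have "(d \<longlongrightarrow> 0) (at x)"
  proof (rule Lim_null_comparison[OF d_le])
    have "((\<lambda>y. Y y - (\<Sum>b\<in>B. representation B (u x) b *\<^sub>R A y b)) \<longlongrightarrow>
        Y x - (\<Sum>b\<in>B. representation B (u x) b *\<^sub>R A x b)) (at x)"
      by (intro tendsto_intros cA cY)
    moreover have "Y x - (\<Sum>b\<in>B. representation B (u x) b *\<^sub>R A x b) = 0"
      using u[OF S(2)] A_eq[OF S(2), of "u x"] by (metis right_minus_eq)
    ultimately have "((\<lambda>y. Y y - (\<Sum>b\<in>B. representation B (u x) b *\<^sub>R A y b)) \<longlongrightarrow> 0) (at x)"
      by simp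
    then have "(h \<longlongrightarrow> 0) (at x)"
      by (rule Lim_transform_within_open[OF _ S]) (use A_eq in \<open>auto simp: h_def\<close>)
    from tendsto_mult[OF tendsto_const tendsto_norm[OF this], of "2 * K"]
    show "((\<lambda>y. 2 * K * norm (h y)) \<longlongrightarrow> 0) (at x)" by simp
  qed
  then show ?thesis unfolding d_def using LIM_zero_cancel by blast
qed

text \<open>Implicit differentiation of \<open>A y (u y) = Y y\<close>. The increment of
  \<open>u\<close> is the inverse of \<open>A x\<close> applied to a differentiable residual plus
  products of \<open>d\<close> with differences of \<open>A\<close>; the products have derivative 0
  at \<open>x\<close> although \<open>d\<close> is so far only continuous.\<close>

lemma linear_solve_has_derivative:
  fixes A :: "'a::real_normed_vector \<Rightarrow> 'b::real_normed_vector \<Rightarrow> 'b"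
  assumes B: "finite B" "independent B" "span B = (UNIV::'b set)"
    and S: "open S" "x \<in> S"
    and A: "\<And>y. y \<in> S \<Longrightarrow> linear (A y)" "inj (A x)"
    and A': "\<And>b. ((\<lambda>y. A y b) has_derivative A' b) (at x)"
    and Y: "(Y has_derivative Y') (at x)"
    and u: "\<And>y. y \<in> S \<Longrightarrow> A y (u y) = Y y"
  shows "(u has_derivative (\<lambda>w. inv_into UNIV (A x) (Y' w - (\<Sum>b\<in>B. representation B (u x) b *\<^sub>R A' b w)))) (at x)"
proof -
  have fd: "fin_dim TYPE('b)" using B unfolding fin_dim_def by blast
  define R where "R = inv_into UNIV (A x)"
  have R: "bounded_linear R" unfolding R_def using fin_dim_bounded_linear_inv fd A S by blast
  note A_eq = linear_eq_sum_representation[OF B A(1)]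
  define h where "h y = Y y - A y (u x)" for y
  define d where "d y = u y - u x" for y
  define e where "e y = (\<Sum>b\<in>B. representation B (d y) b *\<^sub>R (A x b - A y b))" for y
  have d_eq: "d y = R (h y) + R (e y)" if y: "y \<in> S" for y
    unfolding d_def h_def e_def R_def u[OF y, symmetric]
    by (rule linear_solve_difference[where A = A, OF B A(1)[OF S(2)] A(2) A(1)[OF y]])
  have h': "(h has_derivative (\<lambda>w. Y' w - (\<Sum>b\<in>B. representation B (u x) b *\<^sub>R A' b w))) (at x)"
  proof (rule has_derivative_transform_within_open[OF _ S])
    show "((\<lambda>y. Y y - (\<Sum>b\<in>B. representation B (u x) b *\<^sub>R A y b)) has_derivative
        (\<lambda>w. Y' w - (\<Sum>b\<in>B. representation B (u x) b *\<^sub>R A' b w))) (at x)"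
      by (intro has_derivative_diff has_derivative_sum has_derivative_scaleR_right Y A')
  qed (use A_eq in \<open>auto simp: h_def\<close>)
  have cont: "(f \<longlongrightarrow> f x) (at x)" if "(f has_derivative f') (at x)" for f :: "'a \<Rightarrow> 'b" and f'
    using has_derivative_continuous[OF that] by (simp add: continuous_at)
  have "(u \<longlongrightarrow> u x) (at x)"
    by (rule linear_solve_tendsto[OF fd S A cont[OF A'] cont[OF Y] u])
  then have d0: "(d \<longlongrightarrow> 0) (at x)" unfolding d_def by (rule LIM_zero)
  have rep0: "representation B (d x) b = 0" for b
    by (simp add: d_def representation_zero)
  have "((\<lambda>y. representation B (d y) b *\<^sub>R (A x b - A y b)) has_derivative (\<lambda>_. 0)) (at x)" for b
  proof (rule has_derivative_scaleR_zero)
    show "((\<lambda>y. representation B (d y) b) \<longlongrightarrow> 0) (at x)"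
      using bounded_linear.tendsto[OF bounded_linear_representation[OF B, of b] d0]
      by (simp add: representation_zero)
    show "((\<lambda>y. A x b - A y b) has_derivative (\<lambda>w. 0 - A' b w)) (at x)"
      by (intro has_derivative_diff has_derivative_const A')
  qed (use rep0 in auto)
  from has_derivative_sum[of B, OF this]
  have e': "(e has_derivative (\<lambda>_. 0)) (at x)" by (simp add: e_def [abs_def])
  have "((\<lambda>y. R (h y) + R (e y)) has_derivative
     (\<lambda>w. R (Y' w - (\<Sum>b\<in>B. representation B (u x) b *\<^sub>R A' b w)) + R 0)) (at x)"
    by (intro has_derivative_add bounded_linear.has_derivative[OF R] h' e')
  from has_derivative_add[OF has_derivative_const[of "u x"] this]
  have "((\<lambda>y. u x + (R (h y) + R (e y))) has_derivative
     (\<lambda>w. R (Y' w - (\<Sum>b\<in>B. representation B (u x) b *\<^sub>R A' b w)))) (at x)"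
    using linear_0[OF bounded_linear.linear[OF R]] by simp
  then have "(u has_derivative
     (\<lambda>w. R (Y' w - (\<Sum>b\<in>B. representation B (u x) b *\<^sub>R A' b w)))) (at x)"
    by (rule has_derivative_transform_within_open[OF _ S]) (metis d_def d_eq add.commute diff_add_cancel)
  then show ?thesis by (simp add: R_def)
qed

text \<open>Bootstrapping: a directional derivative of a solution solves a system with the same
  operators \<open>A x\<close> and a right-hand side as regular as \<open>u\<close> and the
  derivative of \<open>Y\<close>. The induction on \<open>k\<close> therefore generalises over
  \<open>u\<close> and \<open>Y\<close>.\<close>

lemma smooth_on_linear_solve:
  fixes A :: "'a::real_normed_vector \<Rightarrow> 'b::real_normed_vector \<Rightarrow> 'b"
  assumes fd: "fin_dim TYPE('b)" and S: "open S"
    and A: "\<And>x. x \<in> S \<Longrightarrow> linear (A x)" "\<And>x. x \<in> S \<Longrightarrow> inj (A x)" "\<And>b. smooth_on S (\<lambda>x. A x b)"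
    and Y: "smooth_on S Y" and u: "\<And>x. x \<in> S \<Longrightarrow> A x (u x) = Y x"
  shows "smooth_on S u"
proof -
  obtain B :: "'b set" where B: "finite B" "independent B" "span B = UNIV"
    using fin_dim_basis[OF fd] .
  let ?A' = "\<lambda>x b. frechet_derivative (\<lambda>x. A x b) (at x)"
  have "Ck_on k S u" if "Ck_on k S Y" "\<And>x. x \<in> S \<Longrightarrow> A x (u x) = Y x" for k u Y
    using that
  proof (induction k arbitrary: u Y)
    case 0
    have "isCont u x" if x: "x \<in> S" for x
      unfolding isCont_def
    proof (rule linear_solve_tendsto[where A = A and Y = Y and u = u, OF fd S x A(1) A(2)[OF x] _ _ 0(2)])
      show "((\<lambda>y. A y b) \<longlongrightarrow> A x b) (at x)" for b
        using smooth_on_imp_continuous_on[OF A(3), of b] x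
        unfolding continuous_on_eq_continuous_at[OF S] isCont_def by blast
      show "(Y \<longlongrightarrow> Y x) (at x)"
        using 0(1) x unfolding Ck_on.simps continuous_on_eq_continuous_at[OF S] isCont_def by blast
    qed
    then show ?case by (simp add: continuous_at_imp_continuous_on)
  next
    case (Suc k)
    note Y = Ck_on_SucE[OF Suc.prems(1)]
    let ?r = "\<lambda>x w. frechet_derivative Y (at x) w - (\<Sum>b\<in>B. representation B (u x) b *\<^sub>R ?A' x b w)"
    have IH: "Ck_on k S u" by (rule Suc.IH[OF Ck_on_SucD[OF Suc.prems(1)] Suc.prems(2)])
    show ?case
    proof (rule Ck_on_SucI[OF S])
      fix x assume x: "x \<in> S"
      show "(u has_derivative (\<lambda>w. inv_into UNIV (A x) (?r x w))) (at x)"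
        by (rule linear_solve_has_derivative[where A = A and Y = Y and u = u, OF B S x A(1) A(2)[OF x] smooth_on_has_derivative[OF A(3) x]
          Y(1)[OF x] Suc.prems(2)])
    next
      fix w
      have A'w: "Ck_on k S (\<lambda>x. ?A' x b w)" for b
        using smooth_on_frechet_derivative[OF A(3)] unfolding smooth_on_def by blast
      have "Ck_on k S (\<lambda>x. frechet_derivative Y (at x) w + (\<Sum>b\<in>B. representation B (- u x) b *\<^sub>R ?A' x b w))"
        by (intro Ck_on_add[OF S] Ck_on_sum[OF S] Ck_on_scaleR[OF S] Y(2) A'w IH
            Ck_on_linear_compose[OF S bounded_linear_representation[OF B]]
            Ck_on_linear_compose[OF S bounded_linear_minus[OF bounded_linear_ident]])
      then have "Ck_on k S (\<lambda>x. ?r x w)"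
        by (simp add: linear_neg[OF linear_representation[OF B(2,3)]] sum_negf)
      moreover have "A x (inv_into UNIV (A x) (?r x w)) = ?r x w" if "x \<in> S" for x
        using fin_dim_linear_inj_surj[OF fd A(1,2)[OF that]] by (simp add: surj_f_inv_f)
      ultimately show "Ck_on k S (\<lambda>x. inv_into UNIV (A x) (?r x w))"
        by (rule Suc.IH[where Y = "\<lambda>x. ?r x w"])
    qed
  qed
  then show ?thesis using Y u unfolding smooth_on_def by blast
qed

section \<open>Existence, uniqueness and smoothness for autonomous ordinary differential
  equations\<close>

lemma norm_integral_diff_le:
  fixes g :: "real \<Rightarrow> 'a::banach"
  assumes g: "continuous_on {a..b} g" "\<And>t. t \<in> {a..b} \<Longrightarrow> norm (g t) \<le> B"
    and st: "s \<in> {a..b}" "t \<in> {a..b}"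
  shows "norm (integral {a..t} g - integral {a..s} g) \<le> B * \<bar>t - s\<bar>"
proof -
  have "norm (integral {a..t} g - integral {a..s} g) \<le> B * norm (t - s)"
  proof (rule differentiable_bound[where S = "{a..b}" and f' = "\<lambda>t h. h *\<^sub>R g t"])
    fix u assume u: "u \<in> {a..b}"
    show "((\<lambda>t. integral {a..t} g) has_derivative (\<lambda>h. h *\<^sub>R g u)) (at u within {a..b})"
      using integral_has_vector_derivative[OF g(1) u] by (simp add: has_vector_derivative_def)
    show "onorm (\<lambda>h. h *\<^sub>R g u) \<le> B"
      using g(2)[OF u] order_trans[OF norm_ge_zero g(2)[OF u]]
      by (intro onorm_bound) (simp_all add: mult.commute[of B] mult_left_mono)
  qed (use st in auto)
  then show ?thesis by simp
qed

lemma picard_lindelof_banach: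
  fixes f :: "'a::banach \<Rightarrow> 'a"
  assumes r: "r > 0" and L: "L > 0"
    and lip: "\<And>y z. y \<in> cball x0 r \<Longrightarrow> z \<in> cball x0 r \<Longrightarrow> norm (f y - f z) \<le> L * norm (y - z)"
  obtains e y where "e > 0" "y 0 = x0" "\<And>t. t \<in> {-e..e} \<Longrightarrow> y t \<in> cball x0 r"
    "\<And>t. t \<in> {-e..e} \<Longrightarrow> (y has_vector_derivative f (y t)) (at t within {-e..e})"
proof -
  define M where "M = norm (f x0) + L * r + 1"
  have M: "M > 0" using r L by (simp add: M_def add_nonneg_pos)
  have fM: "norm (f y) \<le> M" if "y \<in> cball x0 r" for y
  proof -
    have "norm (f y) \<le> norm (f x0) + norm (f y - f x0)" by (rule norm_triangle_sub)
    also have "norm (f y - f x0) \<le> L * norm (y - x0)" using lip that r by simp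
    also have "L * norm (y - x0) \<le> L * r"
      using that L by (intro mult_left_mono) (auto simp: dist_norm norm_minus_commute)
    finally show ?thesis by (simp add: M_def)
  qed
  \<comment> \<open>The first bound keeps curves inside the ball of radius \<open>r\<close>, as
    \<open>M\<close> bounds the speed there; the second makes the integral operator a contraction by
    1/2.\<close>
  define e where "e = min (r / M) (1 / (2 * L))"
  have e: "e > 0" "M * e \<le> r" "L * e \<le> 1 / 2"
    using r M L by (auto simp: e_def min_def field_simps)
  \<comment> \<open>Clamping time to the interval lets the integral operator act on bounded
    continuous functions on the whole line, which form a complete metric space.\<close>
  define c where "c t = max (-e) (min e t)" for t
  have c: "c t \<in> {-e..e}" "\<bar>c t\<bar> \<le> e" for t using e(1) by (auto simp: c_def)
  have cid: "c t = t" if "t \<in> {-e..e}" for t using that by (auto simp: c_def)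
  have cf: "continuous_on (cball x0 r) f"
    by (rule lipschitz_on_continuous_on[of L]) (use lip L in \<open>auto simp: lipschitz_on_def dist_norm\<close>)
  define X where "X = {u :: real \<Rightarrow>\<^sub>C 'a. \<forall>t. apply_bcontfun u t \<in> cball x0 r}"
  define g where "g u s = f (apply_bcontfun u s)" for u :: "real \<Rightarrow>\<^sub>C 'a" and s
  have cg: "continuous_on {-e..e} (g u)" if "u \<in> X" for u
    unfolding g_def using that
    by (intro continuous_on_compose2[OF cf]) (auto simp: X_def intro: continuous_on_apply_bcontfun)
  have gM: "norm (g u t) \<le> M" if "u \<in> X" for u t
    using that fM by (auto simp: X_def g_def)
  \<comment> \<open>Both integrals start at \<open>-e\<close>, so that their difference is the
    signed integral from 0 to \<open>c t\<close> for either sign of \<open>t\<close>.\<close>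
  define F where "F u t = x0 + (integral {-e..c t} (g u) - integral {-e..0} (g u))" for u t
  have F_in: "F u t \<in> cball x0 r" if u: "u \<in> X" for u t
  proof -
    have "norm (integral {-e..c t} (g u) - integral {-e..0} (g u)) \<le> M * \<bar>c t - 0\<bar>"
      by (rule norm_integral_diff_le[OF cg[OF u]]) (use gM[OF u] c e in auto)
    also have "\<dots> \<le> M * e" using c M by (intro mult_left_mono) auto
    finally show ?thesis using e by (simp add: F_def dist_norm norm_minus_commute)
  qed
  have F_cont: "continuous_on UNIV (F u)" if u: "u \<in> X" for u
  proof -
    have "continuous_on {-e..e} (\<lambda>t. integral {-e..t} (g u))"
      using cg[OF u] by (intro indefinite_integral_continuous_1 integrable_continuous_interval)
    then have "continuous_on UNIV (\<lambda>t. integral {-e..c t} (g u))"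
      by (rule continuous_on_compose2) (use c in \<open>auto simp: c_def intro!: continuous_intros\<close>)
    then show ?thesis unfolding F_def by (intro continuous_intros)
  qed
  have F_bc: "F u \<in> bcontfun" if "u \<in> X" for u
    using F_cont[OF that] bounded_subset[OF bounded_cball image_subsetI[OF F_in[OF that]]]
    unfolding bcontfun_def by auto
  define T where "T u = Bcontfun (F u)" for u
  have T: "apply_bcontfun (T u) = F u" if "u \<in> X" for u
    unfolding T_def using F_bc[OF that] by (rule Bcontfun_inverse)
  have "\<exists>!u. u \<in> X \<and> T u = u"
  proof (rule Banach_fix[where c = "1/2"])
    have "X = PiC UNIV (\<lambda>_. cball x0 r)" by (simp add: X_def set_eq_iff mem_PiC_iff Pi_iff)
    then show "complete X" by (simp add: complete_eq_closed closed_PiC)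
    have "const_bcontfun x0 \<in> X" using r by (simp add: X_def)
    then show "X \<noteq> {}" by blast
    show "T ` X \<subseteq> X" using T F_in by (auto simp: X_def)
    show "dist (T u) (T v) \<le> 1 / 2 * dist u v" if uv: "u \<in> X" "v \<in> X" for u v
    proof (rule dist_bound)
      fix t
      have ig: "g w integrable_on {-e..s}" if "w \<in> X" "s \<in> {-e..e}" for w s
        using integrable_continuous_interval[OF continuous_on_subset[OF cg[OF that(1)]]] that(2) by simp
      have "F u t - F v t = integral {-e..c t} (\<lambda>s. g u s - g v s) - integral {-e..0} (\<lambda>s. g u s - g v s)"
        using uv c[of t] e(1) by (simp add: F_def integral_diff ig)
      moreover have "norm (integral {-e..c t} (\<lambda>s. g u s - g v s) - integral {-e..0} (\<lambda>s. g u s - g v s))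
          \<le> (L * dist u v) * \<bar>c t - 0\<bar>"
      proof (rule norm_integral_diff_le)
        show "continuous_on {-e..e} (\<lambda>s. g u s - g v s)" using cg uv by (intro continuous_intros) auto
        fix s
        have "norm (g u s - g v s) \<le> L * dist (apply_bcontfun u s) (apply_bcontfun v s)"
          using lip uv by (simp add: g_def X_def dist_norm)
        also have "\<dots> \<le> L * dist u v"
          using dist_bounded[of u s v] L by (intro mult_left_mono) auto
        finally show "norm (g u s - g v s) \<le> L * dist u v" .
      qed (use c e in auto)
      moreover have "(L * dist u v) * \<bar>c t - 0\<bar> \<le> (L * dist u v) * e"
        using c L by (intro mult_left_mono) auto
      moreover have "(L * dist u v) * e \<le> 1 / 2 * dist u v"
        using mult_right_mono[OF e(3), of "dist u v"] by (simp add: mult_ac)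
      ultimately show "dist (apply_bcontfun (T u) t) (apply_bcontfun (T v) t) \<le> 1 / 2 * dist u v"
        using uv by (simp add: T dist_norm)
    qed
  qed auto
  then obtain u where u: "u \<in> X" "T u = u" by blast
  have uF: "apply_bcontfun u t = F u t" for t using T[OF u(1)] u(2) by simp
  show thesis
  proof (rule that[of e "apply_bcontfun u"])
    show "apply_bcontfun u 0 = x0" using e(1) by (subst uF) (simp add: F_def cid)
    fix t assume t: "t \<in> {-e..e}"
    show "apply_bcontfun u t \<in> cball x0 r" using u(1) by (simp add: X_def)
    have "((\<lambda>t. x0 + (integral {-e..t} (g u) - integral {-e..0} (g u))) has_vector_derivative
      0 + (g u t - 0)) (at t within {-e..e})"
      by (intro has_vector_derivative_add has_vector_derivative_diff has_vector_derivative_const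
          integral_has_vector_derivative cg u t)
    then have "((\<lambda>t. x0 + (integral {-e..t} (g u) - integral {-e..0} (g u))) has_vector_derivative g u t)
      (at t within {-e..e})" by simp
    then have "(apply_bcontfun u has_vector_derivative g u t) (at t within {-e..e})"
      by (rule has_vector_derivative_transform[rotated -1]) (use t in \<open>auto simp: uF F_def cid\<close>)
    then show "(apply_bcontfun u has_vector_derivative f (apply_bcontfun u t)) (at t within {-e..e})"
      by (simp add: g_def)
  qed (use e in auto)
qed

text \<open>The equation is moved to the dual space, which is a Banach space, by the field
  \<open>i (f (p h))\<close>; \<open>p\<close> carries solutions back because
  \<open>p (i u) = u\<close>. Radius and Lipschitz constant change by bounds on \<open>i\<close> and
  \<open>p\<close>.\<close>

lemma picard_lindelof_fin_dim:
  fixes f :: "'a::real_normed_vector \<Rightarrow> 'a"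
  assumes fd: "fin_dim TYPE('a)" and r: "r > 0" and L: "L > 0"
    and lip: "\<And>y z. y \<in> cball x0 r \<Longrightarrow> z \<in> cball x0 r \<Longrightarrow> norm (f y - f z) \<le> L * norm (y - z)"
  obtains e y where "e > 0" "y 0 = x0" "\<And>t. t \<in> {-e..e} \<Longrightarrow> y t \<in> cball x0 r"
    "\<And>t. t \<in> {-e..e} \<Longrightarrow> (y has_vector_derivative f (y t)) (at t within {-e..e})"
proof -
  obtain i :: "'a \<Rightarrow> ('a \<Rightarrow>\<^sub>L real)" and p where i: "bounded_linear i" and p: "bounded_linear p"
    and pi: "\<And>u. p (i u) = u"
    using fin_dim_dual_embedding[OF fd] by blast
  obtain K where K: "K > 0" "\<And>v. norm (p v) \<le> norm v * K"
    using bounded_linear.pos_bounded[OF p] by blast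
  obtain Q where Q: "Q > 0" "\<And>v. norm (i v) \<le> norm v * Q"
    using bounded_linear.pos_bounded[OF i] by blast
  have p_in: "p h \<in> cball x0 r" if "h \<in> cball (i x0) (r / K)" for h
  proof -
    have "norm (p h - x0) = norm (p (h - i x0))" by (simp add: linear_diff[OF bounded_linear.linear[OF p]] pi)
    also have "\<dots> \<le> norm (h - i x0) * K" by (rule K)
    also have "\<dots> \<le> r / K * K"
      using that K(1) by (intro mult_right_mono) (auto simp: dist_norm norm_minus_commute)
    finally show ?thesis using K(1) by (simp add: dist_norm norm_minus_commute)
  qed
  have "norm (i (f (p h)) - i (f (p k))) \<le> (Q * L * K) * norm (h - k)"
    if "h \<in> cball (i x0) (r / K)" "k \<in> cball (i x0) (r / K)" for h k
  proof -
    have "norm (i (f (p h)) - i (f (p k))) \<le> norm (f (p h) - f (p k)) * Q"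
      using Q(2)[of "f (p h) - f (p k)"] by (simp add: linear_diff[OF bounded_linear.linear[OF i]])
    also have "\<dots> \<le> (L * norm (p h - p k)) * Q"
      using lip[OF p_in p_in] that Q by (intro mult_right_mono) auto
    also have "norm (p h - p k) \<le> norm (h - k) * K"
      using K(2)[of "h - k"] by (simp add: linear_diff[OF bounded_linear.linear[OF p]])
    finally show ?thesis using L Q(1) by (simp add: mult_ac mult_left_mono mult_right_mono)
  qed
  moreover have "r / K > 0" "Q * L * K > 0" using r K(1) Q(1) L by simp_all
  ultimately obtain e y where y: "e > 0" "y 0 = i x0" "\<And>t. t \<in> {-e..e} \<Longrightarrow> y t \<in> cball (i x0) (r / K)"
    "\<And>t. t \<in> {-e..e} \<Longrightarrow> (y has_vector_derivative i (f (p (y t)))) (at t within {-e..e})"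
    using picard_lindelof_banach[of "r / K" "Q * L * K" "i x0" "\<lambda>h. i (f (p h))"] by metis
  show thesis
  proof (rule that[of e "\<lambda>t. p (y t)"])
    fix t assume t: "t \<in> {-e..e}"
    show "((\<lambda>t. p (y t)) has_vector_derivative f (p (y t))) (at t within {-e..e})"
      using bounded_linear.has_vector_derivative[OF p y(4)[OF t]] by (simp add: pi)
  qed (use y p_in pi in auto)
qed

text \<open>On so short an interval the mean value inequality bounds the maximal distance of the two
  solutions by half of itself; this takes the place of Gronwall's inequality.\<close>

lemma ode_unique_short:
  fixes f :: "'a::real_normed_vector \<Rightarrow> 'a"
  assumes d: "d \<ge> 0" "L * d \<le> 1 / 2" "L \<ge> 0"
    and lip: "\<And>y z. y \<in> U \<Longrightarrow> z \<in> U \<Longrightarrow> norm (f y - f z) \<le> L * norm (y - z)"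
    and y: "\<And>t. t \<in> {-d..d} \<Longrightarrow> y t \<in> U"
      "\<And>t. t \<in> {-d..d} \<Longrightarrow> (y has_vector_derivative f (y t)) (at t within {-d..d})"
    and z: "\<And>t. t \<in> {-d..d} \<Longrightarrow> z t \<in> U"
      "\<And>t. t \<in> {-d..d} \<Longrightarrow> (z has_vector_derivative f (z t)) (at t within {-d..d})"
    and init: "y 0 = z 0" and t: "t \<in> {-d..d}"
  shows "y t = z t"
proof -
  define w where "w t = y t - z t" for t
  have w': "(w has_vector_derivative (f (y t) - f (z t))) (at t within {-d..d})" if "t \<in> {-d..d}" for t
    unfolding w_def using y(2)[OF that] z(2)[OF that] by (rule has_vector_derivative_diff)
  have "continuous_on {-d..d} (\<lambda>t. norm (w t))"
    unfolding continuous_on_eq_continuous_within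
    using has_vector_derivative_continuous[OF w'] continuous_norm by blast
  then obtain s where s: "s \<in> {-d..d}" "\<And>t. t \<in> {-d..d} \<Longrightarrow> norm (w t) \<le> norm (w s)"
    using continuous_attains_sup[of "{-d..d}" "\<lambda>t. norm (w t)"] d(1) by force
  have "norm (w s - w 0) \<le> (L * norm (w s)) * norm (s - 0)"
  proof (rule differentiable_bound[where S = "{-d..d}" and f' = "\<lambda>t h. h *\<^sub>R (f (y t) - f (z t))"])
    fix u assume u: "u \<in> {-d..d}"
    show "(w has_derivative (\<lambda>h. h *\<^sub>R (f (y u) - f (z u)))) (at u within {-d..d})"
      using w'[OF u] by (simp add: has_vector_derivative_def)
    have "norm (f (y u) - f (z u)) \<le> L * norm (w u)" using lip y(1) z(1) u by (simp add: w_def)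
    also have "\<dots> \<le> L * norm (w s)" using s u d by (intro mult_left_mono) auto
    finally show "onorm (\<lambda>h. h *\<^sub>R (f (y u) - f (z u))) \<le> L * norm (w s)"
      using d(3) by (intro onorm_bound) (simp_all add: mult.commute[of "L * norm (w s)"] mult_left_mono)
  qed (use s d in auto)
  also have "\<dots> \<le> (L * norm (w s)) * d" using s(1) d by (intro mult_left_mono) auto
  also have "\<dots> \<le> 1 / 2 * norm (w s)" using mult_right_mono[OF d(2), of "norm (w s)"] by (simp add: mult_ac)
  finally have "norm (w s) \<le> 0" using init by (simp add: w_def)
  then have "norm (w t) \<le> 0" using s(2)[OF t] by simp
  then show ?thesis by (simp add: w_def)
qed

text \<open>Bootstrapping: the derivative is \<open>f\<close> along the solution and hence as
  regular as the solution itself.\<close>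

lemma ode_solution_smooth:
  fixes f :: "'a::real_normed_vector \<Rightarrow> 'a"
  assumes fd: "fin_dim TYPE('a)" and J: "open J" and S: "open S" "smooth_on S f"
    and y: "\<And>t. t \<in> J \<Longrightarrow> y t \<in> S" "\<And>t. t \<in> J \<Longrightarrow> (y has_vector_derivative f (y t)) (at t)"
  shows "smooth_on J y"
  unfolding smooth_on_def
proof
  fix k show "Ck_on k J y"
  proof (induction k)
    case 0
    show ?case
      using y(2) by (auto intro!: continuous_at_imp_continuous_on has_vector_derivative_continuous)
  next
    case (Suc k)
    show ?case
    proof (rule Ck_on_SucI[OF J])
      show "(y has_derivative (\<lambda>h. h *\<^sub>R f (y t))) (at t)" if "t \<in> J" for t
        using y(2)[OF that] by (simp add: has_vector_derivative_def)
      have "Ck_on k S f" using S(2) by (simp add: smooth_on_def)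
      then have "Ck_on k J (\<lambda>t. f (y t))"
        using y(1) by (intro Ck_on_compose[OF fd J S(1) Suc]) auto
      then show "Ck_on k J (\<lambda>t. h *\<^sub>R f (y t))" for h
        by (rule Ck_on_scaleR[OF J Ck_on_const])
    qed
  qed
qed

section \<open>Smooth maps between manifolds and their derivatives in charts\<close>

text \<open>Unlike \<^locale>\<open>smooth_manifold\<close>, this makes no countability assumption on the type, so that it applies to
  the model space, which is not an instance of \<^class>\<open>second_countable_topology\<close>.\<close>

definition atlas :: "('m::t2_space, 'e::real_normed_vector) chart set \<Rightarrow> bool" where
  "atlas A \<longleftrightarrow> fin_dim TYPE('e) \<and> (\<forall>c\<in>A. is_chart c) \<and> (\<Union>c\<in>A. fst c) = UNIV \<and>
     (\<forall>c\<in>A. \<forall>d\<in>A. smooth_on (snd c ` (fst c \<inter> fst d)) (transition c d))"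

lemma atlas_fin_dim: "atlas (A :: ('m::t2_space, 'e::real_normed_vector) chart set) \<Longrightarrow> fin_dim TYPE('e)"
  by (simp add: atlas_def)

lemma atlas_chart: "atlas A \<Longrightarrow> c \<in> A \<Longrightarrow> is_chart c"
  by (simp add: atlas_def)

lemma atlas_cover: "atlas A \<Longrightarrow> \<exists>c\<in>A. p \<in> fst c"
  unfolding atlas_def by blast

lemma chart_inv_left: "is_chart c \<Longrightarrow> p \<in> fst c \<Longrightarrow> chart_inv c (snd c p) = p"
  by (auto simp: is_chart_def homeomorphism_def)

lemma chart_inv_right: "is_chart c \<Longrightarrow> y \<in> chart_image c \<Longrightarrow> snd c (chart_inv c y) = y"
  by (auto simp: is_chart_def homeomorphism_def)

lemma chart_inv_in: "is_chart c \<Longrightarrow> y \<in> chart_image c \<Longrightarrow> chart_inv c y \<in> fst c"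
  by (auto simp: is_chart_def homeomorphism_def)

lemma chart_in_image: "p \<in> fst c \<Longrightarrow> snd c p \<in> chart_image c"
  by (auto simp: chart_image_def)

lemma chart_open: "is_chart c \<Longrightarrow> open (fst c)" "is_chart c \<Longrightarrow> open (chart_image c)"
  by (auto simp: is_chart_def)

lemma chart_continuous: "is_chart c \<Longrightarrow> continuous_on (fst c) (snd c)"
    "is_chart c \<Longrightarrow> continuous_on (chart_image c) (chart_inv c)"
  by (auto simp: is_chart_def homeomorphism_def)

lemma chart_preimage_open: "is_chart c \<Longrightarrow> open V \<Longrightarrow> open (fst c \<inter> snd c -` V)"
  by (rule continuous_open_preimage[OF chart_continuous(1) chart_open(1)])

lemma chart_image_eq: "is_chart c \<Longrightarrow> snd c ` (fst c \<inter> U) = chart_image c \<inter> chart_inv c -` U"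
  by (auto simp: chart_image_def chart_inv_left intro!: image_eqI)

lemma chart_image_open: "is_chart c \<Longrightarrow> open U \<Longrightarrow> open (snd c ` (fst c \<inter> U))"
  unfolding chart_image_eq using chart_continuous(2) chart_open(2) by (rule continuous_open_preimage)

lemma chart_image_subset_open: "is_chart c \<Longrightarrow> open V \<Longrightarrow> V \<subseteq> fst c \<Longrightarrow> open (snd c ` V)"
  using chart_image_open[of c V] by (simp add: Int_absorb1)

definition smooth_map_on ::
  "'m set \<Rightarrow> ('m::t2_space, 'e::real_normed_vector) chart set \<Rightarrow>
   ('n::t2_space, 'f::real_normed_vector) chart set \<Rightarrow> ('m \<Rightarrow> 'n) \<Rightarrow> bool"
where
  "smooth_map_on U A B f \<longleftrightarrow> continuous_on U f \<and>
     (\<forall>c\<in>A. \<forall>d\<in>B. smooth_on (snd c ` (fst c \<inter> (U \<inter> f -` fst d))) (snd d \<circ> f \<circ> chart_inv c))"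

lemma smooth_map_iff: "smooth_map A B f \<longleftrightarrow> smooth_map_on UNIV A B f"
  by (simp add: smooth_map_def smooth_map_on_def)

lemma smooth_map_onD:
  assumes A: "atlas A" and B: "atlas B" and f: "smooth_map_on U A B f" and U: "open U"
    and c: "c \<in> A" and d: "d \<in> B"
  shows "open (U \<inter> f -` fst d)" "open (snd c ` (fst c \<inter> (U \<inter> f -` fst d)))"
    "smooth_on (snd c ` (fst c \<inter> (U \<inter> f -` fst d))) (snd d \<circ> f \<circ> chart_inv c)"
proof -
  show 1: "open (U \<inter> f -` fst d)"
    using f U chart_open(1)[OF atlas_chart[OF B d]]
    by (intro continuous_open_preimage) (auto simp: smooth_map_on_def)
  show "open (snd c ` (fst c \<inter> (U \<inter> f -` fst d)))"
    using chart_image_open[OF atlas_chart[OF A c] 1] .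
  show "smooth_on (snd c ` (fst c \<inter> (U \<inter> f -` fst d))) (snd d \<circ> f \<circ> chart_inv c)"
    using f c d by (simp add: smooth_map_on_def)
qed

definition locally_smooth ::
  "('m::t2_space, 'e::real_normed_vector) chart set \<Rightarrow> ('n::t2_space, 'f::real_normed_vector) chart set \<Rightarrow>
   ('m \<Rightarrow> 'n) \<Rightarrow> 'm \<Rightarrow> bool"
where
  "locally_smooth A B f p \<longleftrightarrow> (\<exists>c\<in>A. \<exists>d\<in>B. \<exists>V. open V \<and> p \<in> V \<and> V \<subseteq> fst c \<and> f ` V \<subseteq> fst d \<and>
     smooth_on (snd c ` V) (snd d \<circ> f \<circ> chart_inv c))"

text \<open>Compatibility of the charts reduces smoothness, which quantifies over all pairs of
  charts, to one pair near each point; continuity comes from that pair as well.\<close>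

lemma smooth_map_onI:
  fixes A :: "('m::t2_space, 'e::real_normed_vector) chart set"
    and B :: "('n::t2_space, 'f::real_normed_vector) chart set"
  assumes A: "atlas A" and B: "atlas B"
    and loc: "\<And>p. p \<in> U \<Longrightarrow> locally_smooth A B f p"
  shows "smooth_map_on U A B f"
proof -
  have "isCont f p" if "p \<in> U" for p
  proof -
    obtain c d V where c: "c \<in> A" "d \<in> B" "open V" "p \<in> V" "V \<subseteq> fst c" "f ` V \<subseteq> fst d"
      "smooth_on (snd c ` V) (snd d \<circ> f \<circ> chart_inv c)" using loc[OF \<open>p \<in> U\<close>] unfolding locally_smooth_def by blast
    note ch = atlas_chart[OF A c(1)] atlas_chart[OF B c(2)]
    have "chart_inv c (snd c q) = q" if "q \<in> V" for q
      using that c(5) chart_inv_left[OF ch(1)] by blast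
    then have im: "(snd d \<circ> f \<circ> chart_inv c) ` snd c ` V \<subseteq> chart_image d"
      using c(6) by (auto simp: chart_image_def)
    have "continuous_on V (\<lambda>q. chart_inv d ((snd d \<circ> f \<circ> chart_inv c) (snd c q)))"
      by (rule continuous_on_compose2[OF chart_continuous(2)[OF ch(2)]],
          rule continuous_on_compose2[OF smooth_on_imp_continuous_on[OF c(7)]],
          rule continuous_on_subset[OF chart_continuous(1)[OF ch(1)] c(5)])
        (use im in auto)
    moreover have "chart_inv d ((snd d \<circ> f \<circ> chart_inv c) (snd c q)) = f q" if "q \<in> V" for q
    proof -
      have "q \<in> fst c" "f q \<in> fst d" using that c(5,6) by auto
      then show ?thesis using chart_inv_left[OF ch(1)] chart_inv_left[OF ch(2)] by simp
    qed
    ultimately have "continuous_on V f" using continuous_on_cong by (metis (no_types, lifting))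
    then show ?thesis using c(3,4) continuous_on_eq_continuous_at by blast
  qed
  then have cont: "continuous_on U f" by (simp add: continuous_at_imp_continuous_on)
  moreover have "smooth_on (snd c' ` (fst c' \<inter> (U \<inter> f -` fst d'))) (snd d' \<circ> f \<circ> chart_inv c')"
    if c': "c' \<in> A" and d': "d' \<in> B" for c' d'
  proof (rule smooth_on_local)
    fix y assume "y \<in> snd c' ` (fst c' \<inter> (U \<inter> f -` fst d'))"
    then obtain p where p: "y = snd c' p" "p \<in> fst c'" "p \<in> U" "f p \<in> fst d'" by blast
    obtain c d V where c: "c \<in> A" "d \<in> B" "open V" "p \<in> V" "V \<subseteq> fst c" "f ` V \<subseteq> fst d"
      "smooth_on (snd c ` V) (snd d \<circ> f \<circ> chart_inv c)" using loc[OF p(3)] unfolding locally_smooth_def by blast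
    note ch = atlas_chart[OF A c(1)] atlas_chart[OF B c(2)]
      atlas_chart[OF A c'] atlas_chart[OF B d']
    obtain W0 where W0: "open W0" "p \<in> W0" "f ` W0 \<subseteq> fst d'"
    proof -
      obtain W0 where "open W0" "p \<in> W0" "\<forall>x\<in>W0. f x \<in> fst d'"
        using \<open>\<And>p. p \<in> U \<Longrightarrow> isCont f p\<close>[OF p(3)] p(4) chart_open(1)[OF ch(4)]
        unfolding continuous_at_open by blast
      then show thesis by (intro that[of W0]) auto
    qed
    \<comment> \<open>On \<open>W\<close> both charts of the source are defined, and on its image
      both charts of the target. In the primed charts \<open>f\<close> is then the given local
      expression between two transition maps.\<close>
    define W where "W = V \<inter> W0 \<inter> fst c'"
    have W: "open W" "p \<in> W" "W \<subseteq> V" "W \<subseteq> fst c" "W \<subseteq> fst c'" "f ` W \<subseteq> fst d'" "f ` W \<subseteq> fst d"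
      using W0 c p chart_open(1)[OF ch(3)] by (auto simp: W_def)
    have o: "open (snd c' ` W)" "open (snd c ` V)" "open (snd d ` (fst d \<inter> fst d'))"
      by (auto intro!: chart_image_subset_open chart_image_open ch W c(3,5) chart_open)
    have 1: "smooth_on (snd c' ` W) (transition c' c)"
      using A c' c(1) W(4,5) unfolding atlas_def
      by (blast intro: smooth_on_subset)
    have 2: "smooth_on (snd d ` (fst d \<inter> fst d')) (transition d d')"
      using B c(2) d' unfolding atlas_def by blast
    have tr: "transition c' c (snd c' q) = snd c q" "chart_inv c (snd c q) = q" "chart_inv c' (snd c' q) = q"
      if "q \<in> W" for q
    proof -
      have "q \<in> fst c'" "q \<in> fst c" using that W(4,5) by auto
      then show "transition c' c (snd c' q) = snd c q" "chart_inv c (snd c q) = q" "chart_inv c' (snd c' q) = q"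
        using chart_inv_left[OF ch(3)] chart_inv_left[OF ch(1)] by (simp_all add: transition_def)
    qed
    have 12: "smooth_on (snd c' ` W) (\<lambda>y. (snd d \<circ> f \<circ> chart_inv c) (transition c' c y))"
      by (rule smooth_on_compose[OF atlas_fin_dim[OF A] o(1,2) 1 c(7)])
        (use W(3) tr(1) in auto)
    have "smooth_on (snd c' ` W) (\<lambda>y. transition d d' ((snd d \<circ> f \<circ> chart_inv c) (transition c' c y)))"
    proof (rule smooth_on_compose[OF atlas_fin_dim[OF B] o(1,3) 12 2], clarify)
      fix q assume q: "q \<in> W"
      then have "f q \<in> fst d \<inter> fst d'" using W(6,7) by blast
      then show "(snd d \<circ> f \<circ> chart_inv c) (transition c' c (snd c' q)) \<in> snd d ` (fst d \<inter> fst d')"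
        using tr[OF q] by simp
    qed
    then have "smooth_on (snd c' ` W) (snd d' \<circ> f \<circ> chart_inv c')"
    proof (rule smooth_on_cong[OF o(1), rotated])
      fix y assume "y \<in> snd c' ` W"
      then obtain q where q: "q \<in> W" "y = snd c' q" by blast
      then have "f q \<in> fst d" using W by auto
      then show "transition d d' ((snd d \<circ> f \<circ> chart_inv c) (transition c' c y)) = (snd d' \<circ> f \<circ> chart_inv c') y"
        using q tr[OF q(1)] chart_inv_left[OF ch(2)] by (simp add: transition_def)
    qed
    then show "\<exists>T. open T \<and> y \<in> T \<and> smooth_on T (snd d' \<circ> f \<circ> chart_inv c')"
      using o(1) p(1) W(2) by blast
  qed
  ultimately show ?thesis by (simp add: smooth_map_on_def)
qed

lemma smooth_map_on_chartsE:
  assumes A: "atlas A" and B: "atlas B" and f: "smooth_map_on U A B f" and U: "open U"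
    and p: "p \<in> U"
  obtains c d V where "c \<in> A" "d \<in> B" "open V" "p \<in> V" "V \<subseteq> U" "V \<subseteq> fst c" "f ` V \<subseteq> fst d"
    "smooth_on (snd c ` V) (snd d \<circ> f \<circ> chart_inv c)"
proof -
  obtain c d where c: "c \<in> A" "p \<in> fst c" "d \<in> B" "f p \<in> fst d"
    using atlas_cover[OF A] atlas_cover[OF B] by meson
  note s = smooth_map_onD[OF A B f U c(1,3)]
  show thesis
    by (rule that[OF c(1,3), of "fst c \<inter> (U \<inter> f -` fst d)"])
      (use c p s(1,3) chart_open(1)[OF atlas_chart[OF A c(1)]] in auto)
qed

lemma smooth_map_on_subset:
  assumes "smooth_map_on U A B f" "V \<subseteq> U"
  shows "smooth_map_on V A B f"
  unfolding smooth_map_on_def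
proof (intro conjI ballI)
  show "continuous_on V f" using assms continuous_on_subset unfolding smooth_map_on_def by blast
  fix c d assume "c \<in> A" "d \<in> B"
  then have "smooth_on (snd c ` (fst c \<inter> (U \<inter> f -` fst d))) (snd d \<circ> f \<circ> chart_inv c)"
    using assms(1) unfolding smooth_map_on_def by blast
  then show "smooth_on (snd c ` (fst c \<inter> (V \<inter> f -` fst d))) (snd d \<circ> f \<circ> chart_inv c)"
    by (rule smooth_on_subset) (use assms(2) in blast)
qed

lemma smooth_map_on_glue:
  assumes A: "atlas A" and B: "atlas B"
    and loc: "\<And>p. p \<in> U \<Longrightarrow> \<exists>V. open V \<and> p \<in> V \<and> smooth_map_on V A B f"
  shows "smooth_map_on U A B f"
proof (rule smooth_map_onI[OF A B])
  fix p assume "p \<in> U"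
  then obtain V where V: "open V" "p \<in> V" "smooth_map_on V A B f" using loc by blast
  show "locally_smooth A B f p"
    unfolding locally_smooth_def
    by (rule smooth_map_on_chartsE[OF A B V(3,1,2)]) blast
qed

lemma smooth_map_on_cong:
  assumes A: "atlas A" and B: "atlas B" and U: "open U"
    and f: "smooth_map_on U A B f" and eq: "\<And>x. x \<in> U \<Longrightarrow> f x = g x"
  shows "smooth_map_on U A B g"
proof (rule smooth_map_onI[OF A B])
  fix p assume p: "p \<in> U"
  obtain c d V where V: "c \<in> A" "d \<in> B" "open V" "p \<in> V" "V \<subseteq> U" "V \<subseteq> fst c" "f ` V \<subseteq> fst d"
    "smooth_on (snd c ` V) (snd d \<circ> f \<circ> chart_inv c)"
    using smooth_map_on_chartsE[OF A B f U p] .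
  note ch = atlas_chart[OF A V(1)]
  have "smooth_on (snd c ` V) (snd d \<circ> g \<circ> chart_inv c)"
  proof (rule smooth_on_cong[OF chart_image_subset_open[OF ch V(3,6)] _ V(8)])
    fix y assume "y \<in> snd c ` V"
    then obtain q where "q \<in> V" "y = snd c q" by blast
    moreover from this have "q \<in> U" "q \<in> fst c" using V(5,6) by auto
    ultimately show "(snd d \<circ> f \<circ> chart_inv c) y = (snd d \<circ> g \<circ> chart_inv c) y"
      using chart_inv_left[OF ch] eq by simp
  qed
  moreover have "g ` V \<subseteq> fst d" using V eq by force
  ultimately show "locally_smooth A B g p" using V unfolding locally_smooth_def by blast
qed

lemma smooth_map_on_compose:
  assumes A: "atlas A" and B: "atlas B" and C: "atlas C"
    and U: "open U" and V: "open V"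
    and f: "smooth_map_on U A B f" and g: "smooth_map_on V B C g" and UV: "f ` U \<subseteq> V"
  shows "smooth_map_on U A C (\<lambda>x. g (f x))"
proof (rule smooth_map_onI[OF A C])
  fix p assume p: "p \<in> U"
  then have fp: "f p \<in> V" using UV by auto
  obtain c where c: "c \<in> A" "p \<in> fst c" using atlas_cover[OF A] by blast
  obtain d e W where W: "d \<in> B" "e \<in> C" "open W" "f p \<in> W" "W \<subseteq> V" "W \<subseteq> fst d" "g ` W \<subseteq> fst e"
    "smooth_on (snd d ` W) (snd e \<circ> g \<circ> chart_inv d)"
    using smooth_map_on_chartsE[OF B C g V fp] .
  note ch = atlas_chart[OF A c(1)] atlas_chart[OF B W(1)]
  note s = smooth_map_onD[OF A B f U c(1) W(1)]
  define X where "X = fst c \<inter> (U \<inter> f -` W)"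
  have cf: "continuous_on U f" using f by (simp add: smooth_map_on_def)
  have X: "open X" "p \<in> X" "X \<subseteq> fst c" "f ` X \<subseteq> W" "X \<subseteq> U"
    using continuous_open_preimage[OF cf U W(3)] chart_open(1)[OF ch(1)] p c W(4)
    by (auto simp: X_def)
  have oX: "open (snd c ` X)" by (rule chart_image_subset_open[OF ch(1) X(1,3)])
  have "smooth_on (snd c ` X) (\<lambda>y. (snd e \<circ> g \<circ> chart_inv d) ((snd d \<circ> f \<circ> chart_inv c) y))"
  proof (rule smooth_on_compose[OF atlas_fin_dim[OF B] oX _ _ W(8)])
    show "open (snd d ` W)" by (rule chart_image_subset_open[OF ch(2) W(3,6)])
    show "smooth_on (snd c ` X) (snd d \<circ> f \<circ> chart_inv c)"
      by (rule smooth_on_subset[OF s(3) image_mono]) (use X(3-5) W(6) in blast)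
    show "(snd d \<circ> f \<circ> chart_inv c) ` snd c ` X \<subseteq> snd d ` W"
    proof clarify
      fix q assume q: "q \<in> X"
      then have "chart_inv c (snd c q) = q" "f q \<in> W" using X(3,4) chart_inv_left[OF ch(1)] by auto
      then show "(snd d \<circ> f \<circ> chart_inv c) (snd c q) \<in> snd d ` W" by simp
    qed
  qed
  then have "smooth_on (snd c ` X) (snd e \<circ> (\<lambda>x. g (f x)) \<circ> chart_inv c)"
  proof (rule smooth_on_cong[OF oX, rotated])
    fix y assume "y \<in> snd c ` X"
    then obtain q where q: "q \<in> X" "y = snd c q" by blast
    then have "f q \<in> fst d" "chart_inv c (snd c q) = q" using X W chart_inv_left[OF ch(1)] by auto
    then show "(snd e \<circ> g \<circ> chart_inv d) ((snd d \<circ> f \<circ> chart_inv c) y) = (snd e \<circ> (\<lambda>x. g (f x)) \<circ> chart_inv c) y"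
      using q chart_inv_left[OF ch(2)] by simp
  qed
  moreover have "(\<lambda>x. g (f x)) ` X \<subseteq> fst e" using X(4) W(7) by blast
  ultimately show "locally_smooth A C (\<lambda>x. g (f x)) p"
    unfolding locally_smooth_def
    using c W(2) X(1-3) by blast
qed

lemma smooth_map_on_ident:
  assumes A: "atlas A"
  shows "smooth_map_on U A A (\<lambda>x. x)"
proof (rule smooth_map_onI[OF A A])
  fix p assume "p \<in> U"
  obtain c where c: "c \<in> A" "p \<in> fst c" using atlas_cover[OF A] by blast
  note ch = atlas_chart[OF A c(1)]
  have o: "open (snd c ` fst c)" using chart_open(2)[OF ch] by (simp add: chart_image_def)
  have "smooth_on (snd c ` fst c) (snd c \<circ> (\<lambda>x. x) \<circ> chart_inv c)"
    by (rule smooth_on_cong[OF o _ smooth_on_ident[OF o]]) (use chart_inv_left[OF ch] in auto)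
  then show "locally_smooth A A (\<lambda>x. x) p"
    unfolding locally_smooth_def
    using c chart_open(1)[OF ch] by (intro bexI[of _ c] exI[of _ "fst c"]) auto
qed

lemma smooth_map_on_const:
  assumes A: "atlas A" and B: "atlas B"
  shows "smooth_map_on U A B (\<lambda>x. k)"
proof (rule smooth_map_onI[OF A B])
  fix p assume "p \<in> U"
  obtain c d where c: "c \<in> A" "p \<in> fst c" "d \<in> B" "k \<in> fst d"
    using atlas_cover[OF A] atlas_cover[OF B] by meson
  have "smooth_on (snd c ` fst c) (snd d \<circ> (\<lambda>x. k) \<circ> chart_inv c)"
    by (simp add: comp_def smooth_on_const)
  then show "locally_smooth A B (\<lambda>x. k) p"
    unfolding locally_smooth_def
    using c chart_open(1)[OF atlas_chart[OF A c(1)]]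
    by (intro bexI[of _ c] bexI[of _ d] exI[of _ "fst c"]) auto
qed

section \<open>The model space and products as manifolds\<close>

definition std_chart :: "('e, 'e) chart" where
  "std_chart = (UNIV, \<lambda>x. x)"

lemma std_atlas_eq: "std_atlas = {std_chart}"
  by (simp add: std_atlas_def std_chart_def)

lemma std_chart_simps [simp]: "fst std_chart = UNIV" "snd std_chart = (\<lambda>x. x)" "chart_inv std_chart = (\<lambda>x. x)"
  using f_inv_into_f[of _ "\<lambda>x. x" UNIV] by (auto simp: std_chart_def chart_inv_def)

lemma is_chart_std: "is_chart std_chart"
  by (simp add: is_chart_def chart_image_def homeomorphism_def)

lemma atlas_std:
  assumes "fin_dim TYPE('e::real_normed_vector)"
  shows "atlas (std_atlas :: ('e, 'e) chart set)"
  using assms smooth_on_ident[of UNIV]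
  by (auto simp: atlas_def std_atlas_eq is_chart_std transition_def comp_def)

lemmas atlas_real = atlas_std[OF fin_dim_real]

lemma smooth_map_on_std_iff:
  assumes "open U"
  shows "smooth_map_on U std_atlas std_atlas f \<longleftrightarrow> smooth_on U f"
  by (auto simp: smooth_map_on_def std_atlas_eq comp_def smooth_on_imp_continuous_on)

lemma smooth_map_on_chart_inv:
  assumes A: "atlas (A :: ('m::t2_space, 'e::real_normed_vector) chart set)" and c: "c \<in> A"
  shows "smooth_map_on (chart_image c) (std_atlas :: ('e, 'e) chart set) A (chart_inv c)"
proof (rule smooth_map_onI[OF atlas_std[OF atlas_fin_dim[OF A]] A])
  fix p assume p: "p \<in> chart_image c"
  note ch = atlas_chart[OF A c]
  have "smooth_on (snd std_chart ` chart_image c) (snd c \<circ> chart_inv c \<circ> chart_inv std_chart)"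
    using chart_open(2)[OF ch] chart_inv_right[OF ch]
    by (auto intro: smooth_on_cong[OF _ _ smooth_on_ident])
  then show "locally_smooth std_atlas A (chart_inv c) p"
    unfolding locally_smooth_def
    using c p chart_open(2)[OF ch] chart_inv_in[OF ch]
    by (intro bexI[of _ c] bexI[of _ std_chart] exI[of _ "chart_image c"]) (auto simp: std_atlas_eq)
qed

definition prod_chart :: "('m, 'e) chart \<Rightarrow> ('n, 'f) chart \<Rightarrow> ('m \<times> 'n, 'e \<times> 'f) chart" where
  "prod_chart c d = (fst c \<times> fst d, map_prod (snd c) (snd d))"

lemma prod_atlas_eq: "prod_atlas A B = {prod_chart c d |c d. c \<in> A \<and> d \<in> B}"
  by (simp add: prod_atlas_def prod_chart_def)

lemma prod_chart_simps [simp]: "fst (prod_chart c d) = fst c \<times> fst d"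
    "snd (prod_chart c d) (x, y) = (snd c x, snd d y)"
  by (simp_all add: prod_chart_def)

lemma chart_image_prod: "chart_image (prod_chart c d) = chart_image c \<times> chart_image d"
  by (auto simp: chart_image_def prod_chart_def)

lemma chart_inv_prod:
  assumes c: "is_chart c" and d: "is_chart d" and y: "y \<in> chart_image c" "z \<in> chart_image d"
  shows "chart_inv (prod_chart c d) (y, z) = (chart_inv c y, chart_inv d z)"
proof -
  have "inj_on (snd (prod_chart c d)) (fst c \<times> fst d)"
    by (intro inj_onI) (clarsimp, metis chart_inv_left[OF c] chart_inv_left[OF d])
  then show ?thesis
    unfolding chart_inv_def[of "prod_chart c d"]
    by (intro inv_into_f_eq) (use chart_inv_in[OF c y(1)] chart_inv_in[OF d y(2)] chart_inv_right[OF c y(1)]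
        chart_inv_right[OF d y(2)] in auto)
qed

lemma is_chart_prod:
  assumes c: "is_chart c" and d: "is_chart d"
  shows "is_chart (prod_chart c d)"
proof -
  have "homeomorphism (fst (prod_chart c d)) (chart_image (prod_chart c d)) (snd (prod_chart c d)) (chart_inv (prod_chart c d))"
  proof (rule homeomorphismI)
    show "continuous_on (fst (prod_chart c d)) (snd (prod_chart c d))"
      unfolding prod_chart_def map_prod_def case_prod_unfold
      by (auto intro!: continuous_intros continuous_on_compose2[OF chart_continuous(1)[OF c]]
          continuous_on_compose2[OF chart_continuous(1)[OF d]])
    have "continuous_on (chart_image c \<times> chart_image d) (\<lambda>p. (chart_inv c (fst p), chart_inv d (snd p)))"
      by (auto intro!: continuous_intros continuous_on_compose2[OF chart_continuous(2)[OF c]]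
          continuous_on_compose2[OF chart_continuous(2)[OF d]])
    then show "continuous_on (chart_image (prod_chart c d)) (chart_inv (prod_chart c d))"
      unfolding chart_image_prod by (rule continuous_on_eq) (auto simp: chart_inv_prod[OF c d])
  qed (auto simp: chart_image_prod chart_inv_prod[OF c d] chart_in_image chart_inv_left[OF c] chart_inv_left[OF d]
      chart_inv_right[OF c] chart_inv_right[OF d] chart_inv_in[OF c] chart_inv_in[OF d])
  then show ?thesis
    using chart_open[OF c] chart_open[OF d] by (auto simp: is_chart_def chart_image_prod open_Times)
qed

lemma atlas_prod:
  fixes A :: "('m::t2_space, 'e::real_normed_vector) chart set"
    and B :: "('n::t2_space, 'f::real_normed_vector) chart set"
  assumes A: "atlas A" and B: "atlas B"
  shows "atlas (prod_atlas A B)"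
  unfolding atlas_def
proof (intro conjI ballI)
  show "fin_dim TYPE('e \<times> 'f)" by (rule fin_dim_Times[OF atlas_fin_dim[OF A] atlas_fin_dim[OF B]])
  show "is_chart c" if "c \<in> prod_atlas A B" for c
    using that is_chart_prod[OF atlas_chart[OF A] atlas_chart[OF B]]
    by (auto simp: prod_atlas_eq)
  have "\<exists>c\<in>prod_atlas A B. p \<in> fst c" for p
  proof -
    obtain c d where "c \<in> A" "fst p \<in> fst c" "d \<in> B" "snd p \<in> fst d"
      using atlas_cover[OF A] atlas_cover[OF B] by meson
    then have "prod_chart c d \<in> prod_atlas A B" "p \<in> fst (prod_chart c d)"
      unfolding prod_atlas_eq by (blast, simp add: mem_Times_iff)
    then show ?thesis by blast
  qed
  then show "(\<Union>c\<in>prod_atlas A B. fst c) = UNIV" by blast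
  fix c' d' assume "c' \<in> prod_atlas A B" "d' \<in> prod_atlas A B"
  then obtain c1 c2 d1 d2 where c: "c1 \<in> A" "d1 \<in> A" "c2 \<in> B" "d2 \<in> B"
    and c': "c' = prod_chart c1 c2" "d' = prod_chart d1 d2" unfolding prod_atlas_eq by blast
  note ch = atlas_chart[OF A c(1)] atlas_chart[OF B c(3)]
  let ?S = "snd c1 ` (fst c1 \<inter> fst d1)" and ?T = "snd c2 ` (fst c2 \<inter> fst d2)"
  have o: "open ?S" "open ?T"
    by (rule chart_image_open[OF ch(1) chart_open(1)[OF atlas_chart[OF A c(2)]]],
        rule chart_image_open[OF ch(2) chart_open(1)[OF atlas_chart[OF B c(4)]]])
  have ST: "snd c' ` (fst c' \<inter> fst d') = ?S \<times> ?T"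
    by (auto simp: c' image_iff) (metis Int_iff mem_Sigma_iff prod_chart_simps(2))
  have t: "smooth_on ?S (transition c1 d1)" "smooth_on ?T (transition c2 d2)"
    using A B c unfolding atlas_def by blast+
  have oST: "open (?S \<times> ?T)" using o open_Times by blast
  have "smooth_on (?S \<times> ?T) (\<lambda>p. (transition c1 d1 (fst p), transition c2 d2 (snd p)))"
    by (intro smooth_on_Pair oST
        smooth_on_compose[OF atlas_fin_dim[OF A] oST o(1) smooth_on_linear[OF oST bounded_linear_fst] t(1)]
        smooth_on_compose[OF atlas_fin_dim[OF B] oST o(2) smooth_on_linear[OF oST bounded_linear_snd] t(2)])
      auto
  then show "smooth_on (snd c' ` (fst c' \<inter> fst d')) (transition c' d')"
    unfolding ST
  proof (rule smooth_on_cong[OF oST, rotated])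
    fix p assume "p \<in> ?S \<times> ?T"
    then have "fst p \<in> chart_image c1" "snd p \<in> chart_image c2" by (auto simp: chart_image_def)
    then show "(transition c1 d1 (fst p), transition c2 d2 (snd p)) = transition c' d' p"
      using chart_inv_prod[OF ch] by (cases p) (simp add: transition_def c')
  qed
qed

lemma smooth_map_on_Pair:
  assumes A: "atlas A" and B: "atlas B" and C: "atlas C"
    and U: "open U" and f: "smooth_map_on U A B f" and g: "smooth_map_on U A C g"
  shows "smooth_map_on U A (prod_atlas B C) (\<lambda>x. (f x, g x))"
proof (rule smooth_map_onI[OF A atlas_prod[OF B C]])
  fix p assume p: "p \<in> U"
  obtain c d e where c: "c \<in> A" "p \<in> fst c" "d \<in> B" "f p \<in> fst d" "e \<in> C" "g p \<in> fst e"
    using atlas_cover[OF A] atlas_cover[OF B] atlas_cover[OF C] by metis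
  note s = smooth_map_onD[OF A B f U c(1,3)] and t = smooth_map_onD[OF A C g U c(1,5)]
  note ch = atlas_chart[OF A c(1)]
  define V where "V = fst c \<inter> ((U \<inter> f -` fst d) \<inter> (U \<inter> g -` fst e))"
  have V: "open V" "p \<in> V" "V \<subseteq> fst c" "(\<lambda>x. (f x, g x)) ` V \<subseteq> fst (prod_chart d e)"
    using s(1) t(1) chart_open(1)[OF ch] p c by (auto simp: V_def)
  have oV: "open (snd c ` V)" by (rule chart_image_subset_open[OF ch V(1,3)])
  have "smooth_on (snd c ` V) (\<lambda>y. ((snd d \<circ> f \<circ> chart_inv c) y, (snd e \<circ> g \<circ> chart_inv c) y))"
    by (rule smooth_on_Pair[OF oV smooth_on_subset[OF s(3)] smooth_on_subset[OF t(3)]]) (auto simp: V_def)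
  then have "smooth_on (snd c ` V) (snd (prod_chart d e) \<circ> (\<lambda>x. (f x, g x)) \<circ> chart_inv c)"
    by (simp add: comp_def)
  moreover have "prod_chart d e \<in> prod_atlas B C" using c unfolding prod_atlas_eq by blast
  ultimately show "locally_smooth A (prod_atlas B C) (\<lambda>x. (f x, g x)) p"
    unfolding locally_smooth_def
    using c(1) V by blast
qed

section \<open>Derivatives, velocities and tangent vectors in charts\<close>

definition chart_deriv ::
  "('m, 'e::real_normed_vector) chart \<Rightarrow> ('n, 'f::real_normed_vector) chart \<Rightarrow> ('m \<Rightarrow> 'n) \<Rightarrow> 'm \<Rightarrow> 'e \<Rightarrow> 'f"
where
  "chart_deriv c d f p = frechet_derivative (snd d \<circ> f \<circ> chart_inv c) (at (snd c p))"

lemma chart_deriv_works: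
  assumes A: "atlas A" and B: "atlas B" and U: "open U" "p \<in> U"
    and f: "smooth_map_on U A B f" and c: "c \<in> A" "p \<in> fst c" and d: "d \<in> B" "f p \<in> fst d"
  shows "((snd d \<circ> f \<circ> chart_inv c) has_derivative chart_deriv c d f p) (at (snd c p))"
  unfolding chart_deriv_def
  by (rule smooth_on_has_derivative[OF smooth_map_onD(3)[OF A B f U(1) c(1) d(1)]])
    (use U c d in auto)

lemma chart_deriv_linear:
  assumes "atlas A" "atlas B" "open U" "p \<in> U" "smooth_map_on U A B f" "c \<in> A" "p \<in> fst c"
    "d \<in> B" "f p \<in> fst d"
  shows "bounded_linear (chart_deriv c d f p)"
  using chart_deriv_works[OF assms] by (rule has_derivative_bounded_linear)

lemma chart_deriv_compose:
  assumes A: "atlas A" and B: "atlas B" and C: "atlas C"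
    and U: "open U" "p \<in> U" and V: "open V" "f p \<in> V"
    and f: "smooth_map_on U A B f" and g: "smooth_map_on V B C g"
    and c: "c \<in> A" "p \<in> fst c" and d: "d \<in> B" "f p \<in> fst d" and e: "e \<in> C" "g (f p) \<in> fst e"
  shows "chart_deriv c e (\<lambda>x. g (f x)) p w = chart_deriv d e g (f p) (chart_deriv c d f p w)"
proof -
  note ch = atlas_chart[OF A c(1)] atlas_chart[OF B d(1)]
  have "((snd e \<circ> g \<circ> chart_inv d) has_derivative chart_deriv d e g (f p)) (at ((snd d \<circ> f \<circ> chart_inv c) (snd c p)))"
    using chart_deriv_works[OF B C V g d e] chart_inv_left[OF ch(1) c(2)] by simp
  from has_derivative_compose[OF chart_deriv_works[OF A B U f c d] this]
  have D: "((\<lambda>y. (snd e \<circ> g \<circ> chart_inv d) ((snd d \<circ> f \<circ> chart_inv c) y)) has_derivative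
      (\<lambda>w. chart_deriv d e g (f p) (chart_deriv c d f p w))) (at (snd c p))" .
  have oW: "open (snd c ` (fst c \<inter> (U \<inter> f -` fst d)))" by (rule smooth_map_onD(2)[OF A B f U(1) c(1) d(1)])
  have "((snd e \<circ> (\<lambda>x. g (f x)) \<circ> chart_inv c) has_derivative
      (\<lambda>w. chart_deriv d e g (f p) (chart_deriv c d f p w))) (at (snd c p))"
    by (rule has_derivative_transform_within_open[OF D oW])
      (use c U d chart_inv_left[OF ch(1)] chart_inv_left[OF ch(2)] in auto)
  then show ?thesis unfolding chart_deriv_def[of c e] by (simp add: frechet_derivative_at_eq)
qed

lemmas chart_deriv_compose_UNIV = chart_deriv_compose[OF _ _ _ open_UNIV UNIV_I open_UNIV UNIV_I]

lemma chart_deriv_ident: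
  assumes "is_chart c" "p \<in> fst c"
  shows "chart_deriv c c (\<lambda>x. x) p w = w"
proof -
  have "((snd c \<circ> (\<lambda>x. x) \<circ> chart_inv c) has_derivative (\<lambda>w. w)) (at (snd c p))"
    by (rule has_derivative_transform_within_open[OF has_derivative_ident chart_open(2)[OF assms(1)]])
      (use chart_in_image[OF assms(2)] chart_inv_right[OF assms(1)] in simp_all)
  then show ?thesis unfolding chart_deriv_def by (simp add: frechet_derivative_at_eq)
qed

lemma chart_deriv_const: "chart_deriv c d (\<lambda>x. k) p w = 0"
  unfolding chart_deriv_def by (simp add: comp_def frechet_derivative_const)

lemma chart_deriv_Pair:
  assumes "((snd d \<circ> f \<circ> chart_inv c) has_derivative D) (at (snd c p))"
    and "((snd e \<circ> g \<circ> chart_inv c) has_derivative E) (at (snd c p))"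
  shows "chart_deriv c (prod_chart d e) (\<lambda>x. (f x, g x)) p w = (D w, E w)"
proof -
  have "((snd (prod_chart d e) \<circ> (\<lambda>x. (f x, g x)) \<circ> chart_inv c) has_derivative (\<lambda>w. (D w, E w))) (at (snd c p))"
    using has_derivative_Pair[OF assms] by (simp add: comp_def)
  then show ?thesis unfolding chart_deriv_def by (simp add: frechet_derivative_at_eq)
qed

lemma velocity_eq:
  assumes A: "atlas A" and J: "open J" "t \<in> J" and g: "smooth_map_on J std_atlas A \<gamma>"
    and c: "c \<in> A" "\<gamma> t \<in> fst c"
  shows "velocity A \<gamma> t c = chart_deriv std_chart c \<gamma> t 1"
    "((snd c \<circ> \<gamma>) has_vector_derivative velocity A \<gamma> t c) (at t)"
proof -
  have D: "((snd c \<circ> \<gamma>) has_derivative chart_deriv std_chart c \<gamma> t) (at t)"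
    using chart_deriv_works[OF atlas_real A J g _ _ c, of std_chart]
    by (simp add: std_atlas_eq comp_def)
  have lin: "chart_deriv std_chart c \<gamma> t h = h *\<^sub>R chart_deriv std_chart c \<gamma> t 1" for h
    using linear_scale[OF has_derivative_linear[OF D], of h 1] by simp
  have V: "((snd c \<circ> \<gamma>) has_vector_derivative chart_deriv std_chart c \<gamma> t 1) (at t)"
    unfolding has_vector_derivative_def lin[symmetric] by (rule D)
  show 1: "velocity A \<gamma> t c = chart_deriv std_chart c \<gamma> t 1"
    using vector_derivative_at[OF V] c by (simp add: velocity_def charts_at_def)
  show "((snd c \<circ> \<gamma>) has_vector_derivative velocity A \<gamma> t c) (at t)"
    using V 1 by simp
qed

text \<open>A transition map is the identity read in two charts, so the relation between coordinate
  vectors is an instance of \<open>chart_deriv\<close>.\<close>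

lemma tangent_spaceD:
  assumes "v \<in> tangent_space A p" "c \<in> A" "p \<in> fst c" "d \<in> A" "p \<in> fst d"
  shows "v d = chart_deriv c d (\<lambda>x. x) p (v c)"
proof -
  have "c \<in> charts_at A p" "d \<in> charts_at A p" using assms by (simp_all add: charts_at_def)
  then have "v d = frechet_derivative (transition c d) (at (snd c p)) (v c)"
    using assms(1) unfolding tangent_space_def by blast
  then show ?thesis by (simp add: chart_deriv_def transition_def comp_def)
qed

lemma tangent_space_eqI:
  assumes "v \<in> tangent_space A p" "w \<in> tangent_space A p" "c \<in> A" "p \<in> fst c" "v c = w c"
  shows "v = w"
proof
  fix d show "v d = w d"
  proof (cases "d \<in> charts_at A p")
    case True
    then have "d \<in> A" "p \<in> fst d" by (simp_all add: charts_at_def)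
    then show ?thesis
      using assms tangent_spaceD[OF assms(1,3,4), of d] tangent_spaceD[OF assms(2,3,4), of d] by simp
  next
    case False
    then show ?thesis using assms(1,2) unfolding tangent_space_def by (metis (mono_tags, lifting) mem_Collect_eq)
  qed
qed

lemma velocity_in_tangent_space:
  assumes A: "atlas A" and J: "open J" "t \<in> J" and g: "smooth_map_on J std_atlas A \<gamma>"
  shows "velocity A \<gamma> t \<in> tangent_space A (\<gamma> t)"
proof -
  have "velocity A \<gamma> t d = frechet_derivative (transition c d) (at (snd c (\<gamma> t))) (velocity A \<gamma> t c)"
    if "c \<in> charts_at A (\<gamma> t)" "d \<in> charts_at A (\<gamma> t)" for c d
  proof -
    have cd: "c \<in> A" "\<gamma> t \<in> fst c" "d \<in> A" "\<gamma> t \<in> fst d" using that by (auto simp: charts_at_def)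
    have "chart_deriv std_chart d (\<lambda>s. (\<gamma> s)) t 1 = chart_deriv c d (\<lambda>x. x) (\<gamma> t) (chart_deriv std_chart c \<gamma> t 1)"
      by (rule chart_deriv_compose[OF atlas_real A A J open_UNIV UNIV_I g smooth_map_on_ident[OF A]
        _ _ cd]) (simp_all add: std_atlas_eq)
    then show ?thesis
      using velocity_eq(1)[OF A J g cd(1,2)] velocity_eq(1)[OF A J g cd(3,4)]
      by (simp add: chart_deriv_def[of c d] transition_def comp_def)
  qed
  moreover have "velocity A \<gamma> t c = 0" if "c \<notin> charts_at A (\<gamma> t)" for c
    using that by (simp add: velocity_def)
  ultimately show ?thesis unfolding tangent_space_def by blast
qed

lemma tangent_space_lincomb:
  assumes A: "atlas A" and v: "\<And>i. i \<in> I \<Longrightarrow> v i \<in> tangent_space A p"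
  shows "lincomb I a v \<in> tangent_space A p"
  unfolding tangent_space_def
proof (intro CollectI conjI allI ballI impI)
  fix c assume c: "c \<notin> charts_at A p"
  have "v i c = 0" if "i \<in> I" for i
    using v[OF that] c unfolding tangent_space_def by blast
  then show "lincomb I a v c = 0" by (simp add: lincomb_def)
next
  fix c d assume cd: "c \<in> charts_at A p" "d \<in> charts_at A p"
  then have cd': "c \<in> A" "d \<in> A" "p \<in> fst c \<inter> fst d" by (simp_all add: charts_at_def)
  have "smooth_on (snd c ` (fst c \<inter> fst d)) (transition c d)"
    using A cd'(1,2) unfolding atlas_def by blast
  from has_derivative_linear[OF smooth_on_has_derivative[OF this imageI[OF cd'(3)]]]
  have "linear (frechet_derivative (transition c d) (at (snd c p)))" .
  moreover have "v i d = frechet_derivative (transition c d) (at (snd c p)) (v i c)" if "i \<in> I" for i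
    using v[OF that] cd unfolding tangent_space_def by blast
  ultimately show "lincomb I a v d = frechet_derivative (transition c d) (at (snd c p)) (lincomb I a v c)"
    by (simp add: lincomb_def linear_sum linear_scale)
qed

section \<open>Images of low-dimensional cubes and the Baire property\<close>

text \<open>Pigeonhole: a fine grid in \<open>V\<close> has more points than there are cells of comparable size in
  the lower-dimensional parameter cube.\<close>

lemma lipschitz_cube_not_dense:
  fixes h :: "('i \<Rightarrow> real) \<Rightarrow> 'f::real_normed_vector" and E :: "'f set"
  assumes I: "finite I" and E: "finite E" "independent E" "card I < card E"
    and r: "r > 0" and L: "L > 0"
    and lip: "\<And>s t d. \<lbrakk>\<And>i. i \<in> I \<Longrightarrow> \<bar>s i\<bar> \<le> r; \<And>i. i \<in> I \<Longrightarrow> \<bar>t i\<bar> \<le> r; \<And>i. i \<in> I \<Longrightarrow> \<bar>s i - t i\<bar> \<le> d; d \<ge> 0\<rbrakk>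
      \<Longrightarrow> norm (h s - h t) \<le> L * d"
    and V: "open V" "p \<in> V"
  shows "\<not> V \<subseteq> closure (h ` {t. \<forall>i\<in>I. \<bar>t i\<bar> \<le> r})"
proof
  assume dense: "V \<subseteq> closure (h ` {t. \<forall>i\<in>I. \<bar>t i\<bar> \<le> r})"
  obtain C where C: "C > 0" "\<And>a. (\<Sum>b\<in>E. \<bar>a b\<bar>) \<le> C * norm (\<Sum>b\<in>E. a b *\<^sub>R b)"
    using independent_coord_bound[OF E(1,2)] by blast
  obtain s where s: "s > 0" "ball p s \<subseteq> V" using V open_contains_ball by blast
  define S where "S = (\<Sum>b\<in>E. norm b) + 1"
  have S: "S > 0" by (simp add: S_def add_nonneg_pos sum_nonneg)
  \<comment> \<open>Combinations of \<open>E\<close> with coefficients in the interval from 0 to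
    \<open>g\<close> stay within \<open>s\<close> of \<open>p\<close>; the 1 in \<open>S\<close>
    makes this strict and keeps the denominator positive.\<close>
  define g where "g = s / S"
  have g: "g > 0" "g * (\<Sum>b\<in>E. norm b) < s" using s S by (auto simp: g_def S_def field_simps)
  \<comment> \<open>\<open>q\<close> is so large that parameters in a common cell have images at
    distance at most \<open>e / 4\<close>. \<open>N\<close> exceeds \<open>(2 * q) ^ card I\<close>,
    the factor lost in the final count.\<close>
  obtain q :: nat where q: "real q > 8 * L * r * C / g" using reals_Archimedean2 by blast
  then have q0: "q > 0"
    by (metis C(1) L r g(1) divide_pos_pos gr_zeroI less_asym mult_pos_pos of_nat_0 zero_less_numeral)
  define N where "N = (2 * q) ^ card I + 1"
  have N: "N > 0" by (simp add: N_def)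
  define M where "M = q * N"
  have M: "M > 0" using q0 N by (simp add: M_def)
  define x where "x k = p + (\<Sum>b\<in>E. (real (k b) * (g / N)) *\<^sub>R b)" for k :: "'f \<Rightarrow> nat"
  define K where "K = PiE E (\<lambda>_. {..<N})"
  \<comment> \<open>By the coordinate bound \<open>C\<close>, distinct grid points are at least
    \<open>e\<close> apart.\<close>
  define e where "e = g / (N * C)"
  have e: "e > 0" using g N C by (simp add: e_def)
  have x_in: "x k \<in> V" if k: "k \<in> K" for k
  proof -
    have "norm (\<Sum>b\<in>E. (real (k b) * (g / N)) *\<^sub>R b) \<le> (\<Sum>b\<in>E. g * norm b)"
    proof (rule sum_norm_le)
      fix b assume "b \<in> E"
      then have "k b < N" using k by (auto simp: K_def)
      then have "real (k b) * (g / N) \<le> real N * (g / N)" using g by (intro mult_right_mono) auto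
      then have "real (k b) * (g / N) \<le> g" using N by simp
      moreover have "norm ((real (k b) * (g / N)) *\<^sub>R b) = (real (k b) * (g / N)) * norm b" using g by simp
      ultimately show "norm ((real (k b) * (g / N)) *\<^sub>R b) \<le> g * norm b"
        by (metis mult_right_mono norm_ge_zero)
    qed
    also have "\<dots> < s" using g(2) by (simp add: sum_distrib_left)
    finally show ?thesis using s(2) by (auto simp: x_def dist_norm)
  qed
  have sep: "e \<le> norm (x k - x k')" if k: "k \<in> K" "k' \<in> K" "k \<noteq> k'" for k k'
  proof -
    obtain b where b: "b \<in> E" "k b \<noteq> k' b" using k PiE_ext unfolding K_def by metis
    have "1 \<le> \<bar>real (k b) - real (k' b)\<bar>" using b(2) by linarith
    then have "1 * (g / N) \<le> \<bar>real (k b) - real (k' b)\<bar> * (g / N)" using g by (intro mult_right_mono) auto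
    also have "\<dots> = \<bar>(real (k b) - real (k' b)) * (g / N)\<bar>" using g by (simp add: abs_mult)
    also have "\<dots> \<le> (\<Sum>b\<in>E. \<bar>(real (k b) - real (k' b)) * (g / N)\<bar>)"
      using b(1) E(1) by (intro member_le_sum) auto
    also have "\<dots> \<le> C * norm (\<Sum>b\<in>E. ((real (k b) - real (k' b)) * (g / N)) *\<^sub>R b)" by (rule C(2))
    also have "(\<Sum>b\<in>E. ((real (k b) - real (k' b)) * (g / N)) *\<^sub>R b) = x k - x k'"
      by (simp only: x_def left_diff_distrib scaleR_diff_left sum_subtractf) simp
    finally show ?thesis using C(1) N by (simp add: e_def field_simps)
  qed
  have "\<exists>t. (\<forall>i\<in>I. \<bar>t i\<bar> \<le> r) \<and> norm (h t - x k) < e / 4" if "k \<in> K" for k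
  proof -
    have "x k \<in> closure (h ` {t. \<forall>i\<in>I. \<bar>t i\<bar> \<le> r})" using dense x_in[OF that] by blast
    then have "\<exists>y \<in> h ` {t. \<forall>i\<in>I. \<bar>t i\<bar> \<le> r}. dist y (x k) < e / 4"
      unfolding closure_approachable by (rule allE[of _ "e / 4"]) (use e in simp)
    then show ?thesis by (auto simp: dist_norm)
  qed
  then obtain t where t: "\<And>k i. k \<in> K \<Longrightarrow> i \<in> I \<Longrightarrow> \<bar>t k i\<bar> \<le> r"
    "\<And>k. k \<in> K \<Longrightarrow> norm (h (t k) - x k) < e / 4" by metis
  \<comment> \<open>Each side of the cube is cut into \<open>M\<close> pieces of length
    \<open>2 * r / M\<close>; the endpoint \<open>r\<close> receives the index \<open>M\<close>,
    whence \<open>M + 1\<close> indices in the count.\<close>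
  define cell where "cell k = (\<lambda>i\<in>I. nat \<lfloor>(t k i + r) * (M / (2 * r))\<rfloor>)" for k
  have cell_in: "cell k \<in> PiE I (\<lambda>_. {..M})" if k: "k \<in> K" for k
  proof -
    have "nat \<lfloor>(t k i + r) * (M / (2 * r))\<rfloor> \<le> M" if "i \<in> I" for i
    proof -
      have "(t k i + r) * (M / (2 * r)) \<le> (2 * r) * (M / (2 * r))"
        using t(1)[OF k that] r by (intro mult_right_mono) auto
      also have "\<dots> = M" using r by simp
      finally show ?thesis by linarith
    qed
    then show ?thesis unfolding cell_def by auto
  qed
  \<comment> \<open>Grid points sharing a cell would be less than \<open>e\<close> apart: their
    approximations are within \<open>e / 4\<close> of each other, and each approximation is off by
    less than \<open>e / 4\<close>.\<close>
  have "inj_on cell K"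
  proof (rule inj_onI, rule ccontr)
    fix k k' assume k: "k \<in> K" "k' \<in> K" and eq: "cell k = cell k'" and ne: "k \<noteq> k'"
    have "\<bar>t k i - t k' i\<bar> \<le> 2 * r / M" if i: "i \<in> I" for i
    proof -
      let ?a = "(t k i + r) * (M / (2 * r))" and ?b = "(t k' i + r) * (M / (2 * r))"
      have "nat \<lfloor>?a\<rfloor> = nat \<lfloor>?b\<rfloor>" using fun_cong[OF eq, of i] i by (simp add: cell_def)
      moreover have "?a \<ge> 0" "?b \<ge> 0" using t(1)[OF k(1) i] t(1)[OF k(2) i] r by auto
      ultimately have "\<bar>?a - ?b\<bar> \<le> 1" by linarith
      moreover have "?a - ?b = (t k i - t k' i) * (M / (2 * r))"
        by (simp only: left_diff_distrib distrib_right)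
      ultimately have "\<bar>t k i - t k' i\<bar> * (M / (2 * r)) \<le> 1" using r by (simp add: abs_mult)
      then show ?thesis using r M by (simp add: field_simps)
    qed
    then have "norm (h (t k) - h (t k')) \<le> L * (2 * r / M)"
      using t(1) k r by (intro lip) auto
    also have "\<dots> \<le> e / 4"
    proof -
      have "8 * L * r * C \<le> q * g" using q g(1) by (simp add: field_simps)
      then show ?thesis using N q0 C g by (simp add: M_def e_def field_simps)
    qed
    finally have "norm (h (t k) - h (t k')) \<le> e / 4" .
    moreover have "norm (x k - x k') \<le> norm (x k - h (t k)) + norm (h (t k) - h (t k')) + norm (h (t k') - x k')"
      using norm_triangle_ineq[of "x k - h (t k)" "h (t k) - h (t k')"]
        norm_triangle_ineq[of "x k - h (t k')" "h (t k') - x k'"] by simp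
    ultimately show False
      using sep[OF k ne] t(2)[OF k(1)] t(2)[OF k(2)] e by (simp add: norm_minus_commute)
  qed
  then have "card K \<le> card (PiE I (\<lambda>_. {..M}))"
    by (rule card_inj_on_le) (use cell_in I in \<open>auto intro: finite_PiE\<close>)
  then have "N ^ card E \<le> (M + 1) ^ card I" using I E(1) by (simp add: K_def card_PiE)
  also have "\<dots> \<le> (2 * q * N) ^ card I" using M by (intro power_mono) (auto simp: M_def)
  also have "\<dots> = (2 * q) ^ card I * N ^ card I" by (simp add: power_mult_distrib)
  also have "\<dots> < N * N ^ card I" using N by (intro mult_strict_right_mono) (auto simp: N_def)
  also have "\<dots> = N ^ Suc (card I)" by simp
  also have "\<dots> \<le> N ^ card E" using E(3) N by (intro power_increasing) auto
  finally show False by simp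
qed

text \<open>Baire's theorem needs a complete metric, which the manifold does not come with. It is
  applied in the model space to closures of chart images of the \<open>K j\<close>, cut down to a
  closed ball inside one chart image; an open set found there is pulled back.\<close>

lemma atlas_Baire:
  fixes B :: "('m::t2_space, 'f::real_normed_vector) chart set" and K :: "'j \<Rightarrow> 'm set"
  assumes B: "atlas B" and J: "countable J" and cov: "(\<Union>j\<in>J. K j) = UNIV"
  shows "\<exists>j\<in>J. \<exists>U. open U \<and> U \<noteq> {} \<and> U \<subseteq> closure (K j)"
proof -
  \<comment> \<open>\<open>undefined\<close> stands for an arbitrary point of the manifold.\<close>
  obtain d where d: "d \<in> B" "undefined \<in> fst d" using atlas_cover[OF B] by blast
  note ch = atlas_chart[OF B d(1)]
  define y where "y = snd d undefined"
  have y: "y \<in> chart_image d" using chart_in_image[OF d(2)] by (simp add: y_def)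
  then obtain r where r: "r > 0" "cball y r \<subseteq> chart_image d"
    using chart_open(2)[OF ch] open_contains_cball by blast
  define T where "T j = cball y r \<inter> closure (snd d ` (K j \<inter> fst d))" for j
  have "\<exists>j\<in>J. interior (T j) \<noteq> {}"
  proof (rule ccontr)
    assume "\<not> ?thesis"
    then have "Met_TC.mtopology interior_of \<Union>(T ` J) = {}"
      using J fin_dim_complete[OF atlas_fin_dim[OF B]]
      by (intro Met_TC.metric_Baire_category_alt) (auto simp: T_def complete_def Met_TC.mcomplete_def)
    then have "interior (\<Union>(T ` J)) = {}" by simp
    moreover have "cball y r \<subseteq> \<Union>(T ` J)"
    proof
      fix z assume z: "z \<in> cball y r"
      then have zi: "z \<in> chart_image d" using r by blast
      obtain j where j: "j \<in> J" "chart_inv d z \<in> K j" using cov by blast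
      then have "z \<in> snd d ` (K j \<inter> fst d)"
        using chart_inv_right[OF ch zi] chart_inv_in[OF ch zi] by (metis IntI imageI)
      then have "z \<in> closure (snd d ` (K j \<inter> fst d))" by (rule subsetD[OF closure_subset])
      then have "z \<in> T j" using z by (simp add: T_def)
      then show "z \<in> \<Union>(T ` J)" using j(1) by blast
    qed
    then have "ball y r \<subseteq> interior (\<Union>(T ` J))" by (intro interior_maximal) auto
    ultimately show False using r(1) by auto
  qed
  then obtain j where j: "j \<in> J" "interior (T j) \<noteq> {}" by blast
  define U where "U = fst d \<inter> snd d -` interior (T j)"
  have "open U" unfolding U_def
    by (rule chart_preimage_open[OF ch open_interior])
  moreover have "U \<noteq> {}"
  proof -
    obtain z where z: "z \<in> interior (T j)" using j by blast
    then have "z \<in> chart_image d" using interior_subset r(2) unfolding T_def by blast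
    then have "chart_inv d z \<in> U"
      using z chart_inv_right[OF ch] chart_inv_in[OF ch] by (simp add: U_def)
    then show ?thesis by blast
  qed
  moreover have "U \<subseteq> closure (K j)"
  proof
    fix p assume p: "p \<in> U"
    show "p \<in> closure (K j)"
      unfolding closure_iff_nhds_not_empty
    proof (intro allI impI)
      fix S V assume V: "V \<subseteq> S" "open V" "p \<in> V"
      have "snd d p \<in> T j" using p interior_subset by (auto simp: U_def)
      then have "snd d p \<in> closure (snd d ` (K j \<inter> fst d))" by (simp add: T_def)
      moreover have "open (snd d ` (fst d \<inter> V))" by (rule chart_image_open[OF ch V(2)])
      moreover have "snd d p \<in> snd d ` (fst d \<inter> V)" using p V by (auto simp: U_def)
      ultimately have "snd d ` (K j \<inter> fst d) \<inter> snd d ` (fst d \<inter> V) \<noteq> {}"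
        by (metis closure_iff_nhds_not_empty order_refl)
      then obtain a b where "a \<in> K j" "a \<in> fst d" "b \<in> fst d" "b \<in> V" "snd d a = snd d b" by blast
      then have "a \<in> K j \<inter> V" using chart_inv_left[OF ch] by (metis IntI)
      then show "K j \<inter> S \<noteq> {}" using V by blast
    qed
  qed
  ultimately show ?thesis using j(1) by blast
qed

text \<open>This carries density from the manifold to the model space, where cubes are counted. The
  chart domain meets \<open>U\<close> because it contains \<open>K\<close>, which is dense
  there.\<close>

lemma chart_image_dense:
  assumes ch: "is_chart d" and K: "K \<subseteq> fst d" and U: "open U" "U \<noteq> {}" "U \<subseteq> closure K"
  obtains V where "open V" "V \<noteq> {}" "V \<subseteq> closure (snd d ` K)"
proof (rule that)
  show "open (snd d ` (fst d \<inter> U))" by (rule chart_image_open[OF ch U(1)])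
  have "K \<inter> U \<noteq> {}" using U by (metis Int_commute closure_iff_nhds_not_empty ex_in_conv order_refl subsetD)
  then show "snd d ` (fst d \<inter> U) \<noteq> {}" using K by blast
  have "snd d ` (fst d \<inter> closure K) \<subseteq> closure (snd d ` K)"
  proof clarify
    fix p assume p: "p \<in> fst d" "p \<in> closure K"
    show "snd d p \<in> closure (snd d ` K)"
      unfolding closure_iff_nhds_not_empty
    proof (intro allI impI)
      fix S W assume W: "W \<subseteq> S" "open W" "snd d p \<in> W"
      have "open (fst d \<inter> snd d -` W)"
        by (rule chart_preimage_open[OF ch W(2)])
      then have "K \<inter> (fst d \<inter> snd d -` W) \<noteq> {}"
        using p W(3) by (metis IntI closure_iff_nhds_not_empty order_refl vimageI2)
      then show "snd d ` K \<inter> S \<noteq> {}" using W(1) by blast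
    qed
  qed
  then show "snd d ` (fst d \<inter> U) \<subseteq> closure (snd d ` K)" using U(3) by blast
qed

section \<open>Fundamental vector fields of a smooth action\<close>

lemma (in smooth_manifold) atlas: "atlas A"
  using finite_dim charts cover compatible by (auto simp: atlas_def fin_dim_def)

text \<open>A fixed chart at the identity identifies the Lie algebra with the model space
  \<open>'e\<close> by \<open>v c\<close>, so that linear algebra takes place in \<open>'e\<close>
  instead of among families of coordinate vectors.\<close>

locale lie_group_chart = lie_group G A
  for G :: "'g::{t2_space,second_countable_topology} monoid" (structure)
    and A :: "('g, 'e::real_normed_vector) chart set" +
  fixes c :: "('g, 'e) chart"
  assumes c_in: "c \<in> A" and one_in: "\<one> \<in> fst c"

text \<open>Transitivity is not among the assumptions, so that the group acting on itself by left
  multiplication is an instance too.\<close>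

locale smooth_group_action = lie_group_chart G A c + M: smooth_manifold B
  for G :: "'g::{t2_space,second_countable_topology} monoid" (structure)
    and A :: "('g, 'e::real_normed_vector) chart set"
    and c :: "('g, 'e) chart"
    and B :: "('m::{t2_space,second_countable_topology}, 'f::real_normed_vector) chart set" +
  fixes act :: "'g \<Rightarrow> 'm \<Rightarrow> 'm"
  assumes smooth_act: "smooth_map (prod_atlas A B) B (\<lambda>(a, x). act a x)"
    and act_one: "act \<one> x = x" and act_mult: "act (a \<otimes> b) x = act a (act b x)"

context lie_group_chart
begin

lemma in_carrier [simp]: "a \<in> carrier G"
  by (simp add: carrier_UNIV)

lemma is_chart_c: "is_chart c"
  by (rule atlas_chart[OF atlas c_in])

lemma smooth_group_action_mult: "smooth_group_action G A c A (\<otimes>)"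
  using smooth_mult by unfold_locales (auto simp: m_assoc)

end

context smooth_group_action
begin

lemma smooth_act_compose:
  assumes C: "atlas C" and U: "open U" and a: "smooth_map_on U C A \<alpha>" and x: "smooth_map_on U C B \<xi>"
  shows "smooth_map_on U C B (\<lambda>p. act (\<alpha> p) (\<xi> p))"
  using smooth_map_on_compose[OF C atlas_prod[OF atlas M.atlas] M.atlas U open_UNIV
    smooth_map_on_Pair[OF C atlas M.atlas U a x] smooth_act[unfolded smooth_map_iff]]
  by simp

lemma smooth_act_left: "smooth_map_on U B B (act a)"
  using smooth_map_on_subset[OF smooth_act_compose[OF M.atlas open_UNIV smooth_map_on_const[OF M.atlas atlas]
    smooth_map_on_ident[OF M.atlas]] subset_UNIV] .

lemma smooth_act_right: "smooth_map_on U A B (\<lambda>a. act a x)"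
  using smooth_map_on_subset[OF smooth_act_compose[OF atlas open_UNIV
    smooth_map_on_ident[OF atlas] smooth_map_on_const[OF atlas M.atlas]] subset_UNIV] .

text \<open>The derivative of the orbit map of \<open>x\<close> at the identity, read in charts. For
  left multiplication, \<open>mult.fund a c w\<close> is the value at \<open>a\<close> of the
  right-invariant field that is \<open>w\<close> at the identity.\<close>

definition fund :: "'m \<Rightarrow> ('m, 'f) chart \<Rightarrow> 'e \<Rightarrow> 'f" where
  "fund x d = chart_deriv c d (\<lambda>a. act a x) \<one>"

lemma fund_linear: "d \<in> B \<Longrightarrow> x \<in> fst d \<Longrightarrow> bounded_linear (fund x d)"
  unfolding fund_def
  by (rule chart_deriv_linear[OF atlas M.atlas open_UNIV UNIV_I smooth_act_right c_in one_in])
    (simp_all add: act_one)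

text \<open>The value is a partial derivative, in the group direction, of the action read in a
  product chart, taken at the identity and \<open>z\<close>; joint smoothness of the action makes it
  smooth in \<open>z\<close>.\<close>

lemma fund_smooth:
  assumes d: "d \<in> B"
  shows "smooth_on (chart_image d) (\<lambda>z. fund (chart_inv d z) d w)"
proof -
  note ch = atlas_chart[OF M.atlas d]
  note P = atlas_prod[OF atlas M.atlas]
  have pd: "prod_chart c d \<in> prod_atlas A B" using c_in d unfolding prod_atlas_eq by blast
  let ?o = "snd c \<one>"
  let ?F = "snd d \<circ> (\<lambda>(a, x). act a x) \<circ> chart_inv (prod_chart c d)"
  let ?S = "snd (prod_chart c d) ` (fst (prod_chart c d) \<inter> (UNIV \<inter> (\<lambda>(a, x). act a x) -` fst d))"
  note s = smooth_map_onD[OF P M.atlas smooth_act[unfolded smooth_map_iff] open_UNIV pd d]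
  have o: "?o \<in> chart_image c" by (rule chart_in_image[OF one_in])
  have in_S: "(?o, z) \<in> ?S" if z: "z \<in> chart_image d" for z
  proof -
    have "(?o, z) = snd (prod_chart c d) (\<one>, chart_inv d z)" using chart_inv_right[OF ch z] by simp
    moreover have "(\<one>, chart_inv d z) \<in> fst (prod_chart c d) \<inter> (UNIV \<inter> (\<lambda>(a, x). act a x) -` fst d)"
      using chart_inv_in[OF ch z] one_in act_one by simp
    ultimately show ?thesis by (rule image_eqI)
  qed
  have S_sub: "?S \<subseteq> chart_image c \<times> chart_image d"
    unfolding chart_image_prod[symmetric] unfolding chart_image_def[of "prod_chart c d"] by blast
  have eq: "fund (chart_inv d z) d w = frechet_derivative ?F (at (?o, z)) (w, 0)" if z: "z \<in> chart_image d" for z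
  proof -
    have D: "(?F has_derivative frechet_derivative ?F (at (?o, z))) (at (?o, z))"
      by (rule smooth_on_has_derivative[OF s(3) in_S[OF z]])
    have "((\<lambda>y. (y, z)) has_derivative (\<lambda>w. (w, 0))) (at ?o)"
      by (intro derivative_eq_intros) auto
    from has_derivative_compose[OF this D]
    have D2: "((\<lambda>y. ?F (y, z)) has_derivative (\<lambda>w. frechet_derivative ?F (at (?o, z)) (w, 0))) (at ?o)" .
    have "((snd d \<circ> (\<lambda>a. act a (chart_inv d z)) \<circ> chart_inv c) has_derivative
        (\<lambda>w. frechet_derivative ?F (at (?o, z)) (w, 0))) (at ?o)"
    proof (rule has_derivative_transform_within_open[OF D2 chart_open(2)[OF is_chart_c] o])
      fix y assume "y \<in> chart_image c"
      then show "?F (y, z) = (snd d \<circ> (\<lambda>a. act a (chart_inv d z)) \<circ> chart_inv c) y"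
        using chart_inv_prod[OF is_chart_c ch _ z] by simp
    qed
    then show ?thesis
      unfolding fund_def chart_deriv_def by (simp add: frechet_derivative_at_eq)
  qed
  have zs: "smooth_on (chart_image d) (\<lambda>z. (?o, z))"
    by (rule smooth_on_Pair[OF chart_open(2)[OF ch] smooth_on_const smooth_on_ident[OF chart_open(2)[OF ch]]])
  have "smooth_on (chart_image d) (\<lambda>z. frechet_derivative ?F (at (?o, z)) (w, 0))"
    by (rule smooth_on_compose[OF atlas_fin_dim[OF P] chart_open(2)[OF ch] s(2) zs
      smooth_on_frechet_derivative[OF s(3)]]) (use in_S in blast)
  then show ?thesis by (rule smooth_on_cong[OF chart_open(2)[OF ch], rotated]) (simp add: eq)
qed

end

sublocale lie_group_chart \<subseteq> mult: smooth_group_action G A c A "(\<otimes>)"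
  by (rule smooth_group_action_mult)

context smooth_group_action
begin

text \<open>Differentiate \<open>act (b \<otimes> a) x = act b (act a x)\<close> in \<open>b\<close>
  at the identity: the orbit map of \<open>x\<close> takes the right-invariant field of
  \<open>w\<close> to the fundamental field of \<open>w\<close>.\<close>

lemma fund_mult:
  assumes a: "a \<in> fst c" and d: "d \<in> B" "act a x \<in> fst d"
  shows "chart_deriv c d (\<lambda>a. act a x) a (mult.fund a c w) = fund (act a x) d w"
proof -
  have "chart_deriv c d (\<lambda>b. act (b \<otimes> a) x) \<one> w = chart_deriv c d (\<lambda>a. act a x) (\<one> \<otimes> a) (chart_deriv c c (\<lambda>b. b \<otimes> a) \<one> w)"
    by (rule chart_deriv_compose_UNIV[OF atlas atlas M.atlas mult.smooth_act_right smooth_act_right c_in one_in c_in _ d(1)]) (simp_all add: a d)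
  then show ?thesis by (simp add: fund_def mult.fund_def act_mult)
qed

lemma act_velocity:
  assumes J: "open J" "t \<in> J" and g: "smooth_map_on J std_atlas A \<gamma>" "\<gamma> t \<in> fst c"
    and d: "d \<in> B" "act (\<gamma> t) x \<in> fst d"
  shows "velocity B (\<lambda>s. act (\<gamma> s) x) t d = chart_deriv c d (\<lambda>a. act a x) (\<gamma> t) (velocity A \<gamma> t c)"
proof -
  note std = atlas_real
  have sm: "smooth_map_on J std_atlas B (\<lambda>s. act (\<gamma> s) x)"
    by (rule smooth_map_on_compose[OF std atlas M.atlas J(1) open_UNIV g(1) smooth_act_right]) simp
  have "chart_deriv std_chart d (\<lambda>s. act (\<gamma> s) x) t 1
      = chart_deriv c d (\<lambda>a. act a x) (\<gamma> t) (chart_deriv std_chart c \<gamma> t 1)"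
    by (rule chart_deriv_compose[OF std atlas M.atlas J open_UNIV UNIV_I g(1) smooth_act_right
      _ _ c_in g(2) d]) (simp_all add: std_atlas_eq)
  then show ?thesis
    using velocity_eq(1)[OF M.atlas J sm d] velocity_eq(1)[OF atlas J g(1) c_in g(2)] by simp
qed

lemma act_integral_curve:
  assumes J: "open J" "t \<in> J" and g: "smooth_map_on J std_atlas A \<gamma>" "\<gamma> t \<in> fst c"
    and v: "velocity A \<gamma> t c = mult.fund (\<gamma> t) c w"
    and d: "d \<in> B" "act (\<gamma> t) x \<in> fst d"
  shows "velocity B (\<lambda>s. act (\<gamma> s) x) t d = fund (act (\<gamma> t) x) d w"
  using act_velocity[OF J g d] fund_mult[OF g(2) d] v by simp

end

section \<open>Integral curves of right-invariant fields\<close>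

context lie_group_chart
begin

lemma fund_one: "mult.fund \<one> c w = w"
  using chart_deriv_ident[OF is_chart_c one_in] by (simp add: mult.fund_def)

lemmas fund_locally_lipschitz = smooth_on_locally_lipschitz
  [OF atlas_fin_dim[OF atlas] chart_open(2)[OF is_chart_c] chart_in_image[OF one_in] mult.fund_smooth[OF c_in]]

lemma integral_curve_exists:
  obtains e \<gamma> where "e > 0" "smooth_map_on {-e<..<e} std_atlas A \<gamma>" "\<gamma> 0 = \<one>"
    "\<And>t. t \<in> {-e<..<e} \<Longrightarrow> \<gamma> t \<in> fst c \<and> velocity A \<gamma> t c = mult.fund (\<gamma> t) c w"
proof -
  let ?f = "\<lambda>z. mult.fund (chart_inv c z) c w" and ?o = "snd c \<one>"
  note fd = atlas_fin_dim[OF atlas]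
  note std = atlas_real
  have f: "smooth_on (chart_image c) ?f" by (rule mult.fund_smooth[OF c_in])
  obtain r L where r: "r > 0" "L > 0" "cball ?o r \<subseteq> chart_image c"
    "\<And>y z. y \<in> cball ?o r \<Longrightarrow> z \<in> cball ?o r \<Longrightarrow> norm (?f y - ?f z) \<le> L * norm (y - z)"
    using fund_locally_lipschitz[of w] by metis
  obtain e y where e: "e > 0" "y 0 = ?o" "\<And>t. t \<in> {-e..e} \<Longrightarrow> y t \<in> cball ?o r"
    "\<And>t. t \<in> {-e..e} \<Longrightarrow> (y has_vector_derivative ?f (y t)) (at t within {-e..e})"
    using picard_lindelof_fin_dim[OF fd r(1,2,4)] by metis
  let ?J = "{-e<..<e}"
  have y_in: "y t \<in> chart_image c" if "t \<in> ?J" for t using e(3)[of t] r(3) that by auto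
  have y': "(y has_vector_derivative ?f (y t)) (at t)" if "t \<in> ?J" for t
  proof -
    have "(y has_vector_derivative ?f (y t)) (at t within ?J)"
      using e(4)[of t] that by (auto intro: has_vector_derivative_within_subset)
    then show ?thesis using at_within_open[OF that open_greaterThanLessThan] by metis
  qed
  have sy: "smooth_on ?J y"
    by (rule ode_solution_smooth[OF fd _ chart_open(2)[OF is_chart_c] f y_in y']) auto
  define \<gamma> where "\<gamma> t = chart_inv c (y t)" for t
  have s: "smooth_map_on ?J std_atlas A \<gamma>"
    unfolding \<gamma>_def
    by (rule smooth_map_on_compose[OF std atlas_std[OF fd] atlas _ chart_open(2)[OF is_chart_c] _
        smooth_map_on_chart_inv[OF atlas c_in]])
      (use sy y_in in \<open>auto simp: smooth_map_on_std_iff\<close>)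
  show thesis
  proof (rule that[OF e(1) s])
    show "\<gamma> 0 = \<one>" using e(2) chart_inv_left[OF is_chart_c one_in] by (simp add: \<gamma>_def)
    fix t assume t: "t \<in> ?J"
    have gt: "\<gamma> t \<in> fst c" using chart_inv_in[OF is_chart_c y_in[OF t]] by (simp add: \<gamma>_def)
    have "((snd c \<circ> \<gamma>) has_vector_derivative ?f (y t)) (at t)"
      by (rule has_vector_derivative_transform_within_open[OF y'[OF t], of ?J])
        (use t chart_inv_right[OF is_chart_c y_in] in \<open>auto simp: \<gamma>_def\<close>)
    then have "velocity A \<gamma> t c = ?f (y t)"
      using velocity_eq(2)[OF atlas _ t s c_in gt] vector_derivative_unique_at by auto
    then show "\<gamma> t \<in> fst c \<and> velocity A \<gamma> t c = mult.fund (\<gamma> t) c w"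
      using gt by (simp add: \<gamma>_def)
  qed
qed

text \<open>Uniqueness is confined to short symmetric intervals and to curves that stay in
  \<open>U\<close>, where the field is Lipschitz in the chart. The open set \<open>J\<close> around
  the interval gives the curves two-sided velocities at its end points.\<close>

definition unique_integral_curves :: "'e \<Rightarrow> 'g set \<Rightarrow> real \<Rightarrow> bool" where
  "unique_integral_curves w U d0 \<longleftrightarrow> (\<forall>d J \<alpha> \<beta> t. 0 \<le> d \<longrightarrow> d \<le> d0 \<longrightarrow> open J \<longrightarrow> {-d..d} \<subseteq> J \<longrightarrow>
     smooth_map_on J std_atlas A \<alpha> \<longrightarrow> smooth_map_on J std_atlas A \<beta> \<longrightarrow>
     (\<forall>t\<in>{-d..d}. \<alpha> t \<in> U \<and> velocity A \<alpha> t c = mult.fund (\<alpha> t) c w) \<longrightarrow>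
     (\<forall>t\<in>{-d..d}. \<beta> t \<in> U \<and> velocity A \<beta> t c = mult.fund (\<beta> t) c w) \<longrightarrow>
     \<alpha> 0 = \<beta> 0 \<longrightarrow> t \<in> {-d..d} \<longrightarrow> \<alpha> t = \<beta> t)"

lemma integral_curve_unique:
  obtains U d0 where "open U" "\<one> \<in> U" "U \<subseteq> fst c" "d0 > 0"
    "unique_integral_curves w U d0"
proof -
  let ?f = "\<lambda>z. mult.fund (chart_inv c z) c w" and ?o = "snd c \<one>"
  obtain r L where r: "r > 0" "L > 0" "cball ?o r \<subseteq> chart_image c"
    "\<And>y z. y \<in> cball ?o r \<Longrightarrow> z \<in> cball ?o r \<Longrightarrow> norm (?f y - ?f z) \<le> L * norm (y - z)"
    using fund_locally_lipschitz[of w] by metis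
  define U where "U = fst c \<inter> snd c -` ball ?o r"
  show thesis
  proof (rule that[of U "1 / (2 * L)"])
    show "open U" unfolding U_def
      by (rule chart_preimage_open[OF is_chart_c open_ball])
    show "\<one> \<in> U" "U \<subseteq> fst c" "1 / (2 * L) > 0" using r(1,2) one_in by (auto simp: U_def)
    show "unique_integral_curves w U (1 / (2 * L))"
      unfolding unique_integral_curves_def
    proof (intro allI impI)
      fix d J \<alpha> \<beta> t
      assume d: "0 \<le> d" "d \<le> 1 / (2 * L)" and J: "open J" "{-d..d} \<subseteq> J" and s: "smooth_map_on J std_atlas A \<alpha>" "smooth_map_on J std_atlas A \<beta>"
        and a: "\<forall>t\<in>{-d..d}. \<alpha> t \<in> U \<and> velocity A \<alpha> t c = mult.fund (\<alpha> t) c w"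
        and b: "\<forall>t\<in>{-d..d}. \<beta> t \<in> U \<and> velocity A \<beta> t c = mult.fund (\<beta> t) c w"
        and init: "\<alpha> 0 = \<beta> 0" and t: "t \<in> {-d..d}"
      have D: "((snd c \<circ> \<gamma>) has_vector_derivative ?f ((snd c \<circ> \<gamma>) s)) (at s within {-d..d})"
        if "smooth_map_on J std_atlas A \<gamma>" "\<gamma> s \<in> U \<and> velocity A \<gamma> s c = mult.fund (\<gamma> s) c w" "s \<in> {-d..d}" for \<gamma> s
      proof -
        have gc: "\<gamma> s \<in> fst c" using that(2) by (simp add: U_def)
        have "s \<in> J" using that(3) J(2) by blast
        then have "((snd c \<circ> \<gamma>) has_vector_derivative velocity A \<gamma> s c) (at s)"
          by (rule velocity_eq(2)[OF atlas J(1) _ that(1) c_in gc])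
        then show ?thesis
          using that(2) chart_inv_left[OF is_chart_c gc] by (simp add: has_vector_derivative_at_within)
      qed
      have "(snd c \<circ> \<alpha>) t = (snd c \<circ> \<beta>) t"
      proof (rule ode_unique_short[where f = ?f and U = "cball ?o r" and L = L and d = d])
        show "L * d \<le> 1 / 2" using d(2) r(2) by (simp add: field_simps)
        show "((snd c \<circ> \<alpha>) has_vector_derivative ?f ((snd c \<circ> \<alpha>) s)) (at s within {-d..d})" if "s \<in> {-d..d}" for s
          by (rule D[OF s(1) bspec[OF a that] that])
        show "((snd c \<circ> \<beta>) has_vector_derivative ?f ((snd c \<circ> \<beta>) s)) (at s within {-d..d})" if "s \<in> {-d..d}" for s
          by (rule D[OF s(2) bspec[OF b that] that])
        show "(snd c \<circ> \<alpha>) s \<in> cball ?o r" if "s \<in> {-d..d}" for s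
          using bspec[OF a that] by (simp add: U_def less_imp_le)
        show "(snd c \<circ> \<beta>) s \<in> cball ?o r" if "s \<in> {-d..d}" for s
          using bspec[OF b that] by (simp add: U_def less_imp_le)
      qed (use d(1) r(2,4) init t in simp_all)
      moreover have "\<alpha> t \<in> fst c" "\<beta> t \<in> fst c" using bspec[OF a t] bspec[OF b t] by (auto simp: U_def)
      ultimately show "\<alpha> t = \<beta> t" using chart_inv_left[OF is_chart_c] by (metis comp_apply)
    qed
  qed
qed

end

section \<open>One-parameter subgroups\<close>

lemma tangent_space_scaleR:
  assumes "atlas A" "v \<in> tangent_space A p"
  shows "(\<lambda>c. r *\<^sub>R v c) \<in> tangent_space A p"
  using tangent_space_lincomb[of A "{()}" "\<lambda>_. v" p "\<lambda>_. r"] assms by (simp add: lincomb_def)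

lemma smooth_map_on_shift:
  assumes A: "atlas A" and J: "open J" "open J'" and g: "smooth_map_on J std_atlas A \<gamma>"
    and sub: "\<And>u. u \<in> J' \<Longrightarrow> u + s \<in> J"
  shows "smooth_map_on J' std_atlas A (\<lambda>u::real. \<gamma> (u + s))"
proof (rule smooth_map_on_compose[OF atlas_real atlas_real A J(2,1) _ g])
  show "smooth_map_on J' std_atlas std_atlas (\<lambda>u. u + s)"
    unfolding smooth_map_on_std_iff[OF J(2)]
    by (rule smooth_on_add[OF J(2) smooth_on_ident[OF J(2)] smooth_on_const])
qed (use sub in auto)

lemma velocity_shift:
  assumes A: "atlas A" and J: "open J" "t + s \<in> J" and g: "smooth_map_on J std_atlas A \<gamma>"
    and c: "c \<in> A" "\<gamma> (t + s) \<in> fst c"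
  shows "velocity A (\<lambda>u. \<gamma> (u + s)) t c = velocity A \<gamma> (t + s) c"
proof -
  have "((\<lambda>u. u + s) has_vector_derivative 1) (at t)"
    by (auto intro!: derivative_eq_intros)
  from vector_diff_chain_at[OF this velocity_eq(2)[OF A J g c]]
  have "((snd c \<circ> (\<lambda>u. \<gamma> (u + s))) has_vector_derivative velocity A \<gamma> (t + s) c) (at t)"
    by (simp add: comp_def)
  from vector_derivative_at[OF this] show ?thesis
    using c by (simp add: velocity_def charts_at_def)
qed

lemma velocity_scale:
  assumes A: "atlas A" and J: "open J" "r * t \<in> J" and g: "smooth_map_on J std_atlas A \<gamma>"
    and c: "c \<in> A" "\<gamma> (r * t) \<in> fst c"
  shows "velocity A (\<lambda>u. \<gamma> (r * u)) t c = r *\<^sub>R velocity A \<gamma> (r * t) c"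
proof -
  have "((\<lambda>u. r * u) has_vector_derivative r) (at t)"
    by (auto intro!: derivative_eq_intros)
  from vector_diff_chain_at[OF this velocity_eq(2)[OF A J g c]]
  have "((snd c \<circ> (\<lambda>u. \<gamma> (r * u))) has_vector_derivative r *\<^sub>R velocity A \<gamma> (r * t) c) (at t)"
    by (simp add: comp_def)
  from vector_derivative_at[OF this] show ?thesis
    using c by (simp add: velocity_def charts_at_def)
qed

lemma real_div_power2_less:
  fixes t e :: real
  assumes "e > 0"
  obtains n where "\<bar>t\<bar> / 2 ^ n < e"
proof -
  obtain n where "\<bar>t\<bar> / e < 2 ^ n" using real_arch_pow[of 2 "\<bar>t\<bar> / e"] by auto
  then show thesis using that[of n] assms by (simp add: field_simps)
qed

context lie_group_chart
begin

lemma continuous_mult: "continuous_on UNIV (\<lambda>(a, b). a \<otimes> b)"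
  using smooth_mult by (simp add: smooth_map_def)

text \<open>For fixed \<open>t\<close> both \<open>\<gamma> (u + t)\<close> and
  \<open>\<gamma> u \<otimes> \<gamma> t\<close> are integral curves in \<open>u\<close> of the
  right-invariant field, and both start at \<open>\<gamma> t\<close>; uniqueness gives the addition
  law for small parameters.\<close>

lemma local_one_parameter_subgroup:
  obtains e \<gamma> where "e > 0" "smooth_map_on {-e<..<e} std_atlas A \<gamma>" "\<gamma> 0 = \<one>" "velocity A \<gamma> 0 c = w"
    "\<And>s t. \<bar>s\<bar> < e \<Longrightarrow> \<bar>t\<bar> < e \<Longrightarrow> \<gamma> (s + t) = \<gamma> s \<otimes> \<gamma> t"
proof -
  obtain e0 \<gamma> where e0: "e0 > 0" "smooth_map_on {-e0<..<e0} std_atlas A \<gamma>" "\<gamma> 0 = \<one>"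
    "\<And>t. t \<in> {-e0<..<e0} \<Longrightarrow> \<gamma> t \<in> fst c \<and> velocity A \<gamma> t c = mult.fund (\<gamma> t) c w"
    using integral_curve_exists[of w] by blast
  obtain U d0 where U: "open U" "\<one> \<in> U" "U \<subseteq> fst c" "d0 > 0"
    "unique_integral_curves w U d0"
    using integral_curve_unique[of w] by blast
  let ?J = "{-e0<..<e0}"
  have cg: "continuous_on ?J \<gamma>" using e0(2) by (simp add: smooth_map_on_def)
  have "continuous_on (?J \<times> ?J) (\<lambda>p. (\<lambda>(a, b). a \<otimes> b) (\<gamma> (fst p), \<gamma> (snd p)))"
    by (rule continuous_on_compose2[OF continuous_mult])
      (auto intro!: continuous_on_Pair continuous_on_compose2[OF cg] continuous_on_fst continuous_on_snd continuous_on_id)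
  then have "open ((?J \<times> ?J) \<inter> (\<lambda>p. (\<lambda>(a, b). a \<otimes> b) (\<gamma> (fst p), \<gamma> (snd p))) -` U)" (is "open ?N")
    by (rule continuous_open_preimage[OF _ _ U(1)]) (auto intro!: open_Times)
  moreover have "(0, 0) \<in> ?N" using e0 U(2) by simp
  ultimately obtain X Y where XY: "open X" "open Y" "(0, 0) \<in> X \<times> Y" "X \<times> Y \<subseteq> ?N"
    by (rule open_prod_elim)
  have "open (X \<inter> Y)" "0 \<in> X \<inter> Y" using XY by auto
  then obtain r where r: "r > 0" "ball 0 r \<subseteq> X \<inter> Y"
    using open_contains_ball by blast
  have in_U: "\<gamma> s \<otimes> \<gamma> t \<in> U" "s \<in> ?J" if "\<bar>s\<bar> < r" "\<bar>t\<bar> < r" for s t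
  proof -
    have "s \<in> ball 0 r" "t \<in> ball 0 r" using that by simp_all
    then have "(s, t) \<in> ?N" using XY(4) r(2) by blast
    then show "\<gamma> s \<otimes> \<gamma> t \<in> U" "s \<in> ?J" by auto
  qed
  have in_U1: "\<gamma> s \<in> U" if "\<bar>s\<bar> < r" for s
    using in_U(1)[OF that, of 0] r(1) e0(3) by simp
  \<comment> \<open>Half of \<open>r\<close> leaves room for the sum of two parameters;
    \<open>d0\<close> is the length on which uniqueness holds.\<close>
  define e where "e = min (r / 2) d0"
  have e: "e > 0" "e \<le> r / 2" "e \<le> d0" using r U(4) by (auto simp: e_def)
  show thesis
  proof (rule that[of e \<gamma>])
    show "smooth_map_on {-e<..<e} std_atlas A \<gamma>"
      by (rule smooth_map_on_subset[OF e0(2)]) (use in_U(2)[of _ 0] e r in auto)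
    show "velocity A \<gamma> 0 c = w" using e0(1,3) e0(4)[of 0] fund_one by simp
    fix s t :: real assume st: "\<bar>s\<bar> < e" "\<bar>t\<bar> < e"
    let ?I = "{-e<..<e}"
    have uJ: "u + t \<in> ?J" "\<bar>u + t\<bar> < r" "\<bar>u\<bar> < r" "u \<in> ?J" if "u \<in> ?I" for u
      using that st e in_U(2)[of "u + t" 0] in_U(2)[of "u" 0] r(1) by auto
    have \<beta>: "smooth_map_on ?I std_atlas A (\<lambda>u. \<gamma> u \<otimes> \<gamma> t)"
      by (rule smooth_map_on_compose[OF atlas_real atlas atlas _ open_UNIV
            smooth_map_on_subset[OF e0(2)] mult.smooth_act_right]) (use uJ in auto)
    have "\<gamma> (s + t) = \<gamma> s \<otimes> \<gamma> t"
    proof (rule U(5)[unfolded unique_integral_curves_def, rule_format, where d = "\<bar>s\<bar>" and J = ?I and \<alpha> = "\<lambda>u. \<gamma> (u + t)" and \<beta> = "\<lambda>u. \<gamma> u \<otimes> \<gamma> t"])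
      show "smooth_map_on ?I std_atlas A (\<lambda>u. \<gamma> (u + t))"
        by (rule smooth_map_on_shift[OF atlas _ _ e0(2)]) (use uJ in auto)
      fix u assume "u \<in> {- \<bar>s\<bar>..\<bar>s\<bar>}"
      then have u: "u \<in> ?I" using st by auto
      note uj = uJ[OF u]
      have "velocity A (\<lambda>u. \<gamma> (u + t)) u c = velocity A \<gamma> (u + t) c"
        by (rule velocity_shift[OF atlas _ uj(1) e0(2) c_in]) (use e0(4)[OF uj(1)] in auto)
      then show "\<gamma> (u + t) \<in> U \<and> velocity A (\<lambda>u. \<gamma> (u + t)) u c = mult.fund (\<gamma> (u + t)) c w"
        using e0(4)[OF uj(1)] in_U1[OF uj(2)] by simp
      have "\<bar>t\<bar> < r" using st(2) e r(1) by linarith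
      then have *: "\<gamma> u \<otimes> \<gamma> t \<in> U" using in_U(1)[OF uj(3)] by blast
      have "velocity A (\<lambda>u. \<gamma> u \<otimes> \<gamma> t) u c = mult.fund (\<gamma> u \<otimes> \<gamma> t) c w"
        by (rule mult.act_integral_curve[OF _ uj(4) e0(2) _ _ c_in]) (use e0(4)[OF uj(4)] * U(3) in auto)
      then show "\<gamma> u \<otimes> \<gamma> t \<in> U \<and> velocity A (\<lambda>u. \<gamma> u \<otimes> \<gamma> t) u c = mult.fund (\<gamma> u \<otimes> \<gamma> t) c w"
        using * by simp
    qed (use st e \<beta> e0(3) in auto)
    then show "\<gamma> (s + t) = \<gamma> s \<otimes> \<gamma> t" .
  qed (use e e0(3) in auto)
qed

text \<open>A local one-parameter subgroup extends to the line by raising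
  \<open>\<gamma> (t / 2 ^ n)\<close> to the power \<open>2 ^ n\<close>. This does not depend on
  \<open>n\<close> once \<open>t / 2 ^ n\<close> is small, as each further halving is undone by a
  squaring.\<close>

lemma one_param_exists:
  "\<exists>\<gamma>. one_parameter_subgroup G A \<gamma> \<and> velocity A \<gamma> 0 c = w"
proof -
  obtain e \<gamma> where g: "e > 0" "smooth_map_on {-e<..<e} std_atlas A \<gamma>" "\<gamma> 0 = \<one>" "velocity A \<gamma> 0 c = w"
    "\<And>s t. \<bar>s\<bar> < e \<Longrightarrow> \<bar>t\<bar> < e \<Longrightarrow> \<gamma> (s + t) = \<gamma> s \<otimes> \<gamma> t"
    using local_one_parameter_subgroup[of w] by blast
  define P where "P n t = \<gamma> (t / 2 ^ n) [^] (2 ^ n :: nat)" for n :: nat and t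
  define \<Gamma> where "\<Gamma> t = P (LEAST n. \<bar>t\<bar> / 2 ^ n < e) t" for t
  have P_Suc: "P (Suc n) t = P n t" if "\<bar>t\<bar> / 2 ^ n < e" for n t
  proof -
    let ?s = "t / 2 ^ Suc n"
    have "\<bar>?s\<bar> < e" using that by (auto simp: field_simps)
    then have "\<gamma> (?s + ?s) = \<gamma> ?s \<otimes> \<gamma> ?s" by (intro g(5))
    then have "\<gamma> (t / 2 ^ n) = \<gamma> ?s [^] (2 :: nat)" by (simp add: numeral_2_eq_2)
    then show ?thesis by (simp add: P_def nat_pow_pow)
  qed
  have \<Gamma>_eq: "\<Gamma> t = P n t" if "\<bar>t\<bar> / 2 ^ n < e" for n t
  proof -
    let ?m = "LEAST n. \<bar>t\<bar> / 2 ^ n < e"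
    have m: "\<bar>t\<bar> / 2 ^ ?m < e" by (rule LeastI[where P = "\<lambda>n. \<bar>t\<bar> / 2 ^ n < e", OF that])
    have "?m \<le> n" by (rule Least_le[where P = "\<lambda>n. \<bar>t\<bar> / 2 ^ n < e", OF that])
    then have "P n t = P ?m t"
    proof (induction n rule: dec_induct)
      case (step k)
      have "\<bar>t\<bar> / 2 ^ k \<le> \<bar>t\<bar> / 2 ^ ?m"
        using step(1) by (intro divide_left_mono power_increasing) auto
      then show ?case using P_Suc[of t k] step m by simp
    qed simp
    then show ?thesis by (simp add: \<Gamma>_def)
  qed
  have hom: "\<Gamma> (s + t) = \<Gamma> s \<otimes> \<Gamma> t" for s t
  proof -
    obtain n where n: "\<bar>\<bar>s\<bar> + \<bar>t\<bar>\<bar> / 2 ^ n < e" using real_div_power2_less[OF g(1)] .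
    have le: "\<bar>u\<bar> / 2 ^ n < e" if "\<bar>u\<bar> \<le> \<bar>\<bar>s\<bar> + \<bar>t\<bar>\<bar>" for u
      using divide_right_mono[OF that, of "2 ^ n"] n by simp
    have st: "\<bar>s / 2 ^ n\<bar> < e" "\<bar>t / 2 ^ n\<bar> < e" using le[of s] le[of t] by simp_all
    \<comment> \<open>Values of \<open>\<gamma>\<close> at small parameters commute because addition
      does, so powers distribute over their product.\<close>
    have "\<gamma> (s / 2 ^ n) \<otimes> \<gamma> (t / 2 ^ n) = \<gamma> (t / 2 ^ n) \<otimes> \<gamma> (s / 2 ^ n)"
      using g(5)[OF st] g(5)[OF st(2,1)] by (simp add: add.commute)
    from pow_mult_distrib[OF this, of "2 ^ n"]
    have "P n (s + t) = P n s \<otimes> P n t" using g(5)[OF st] by (simp add: P_def add_divide_distrib)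
    then show ?thesis using \<Gamma>_eq[OF le, of "s + t"] \<Gamma>_eq[OF le, of s] \<Gamma>_eq[OF le, of t] by simp
  qed
  have \<Gamma>_\<gamma>: "\<Gamma> t = \<gamma> t" if "\<bar>t\<bar> < e" for t
    using \<Gamma>_eq[of t 0] that by (simp add: P_def)
  have "smooth_map_on UNIV std_atlas A \<Gamma>"
  proof (rule smooth_map_on_glue[OF atlas_real atlas], intro exI conjI)
    fix t0 :: real
    let ?V = "{t0 - e<..<t0 + e}"
    show "open ?V" "t0 \<in> ?V" using g(1) by auto
    \<comment> \<open>Near \<open>t0\<close> the extension is \<open>\<gamma>\<close>, shifted in
      time and translated by \<open>\<Gamma> t0\<close>.\<close>
    have "smooth_map_on ?V std_atlas A (\<lambda>t. \<gamma> (t + (- t0)))"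
      by (rule smooth_map_on_shift[OF atlas _ _ g(2)]) auto
    from smooth_map_on_compose[OF atlas_real atlas atlas _ open_UNIV this
        mult.smooth_act_left[of UNIV "\<Gamma> t0"]]
    have "smooth_map_on ?V std_atlas A (\<lambda>t. \<Gamma> t0 \<otimes> \<gamma> (t + (- t0)))" by simp
    then show "smooth_map_on ?V std_atlas A \<Gamma>"
    proof (rule smooth_map_on_cong[OF atlas_real atlas, rotated])
      fix t assume "t \<in> ?V"
      then have "\<bar>t + (- t0)\<bar> < e" by auto
      then show "\<Gamma> t0 \<otimes> \<gamma> (t + (- t0)) = \<Gamma> t" using hom[of t0 "t + (- t0)"] by (simp add: \<Gamma>_\<gamma>)
    qed simp
  qed
  then have "one_parameter_subgroup G A \<Gamma>"
    using hom by (simp add: one_parameter_subgroup_def smooth_map_iff)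
  moreover have "velocity A \<Gamma> 0 c = w"
  proof -
    have "((snd c \<circ> \<gamma>) has_vector_derivative w) (at 0)"
      using velocity_eq(2)[OF atlas _ _ g(2) c_in, of 0] g(1,3,4) one_in by simp
    then have "((snd c \<circ> \<Gamma>) has_vector_derivative w) (at 0)"
      by (rule has_vector_derivative_transform_within_open[of _ _ _ "{-e<..<e}"]) (use g(1) \<Gamma>_\<gamma> in auto)
    then show ?thesis
      using vector_derivative_at g(1,3) \<Gamma>_\<gamma>[of 0] c_in one_in by (simp add: velocity_def charts_at_def)
  qed
  ultimately show ?thesis by blast
qed

lemma one_paramD:
  assumes "one_parameter_subgroup G A \<gamma>"
  shows "smooth_map_on U std_atlas A \<gamma>" "\<gamma> (s + t) = \<gamma> s \<otimes> \<gamma> t" "\<gamma> 0 = \<one>"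
proof -
  show 1: "\<gamma> (s + t) = \<gamma> s \<otimes> \<gamma> t" for s t using assms by (simp add: one_parameter_subgroup_def)
  show "smooth_map_on U std_atlas A \<gamma>"
    by (rule smooth_map_on_subset[OF _ subset_UNIV])
      (use assms in \<open>simp add: one_parameter_subgroup_def smooth_map_iff\<close>)
  have "\<gamma> 0 \<otimes> \<gamma> 0 = \<gamma> 0" using 1[of 0 0] by simp
  then show "\<gamma> 0 = \<one>" by simp
qed

end

context smooth_group_action
begin

lemma one_param_velocity_0:
  assumes g: "one_parameter_subgroup G A \<gamma>" and d: "d \<in> B" "x \<in> fst d"
  shows "velocity B (\<lambda>s. act (\<gamma> s) x) 0 d = fund x d (velocity A \<gamma> 0 c)"
  using act_velocity[OF open_UNIV UNIV_I one_paramD(1)[OF g] _ d(1), of 0 x]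
    one_paramD(3)[OF g] one_in d(2) by (simp add: act_one fund_def)

lemma smooth_orbit_curve:
  assumes g: "one_parameter_subgroup G A \<gamma>"
  shows "smooth_map_on U std_atlas B (\<lambda>s. act (\<gamma> s) x)"
proof -
  have "smooth_map_on UNIV std_atlas B (\<lambda>s. act (\<gamma> s) x)"
    by (rule smooth_map_on_compose[OF atlas_real atlas M.atlas open_UNIV open_UNIV
      one_paramD(1)[OF g] smooth_act_right]) simp
  then show ?thesis by (rule smooth_map_on_subset) simp
qed

text \<open>The addition law moves time \<open>t\<close> to 0 and the base point to
  \<open>act (\<gamma> t) x\<close>; thus orbits of one-parameter subgroups are integral curves of
  fundamental fields.\<close>

lemma one_param_velocity:
  assumes g: "one_parameter_subgroup G A \<gamma>" and d: "d \<in> B" "act (\<gamma> t) x \<in> fst d"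
  shows "velocity B (\<lambda>s. act (\<gamma> s) x) t d = fund (act (\<gamma> t) x) d (velocity A \<gamma> 0 c)"
proof -
  have "velocity B (\<lambda>s. act (\<gamma> s) x) t d = velocity B (\<lambda>s. act (\<gamma> (s + t)) x) 0 d"
    using velocity_shift[OF M.atlas open_UNIV UNIV_I smooth_orbit_curve[OF g, of UNIV x] d(1), of 0 t] d(2) by simp
  also have "(\<lambda>s. act (\<gamma> (s + t)) x) = (\<lambda>s. act (\<gamma> s) (act (\<gamma> t) x))"
    by (simp add: one_paramD(2)[OF g] act_mult)
  finally show ?thesis using one_param_velocity_0[OF g d] by simp
qed

end

context lie_group_chart
begin

lemma one_param_pow:
  assumes g: "one_parameter_subgroup G A \<gamma>"
  shows "\<gamma> (real n * t) = \<gamma> t [^] n"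
proof (induction n)
  case 0
  show ?case using one_paramD(3)[OF g] by simp
next
  case (Suc n)
  have "real (Suc n) * t = real n * t + t" by (simp add: distrib_right)
  then show ?case using one_paramD(2)[OF g, of "real n * t" t] Suc by simp
qed

text \<open>Both are integral curves of one right-invariant field, so they agree near 0; their
  values at \<open>t\<close> are powers of their values at \<open>t / 2 ^ n\<close>.\<close>

lemma one_param_unique:
  assumes a: "one_parameter_subgroup G A \<alpha>" and b: "one_parameter_subgroup G A \<beta>"
    and eq: "velocity A \<alpha> 0 c = velocity A \<beta> 0 c"
  shows "\<alpha> = \<beta>"
proof
  fix t
  define w where "w = velocity A \<alpha> 0 c"
  obtain U d0 where U: "open U" "\<one> \<in> U" "U \<subseteq> fst c" "d0 > 0"
    "unique_integral_curves w U d0"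
    using integral_curve_unique[of w] by blast
  have ode: "velocity A \<gamma> s c = mult.fund (\<gamma> s) c w" if "one_parameter_subgroup G A \<gamma>" "velocity A \<gamma> 0 c = w" "\<gamma> s \<in> U" for \<gamma> s
    using mult.one_param_velocity[OF that(1) c_in, of s \<one>] that(2,3) U(3) by auto
  have near: "\<exists>r>0. \<forall>s. \<bar>s\<bar> < r \<longrightarrow> \<gamma> s \<in> U" if g: "one_parameter_subgroup G A \<gamma>" for \<gamma>
  proof -
    have "continuous_on UNIV \<gamma>" using one_paramD(1)[OF g, of UNIV] by (simp add: smooth_map_on_def)
    then have "open (\<gamma> -` U)" using U(1) by (simp add: open_vimage)
    moreover have "0 \<in> \<gamma> -` U" using one_paramD(3)[OF g] U(2) by simp
    ultimately obtain r where "r > 0" "ball 0 r \<subseteq> \<gamma> -` U" using open_contains_ball by blast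
    then show ?thesis by (intro exI[of _ r]) auto
  qed
  obtain r1 where r1: "r1 > 0" "\<And>s. \<bar>s\<bar> < r1 \<Longrightarrow> \<alpha> s \<in> U" using near[OF a] by blast
  obtain r2 where r2: "r2 > 0" "\<And>s. \<bar>s\<bar> < r2 \<Longrightarrow> \<beta> s \<in> U" using near[OF b] by blast
  define r where "r = min d0 (min r1 r2)"
  have r: "r > 0" "r \<le> d0" "r \<le> r1" "r \<le> r2" using r1 r2 U(4) by (auto simp: r_def)
  have local: "\<alpha> s = \<beta> s" if s: "\<bar>s\<bar> < r" for s
  proof (rule U(5)[unfolded unique_integral_curves_def, rule_format, where d = "\<bar>s\<bar>" and J = UNIV and \<alpha> = \<alpha> and \<beta> = \<beta>])
    fix u assume "u \<in> {- \<bar>s\<bar>..\<bar>s\<bar>}"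
    then have "\<bar>u\<bar> < r" using s by auto
    then have "\<alpha> u \<in> U" "\<beta> u \<in> U" using r r1(2) r2(2) by auto
    then show "\<alpha> u \<in> U \<and> velocity A \<alpha> u c = mult.fund (\<alpha> u) c w" "\<beta> u \<in> U \<and> velocity A \<beta> u c = mult.fund (\<beta> u) c w"
      using ode[OF a, of u] ode[OF b, of u] eq by (simp_all add: w_def)
  qed (use s r one_paramD[OF a] one_paramD[OF b] in auto)
  obtain n where n: "\<bar>t\<bar> / 2 ^ n < r" using real_div_power2_less[OF r(1)] .
  have "\<gamma> t = \<gamma> (t / 2 ^ n) [^] (2 ^ n :: nat)" if "one_parameter_subgroup G A \<gamma>" for \<gamma>
    using one_param_pow[OF that, of "2 ^ n" "t / 2 ^ n"] by simp
  then show "\<alpha> t = \<beta> t" using local[of "t / 2 ^ n"] n a b by (metis abs_divide abs_numeral power_abs)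
qed

text \<open>The curve exp(tv) for the element \<open>v\<close> whose coordinate vector in
  \<open>c\<close> is \<open>w\<close>; the index is the coordinate vector because bases are handled
  in \<open>'e\<close>.\<close>

definition one_param :: "'e \<Rightarrow> real \<Rightarrow> 'g" where
  "one_param w = (THE \<gamma>. one_parameter_subgroup G A \<gamma> \<and> velocity A \<gamma> 0 c = w)"

lemma one_param: "one_parameter_subgroup G A (one_param w)" "velocity A (one_param w) 0 c = w"
proof -
  have "\<exists>!\<gamma>. one_parameter_subgroup G A \<gamma> \<and> velocity A \<gamma> 0 c = w"
    using one_param_exists one_param_unique by blast
  from theI'[OF this] show "one_parameter_subgroup G A (one_param w)" "velocity A (one_param w) 0 c = w"
    by (simp_all add: one_param_def)
qed

lemma one_param_eqI: "one_parameter_subgroup G A \<gamma> \<Longrightarrow> velocity A \<gamma> 0 c = w \<Longrightarrow> \<gamma> = one_param w"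
  using one_param_unique[OF _ one_param(1)] one_param(2) by metis

lemma velocity_one_param_in_lie_algebra: "velocity A (one_param w) 0 \<in> lie_algebra G A"
  using velocity_in_tangent_space[where t = 0, OF atlas open_UNIV UNIV_I one_paramD(1)[OF one_param(1)]]
    one_paramD(3)[OF one_param(1)] by (simp add: lie_algebra_def)

text \<open>Tangent vectors at the identity agree as soon as their coordinates in \<open>c\<close>
  do, so the descriptions by tangent families and by coordinate vectors single out the same
  curve.\<close>

lemma lie_exp_eq:
  assumes v: "v \<in> lie_algebra G A"
  shows "lie_exp G A v = one_param (v c) 1"
proof -
  have iff: "velocity A \<gamma> 0 = v \<longleftrightarrow> velocity A \<gamma> 0 c = v c" if g: "one_parameter_subgroup G A \<gamma>" for \<gamma>
  proof
    assume eq: "velocity A \<gamma> 0 c = v c"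
    have "velocity A \<gamma> 0 \<in> tangent_space A \<one>"
      using velocity_in_tangent_space[where t = 0, OF atlas open_UNIV UNIV_I one_paramD(1)[OF g]]
        one_paramD(3)[OF g] by simp
    then show "velocity A \<gamma> 0 = v"
      by (rule tangent_space_eqI[where c = c and v = "velocity A \<gamma> 0" and w = v, OF _ _ c_in one_in eq]) (use v in \<open>simp add: lie_algebra_def\<close>)
  qed simp
  then have "(\<lambda>\<gamma>. one_parameter_subgroup G A \<gamma> \<and> velocity A \<gamma> 0 = v)
      = (\<lambda>\<gamma>. one_parameter_subgroup G A \<gamma> \<and> velocity A \<gamma> 0 c = v c)" by blast
  then show ?thesis by (simp add: lie_exp_def one_param_def)
qed

text \<open>Rescaling time rescales the velocity. This turns the curve in
  \<open>induced_field\<close>, which exponentiates a different vector at each time, into a single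
  one-parameter subgroup.\<close>

lemma one_param_scale: "one_param (r *\<^sub>R w) t = one_param w (r * t)"
proof -
  let ?g = "\<lambda>t. one_param w (r * t)"
  note g = one_paramD[OF one_param(1)]
  have "smooth_map_on UNIV std_atlas std_atlas (\<lambda>t. r * t)"
    unfolding smooth_map_on_std_iff[OF open_UNIV] by (rule smooth_on_linear[OF open_UNIV bounded_linear_mult_right])
  from smooth_map_on_compose[where g = "one_param w", OF atlas_real atlas_real atlas
      open_UNIV open_UNIV this g(1)]
  have "smooth_map_on UNIV std_atlas A ?g" by simp
  then have "one_parameter_subgroup G A ?g"
    using g(2) by (simp add: one_parameter_subgroup_def smooth_map_iff distrib_left)
  moreover have "velocity A ?g 0 c = r *\<^sub>R w"
    using velocity_scale[where r = r and t = 0 and \<gamma> = "one_param w", OF atlas open_UNIV UNIV_I g(1) c_in] g(3) one_in one_param(2)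
    by simp
  ultimately have "?g = one_param (r *\<^sub>R w)" by (rule one_param_eqI)
  then show ?thesis by metis
qed


end

context smooth_group_action
begin

lemma induced_field_eq:
  assumes v: "v \<in> lie_algebra G A"
  shows "induced_field G A B act v x = velocity B (\<lambda>t. act (one_param (v c) t) x) 0"
  using lie_exp_eq[OF tangent_space_scaleR[OF atlas v[unfolded lie_algebra_def], folded lie_algebra_def]]
  by (simp add: induced_field_def one_param_scale)

lemma induced_field_chart:
  assumes v: "v \<in> lie_algebra G A" and d: "d \<in> B" "x \<in> fst d"
  shows "induced_field G A B act v x d = fund x d (v c)"
  unfolding induced_field_eq[OF v] one_param_velocity_0[OF one_param(1) d] one_param(2) ..

lemma induced_field_smooth:
  assumes v: "v \<in> lie_algebra G A"
  shows "smooth_vector_field B (induced_field G A B act v)"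
  unfolding smooth_vector_field_def
proof (intro conjI allI ballI)
  fix x
  show "induced_field G A B act v x \<in> tangent_space B x"
    using velocity_in_tangent_space[where t = 0, OF M.atlas open_UNIV UNIV_I smooth_orbit_curve[OF one_param(1)]]
      one_paramD(3)[OF one_param(1)]
    by (simp add: induced_field_eq[OF v] act_one)
next
  fix d assume d: "d \<in> B"
  note ch = atlas_chart[OF M.atlas d]
  show "smooth_on (chart_image d) (\<lambda>y. induced_field G A B act v (chart_inv d y) d)"
    by (rule smooth_on_cong[OF chart_open(2)[OF ch] _ fund_smooth[OF d, of "v c"]])
      (simp add: induced_field_chart[OF v d] chart_inv_in[OF ch])
qed

end

section \<open>The infinitesimal action is surjective\<close>

context lie_group_chart
begin

text \<open>With the identity in one factor, multiplication is the identity map in the other, so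
  both partial derivatives are identities; linearity adds them.\<close>

lemma chart_deriv_mult_one:
  shows "chart_deriv (prod_chart c c) c (\<lambda>(a, b). a \<otimes> b) (\<one>, \<one>) (w, z) = w + z"
proof -
  note P = atlas_prod[OF atlas atlas]
  have pc: "prod_chart c c \<in> prod_atlas A A" using c_in unfolding prod_atlas_eq by blast
  note m = smooth_mult[unfolded smooth_map_iff]
  let ?L = "chart_deriv (prod_chart c c) c (\<lambda>(a, b). a \<otimes> b) (\<one>, \<one>)"
  have lin: "linear ?L"
    by (rule bounded_linear.linear, rule chart_deriv_linear[OF P atlas open_UNIV UNIV_I m pc _ c_in])
      (use one_in in simp_all)
  have id: "((snd c \<circ> (\<lambda>a. a) \<circ> chart_inv c) has_derivative (\<lambda>w. w)) (at (snd c \<one>))"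
  proof -
    have "chart_deriv c c (\<lambda>x. x) \<one> = (\<lambda>w. w)" using chart_deriv_ident[OF is_chart_c one_in] by blast
    then show ?thesis
      using chart_deriv_works[OF atlas atlas open_UNIV UNIV_I smooth_map_on_ident[OF atlas] c_in one_in c_in one_in]
      by simp
  qed
  have const: "((snd c \<circ> (\<lambda>a. \<one>) \<circ> chart_inv c) has_derivative (\<lambda>w. 0)) (at (snd c \<one>))"
    by (simp add: comp_def)
  have "chart_deriv c c (\<lambda>a. (\<lambda>(a, b). a \<otimes> b) (a, \<one>)) \<one> w = ?L (chart_deriv c (prod_chart c c) (\<lambda>a. (a, \<one>)) \<one> w)"
    by (rule chart_deriv_compose_UNIV[OF atlas P atlas smooth_map_on_Pair[OF atlas atlas atlas open_UNIV smooth_map_on_ident[OF atlas]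
        smooth_map_on_const[OF atlas atlas]] m c_in one_in pc _ c_in]) (use one_in in simp_all)
  then have 1: "?L (w, 0) = w"
    using chart_deriv_Pair[OF id const, of w] chart_deriv_ident[OF is_chart_c one_in] by simp
  have "chart_deriv c c (\<lambda>a. (\<lambda>(a, b). a \<otimes> b) (\<one>, a)) \<one> z = ?L (chart_deriv c (prod_chart c c) (\<lambda>a. (\<one>, a)) \<one> z)"
    by (rule chart_deriv_compose_UNIV[OF atlas P atlas smooth_map_on_Pair[OF atlas atlas atlas open_UNIV smooth_map_on_const[OF atlas atlas]
        smooth_map_on_ident[OF atlas]] m c_in one_in pc _ c_in]) (use one_in in simp_all)
  then have 2: "?L (0, z) = z"
    using chart_deriv_Pair[OF const id, of z] chart_deriv_ident[OF is_chart_c one_in] by simp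
  have "?L (w, z) = ?L ((w, 0) + (0, z))" by simp
  then show ?thesis unfolding linear_add[OF lin] 1 2 .
qed

lemma chart_deriv_mult:
  assumes C: "atlas C" and f: "smooth_map_on UNIV C A f" "f p = \<one>" and g: "smooth_map_on UNIV C A g" "g p = \<one>"
    and s: "s \<in> C" "p \<in> fst s"
  shows "chart_deriv s c (\<lambda>u. f u \<otimes> g u) p w = chart_deriv s c f p w + chart_deriv s c g p w"
proof -
  note P = atlas_prod[OF atlas atlas]
  have pc: "prod_chart c c \<in> prod_atlas A A" using c_in unfolding prod_atlas_eq by blast
  have "chart_deriv s c (\<lambda>u. (\<lambda>(a, b). a \<otimes> b) (f u, g u)) p w
     = chart_deriv (prod_chart c c) c (\<lambda>(a, b). a \<otimes> b) (f p, g p) (chart_deriv s (prod_chart c c) (\<lambda>u. (f u, g u)) p w)"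
    by (rule chart_deriv_compose_UNIV[OF C P atlas smooth_map_on_Pair[OF C atlas atlas open_UNIV f(1) g(1)] smooth_mult[unfolded smooth_map_iff]
       s pc _ c_in]) (use one_in f g in simp_all)
  also have "chart_deriv s (prod_chart c c) (\<lambda>u. (f u, g u)) p w = (chart_deriv s c f p w, chart_deriv s c g p w)"
    by (rule chart_deriv_Pair) (rule chart_deriv_works[OF C atlas open_UNIV UNIV_I _ s c_in], use f g one_in in simp_all)+
  finally show ?thesis by (simp add: f g chart_deriv_mult_one)
qed

text \<open>Coordinates of the second kind. The parameters are indexed by the vectors themselves;
  the list only fixes the order of the factors.\<close>

definition param_prod :: "'e list \<Rightarrow> ('e \<Rightarrow> real) \<Rightarrow> 'g" where
  "param_prod l t = foldr (\<lambda>b g. one_param b (t b) \<otimes> g) l \<one>"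

lemma param_prod_simps [simp]: "param_prod [] t = \<one>" "param_prod (b # l) t = one_param b (t b) \<otimes> param_prod l t"
  by (simp_all add: param_prod_def)

lemma param_prod_append: "param_prod (l @ l') t = param_prod l t \<otimes> param_prod l' t"
  by (induction l) (simp_all add: m_assoc)

lemma param_prod_cong: "(\<And>b. b \<in> set l \<Longrightarrow> s b = t b) \<Longrightarrow> param_prod l s = param_prod l t"
  by (induction l) simp_all

text \<open>One induction proves all three claims, because the product rule for the derivative asks
  for smoothness of both factors and for their values at 0.\<close>

lemma param_prod_smooth:
  fixes \<phi> :: "'a::real_normed_vector \<Rightarrow> 'e \<Rightarrow> real"
  assumes fd: "fin_dim TYPE('a)" and \<phi>: "\<And>b. bounded_linear (\<lambda>u. \<phi> u b)"
  shows "smooth_map_on UNIV std_atlas A (\<lambda>u. param_prod l (\<phi> u))" "param_prod l (\<phi> 0) = \<one>"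
    "chart_deriv std_chart c (\<lambda>u. param_prod l (\<phi> u)) 0 w = (\<Sum>b\<leftarrow>l. \<phi> w b *\<^sub>R b)"
proof -
  note std = atlas_std[OF fd] and stdr = atlas_real
  have "smooth_map_on UNIV std_atlas A (\<lambda>u. param_prod l (\<phi> u)) \<and> param_prod l (\<phi> 0) = \<one> \<and>
    chart_deriv std_chart c (\<lambda>u. param_prod l (\<phi> u)) 0 w = (\<Sum>b\<leftarrow>l. \<phi> w b *\<^sub>R b)"
  proof (induction l)
    case Nil
    show ?case using smooth_map_on_const[OF std atlas] by (simp add: chart_deriv_const)
  next
    case (Cons b l)
    have \<phi>0: "\<phi> 0 b = 0" using linear_0[OF bounded_linear.linear[OF \<phi>]] .
    have \<phi>s: "smooth_map_on UNIV std_atlas std_atlas (\<lambda>u. \<phi> u b)"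
      unfolding smooth_map_on_std_iff[OF open_UNIV] by (rule smooth_on_linear[OF open_UNIV \<phi>])
    note op = one_paramD[OF one_param(1)[of b]]
    have s: "smooth_map_on UNIV std_atlas A (\<lambda>u. one_param b (\<phi> u b))"
      by (rule smooth_map_on_compose[OF std stdr atlas open_UNIV open_UNIV \<phi>s op(1)]) simp
    have "chart_deriv std_chart c (\<lambda>u. one_param b (\<phi> u b)) 0 w
        = chart_deriv std_chart c (one_param b) (\<phi> 0 b) (chart_deriv std_chart std_chart (\<lambda>u. \<phi> u b) 0 w)"
      by (rule chart_deriv_compose_UNIV[OF std stdr atlas \<phi>s op(1) _ _ _ _ c_in])
        (simp_all add: std_atlas_eq \<phi>0 op(3) one_in)
    also have "chart_deriv std_chart std_chart (\<lambda>u. \<phi> u b) 0 w = \<phi> w b"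
      using frechet_derivative_at_eq[OF bounded_linear_imp_has_derivative[OF \<phi>[of b]]]
      by (simp add: chart_deriv_def comp_def)
    also have "chart_deriv std_chart c (one_param b) (\<phi> 0 b) (\<phi> w b) = \<phi> w b *\<^sub>R b"
    proof -
      have lin: "linear (chart_deriv std_chart c (one_param b) 0)"
        by (rule bounded_linear.linear, rule chart_deriv_linear[OF stdr atlas open_UNIV UNIV_I op(1) _ _ c_in])
          (simp_all add: std_atlas_eq op(3) one_in)
      have "chart_deriv std_chart c (one_param b) 0 1 = b"
        using velocity_eq(1)[OF atlas open_UNIV UNIV_I op(1) c_in, of 0] op(3) one_in one_param(2) by simp
      then show ?thesis using linear_scale[OF lin, of "\<phi> w b" 1] by (simp add: \<phi>0)
    qed
    finally have D: "chart_deriv std_chart c (\<lambda>u. one_param b (\<phi> u b)) 0 w = \<phi> w b *\<^sub>R b" .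
    have "chart_deriv std_chart c (\<lambda>u. one_param b (\<phi> u b) \<otimes> param_prod l (\<phi> u)) 0 w
       = chart_deriv std_chart c (\<lambda>u. one_param b (\<phi> u b)) 0 w + chart_deriv std_chart c (\<lambda>u. param_prod l (\<phi> u)) 0 w"
      by (rule chart_deriv_mult[OF std s _ conjunct1[OF Cons] conjunct1[OF conjunct2[OF Cons]]])
        (simp_all add: \<phi>0 op(3) std_atlas_eq)
    then show ?case
      using Cons D mult.smooth_act_compose[OF std open_UNIV s conjunct1[OF Cons]] by (simp add: \<phi>0 op(3))
  qed
  then show "smooth_map_on UNIV std_atlas A (\<lambda>u. param_prod l (\<phi> u))" "param_prod l (\<phi> 0) = \<one>"
    "chart_deriv std_chart c (\<lambda>u. param_prod l (\<phi> u)) 0 w = (\<Sum>b\<leftarrow>l. \<phi> w b *\<^sub>R b)" by blast+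
qed

text \<open>The derivative at 0 reassembles a vector from its coordinates in \<open>Bs\<close>, so
  it is the identity and \<open>smooth_on_local_surj\<close> applies.\<close>

lemma param_prod_local_surj:
  assumes Bs: "finite Bs" "independent Bs" "span Bs = (UNIV :: 'e set)" and l: "distinct l" "set l = Bs" and r: "r > 0"
  obtains U where "open U" "\<one> \<in> U" "\<And>a. a \<in> U \<Longrightarrow> \<exists>u. norm u \<le> r \<and> a = param_prod l (representation Bs u)"
proof -
  note fd = atlas_fin_dim[OF atlas]
  note std = atlas_std[OF fd]
  define \<Phi> where "\<Phi> u = param_prod l (representation Bs u)" for u
  note P = param_prod_smooth[where l = l and \<phi> = "representation Bs", OF fd bounded_linear_representation[OF Bs], folded \<Phi>_def]
  have sc: "std_chart \<in> std_atlas" by (simp add: std_atlas_eq)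
  define S where "S = \<Phi> -` fst c"
  have S: "open S" "smooth_on S (snd c \<circ> \<Phi>)"
    using smooth_map_onD(1,3)[OF std atlas P(1) open_UNIV sc c_in] by (simp_all add: S_def comp_def)
  have S0: "0 \<in> S" using P(2) one_in by (simp add: S_def)
  have "chart_deriv std_chart c \<Phi> 0 = (\<lambda>w. w)"
  proof
    fix w
    show "chart_deriv std_chart c \<Phi> 0 w = w"
      using sum_representation[OF Bs, of w] l by (simp add: P(3) sum_list_distinct_conv_sum_set)
  qed
  then have "((snd c \<circ> \<Phi>) has_derivative (\<lambda>w. w)) (at 0)"
    using chart_deriv_works[OF std atlas open_UNIV UNIV_I P(1) sc _ c_in, of 0] P(2) one_in by (simp add: comp_def)
  then obtain s where s: "s > 0" "ball ((snd c \<circ> \<Phi>) 0) s \<subseteq> (snd c \<circ> \<Phi>) ` (cball 0 r \<inter> S)"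
    using smooth_on_local_surj[OF fd S(1) S0 S(2) _ r] by blast
  define U where "U = fst c \<inter> snd c -` ball (snd c \<one>) s"
  show thesis
  proof (rule that[of U])
    show "open U" unfolding U_def
      by (rule chart_preimage_open[OF is_chart_c open_ball])
    show "\<one> \<in> U" using one_in s(1) by (simp add: U_def)
    fix a assume a: "a \<in> U"
    then have "snd c a \<in> (snd c \<circ> \<Phi>) ` (cball 0 r \<inter> S)" using s(2) P(2) by (auto simp: U_def)
    then obtain u where u: "u \<in> cball 0 r" "u \<in> S" "snd c a = snd c (\<Phi> u)" by auto
    have "a \<in> fst c" "\<Phi> u \<in> fst c" using a u(2) by (simp_all add: U_def S_def)
    then have "a = \<Phi> u" using u(3) chart_inv_left[OF is_chart_c] by metis
    then show "\<exists>u. norm u \<le> r \<and> a = param_prod l (representation Bs u)" using u(1) by (auto simp: \<Phi>_def)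
  qed
qed

text \<open>Second countability of the group enters here, through Lindelof's theorem. Translates of
  \<open>U\<close> are open as preimages of \<open>U\<close> under the inverse translations.\<close>

lemma translates_countable_cover:
  assumes U: "open U" "\<one> \<in> U"
  obtains J where "countable J" "(\<Union>g\<in>J. (\<lambda>a. g \<otimes> a) ` U) = UNIV"
proof -
  have op: "open ((\<lambda>a. g \<otimes> a) ` U)" for g
  proof -
    have "(\<lambda>a. g \<otimes> a) ` U = (\<lambda>a. m_inv G g \<otimes> a) -` U"
    proof (intro equalityI subsetI)
      fix b assume "b \<in> (\<lambda>a. m_inv G g \<otimes> a) -` U"
      then show "b \<in> (\<lambda>a. g \<otimes> a) ` U"
        by (intro image_eqI[of _ _ "m_inv G g \<otimes> b"]) (simp_all flip: m_assoc)
    qed (auto simp flip: m_assoc)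
    moreover have "continuous_on UNIV (\<lambda>a. m_inv G g \<otimes> a)"
      using mult.smooth_act_left[of UNIV "m_inv G g"] by (simp add: smooth_map_on_def)
    ultimately show ?thesis using U(1) by (simp add: open_vimage)
  qed
  obtain F where F: "F \<subseteq> range (\<lambda>g. (\<lambda>a. g \<otimes> a) ` U)" "countable F" "\<Union>F = \<Union>(range (\<lambda>g. (\<lambda>a. g \<otimes> a) ` U))"
    using Lindelof[of "range (\<lambda>g. (\<lambda>a. g \<otimes> a) ` U)"] op by blast
  obtain J where J: "countable J" "F = (\<lambda>g. (\<lambda>a. g \<otimes> a) ` U) ` J"
    using F(1,2) by (metis countable_subset_image)
  have "a \<in> (\<lambda>b. a \<otimes> b) ` U" for a using U(2) by (intro image_eqI[of _ _ \<one>]) simp_all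
  then have "\<Union>F = UNIV" unfolding F(3) by blast
  then show thesis using that[of J] J by blast
qed

end

context smooth_group_action
begin

text \<open>The orbit curve satisfies
  \<open>\<beta> (s + t) = act (one_param k t) (\<beta> s)\<close>, so inside the chart its velocity
  at \<open>t\<close> is the image of its velocity at 0, which vanishes. It is constant near 0, and
  later times are reached by powers.\<close>

lemma one_param_fixes:
  assumes d: "d \<in> B" "x \<in> fst d" and k: "fund x d k = 0"
  shows "act (one_param k t) x = x"
proof -
  note op = one_paramD[OF one_param(1)[of k]]
  define \<beta> where "\<beta> t = act (one_param k t) x" for t :: real
  have s: "smooth_map_on U std_atlas B \<beta>" for U
    unfolding \<beta>_def by (rule smooth_orbit_curve[OF one_param(1)])
  have \<beta>0: "\<beta> 0 = x" by (simp add: \<beta>_def op(3) act_one)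
  note ch = atlas_chart[OF M.atlas d(1)]
  have v0: "chart_deriv std_chart d \<beta> 0 1 = 0"
    using velocity_eq(1)[OF M.atlas open_UNIV UNIV_I s d(1), of 0] \<beta>0 d(2) k
      one_param_velocity_0[OF one_param(1) d, of k] one_param(2)[of k]
    unfolding \<beta>_def by simp
  have v: "((snd d \<circ> \<beta>) has_vector_derivative 0) (at t)" if t: "\<beta> t \<in> fst d" for t :: real
  proof -
    have "chart_deriv std_chart d (\<lambda>s. act (one_param k t) (\<beta> s)) 0 1
       = chart_deriv d d (act (one_param k t)) (\<beta> 0) (chart_deriv std_chart d \<beta> 0 1)"
      by (rule chart_deriv_compose_UNIV[OF atlas_real M.atlas M.atlas s smooth_act_left _ _ d(1) _ d(1)]) (use \<beta>0 d t in \<open>simp_all add: std_atlas_eq \<beta>_def\<close>)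
    also have "\<dots> = 0"
      unfolding v0
      by (rule linear_0[OF bounded_linear.linear], rule chart_deriv_linear[OF M.atlas M.atlas open_UNIV UNIV_I smooth_act_left d(1) _ d(1)])
        (use \<beta>0 d t in \<open>simp_all add: \<beta>_def\<close>)
    also have "(\<lambda>s. act (one_param k t) (\<beta> s)) = (\<lambda>s. \<beta> (s + t))"
      by (simp add: \<beta>_def add.commute[of _ t] op(2) act_mult)
    finally have "chart_deriv std_chart d (\<lambda>s. \<beta> (s + t)) 0 1 = 0" .
    then have "velocity B (\<lambda>s. \<beta> (s + t)) 0 d = 0"
      using velocity_eq(1)[where \<gamma> = "\<lambda>s. \<beta> (s + t)" and t = 0, OF M.atlas open_UNIV UNIV_I smooth_map_on_shift[OF M.atlas open_UNIV open_UNIV s UNIV_I] d(1)] t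
      by simp
    then have "velocity B \<beta> t d = 0"
      using velocity_shift[OF M.atlas open_UNIV UNIV_I s d(1), of 0 t] t by simp
    then show ?thesis using velocity_eq(2)[OF M.atlas open_UNIV UNIV_I s d(1) t] by simp
  qed
  have "continuous_on UNIV \<beta>" using s[of UNIV] by (simp add: smooth_map_on_def)
  then have "open (\<beta> -` fst d)" using chart_open(1)[OF ch] by (simp add: open_vimage)
  moreover have "0 \<in> \<beta> -` fst d" using \<beta>0 d(2) by simp
  ultimately obtain r where r: "r > 0" "ball 0 r \<subseteq> \<beta> -` fst d" using open_contains_ball by blast
  have "\<exists>k. \<forall>t\<in>ball (0::real) r. (snd d \<circ> \<beta>) t = k"
  proof (rule has_derivative_zero_constant)
    fix t :: real assume "t \<in> ball 0 r"
    then have "\<beta> t \<in> fst d" using r(2) by blast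
    from v[OF this] show "((snd d \<circ> \<beta>) has_derivative (\<lambda>h. 0)) (at t within ball 0 r)"
      by (simp add: has_vector_derivative_def has_derivative_at_withinI)
  qed simp
  then obtain y where y: "\<And>t. t \<in> ball 0 r \<Longrightarrow> snd d (\<beta> t) = y" by auto
  have near: "\<beta> s = x" if "\<bar>s\<bar> < r" for s
  proof -
    have sr: "s \<in> ball 0 r" "0 \<in> ball (0::real) r" using that r(1) by auto
    then have "snd d (\<beta> s) = snd d x" using y[OF sr(1)] y[OF sr(2)] \<beta>0 by simp
    moreover have "\<beta> s \<in> fst d" using sr(1) r(2) by blast
    ultimately show ?thesis using chart_inv_left[OF ch] d(2) by metis
  qed
  obtain n where n: "\<bar>t\<bar> / 2 ^ n < r" using real_div_power2_less[OF r(1)] .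
  define a where "a = one_param k (t / 2 ^ n)"
  have a: "act a x = x" using near[of "t / 2 ^ n"] n by (simp add: a_def \<beta>_def)
  have "act (a [^] m) x = x" for m :: nat
    by (induction m) (simp_all add: act_one act_mult a)
  moreover have "one_param k t = a [^] (2 ^ n :: nat)"
    using one_param_pow[OF one_param(1), of k "2 ^ n" "t / 2 ^ n"] by (simp add: a_def)
  ultimately show ?thesis by simp
qed

text \<open>If the infinitesimal action at \<open>x\<close> had too small a rank, then near the identity the orbit of \<open>x\<close> would be
  swept out by the one-parameter subgroups complementary to the kernel alone, so that \<open>M\<close> would be a
  countable union of translates of a Lipschitz image of a cube of dimension less than that of \<open>M\<close>.\<close>

lemma fund_surj:
  assumes trans: "\<And>y z. \<exists>a. act a y = z" and d: "d \<in> B" "x \<in> fst d"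
  shows "surj (fund x d)"
proof (rule ccontr)
  assume not_surj: "\<not> surj (fund x d)"
  let ?L = "fund x d"
  note fde = atlas_fin_dim[OF atlas] and fdf = atlas_fin_dim[OF M.atlas]
  have lin: "linear ?L" using fund_linear[OF d] bounded_linear.linear by blast
  obtain K where K: "K \<subseteq> {w. ?L w = 0}" "independent K" "{w. ?L w = 0} \<subseteq> span K"
    using maximal_independent_subset[of "{w. ?L w = 0}"] by blast
  \<comment> \<open>Extending a basis \<open>K\<close> of the kernel leaves
    \<open>D = Bs - K\<close> spanning a complement on which \<open>?L\<close> is injective, so
    \<open>card D\<close> is the rank.\<close>
  obtain Bs where Bs0: "K \<subseteq> Bs" "Bs \<subseteq> UNIV" "independent Bs" "UNIV \<subseteq> span Bs"
    by (rule maximal_independent_subset_extend[OF subset_UNIV K(2)])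
  then have Bs: "K \<subseteq> Bs" "independent Bs" "span Bs = UNIV" by (simp_all add: top.extremum_unique)
  obtain E0 :: "'e set" where "finite E0" "independent E0" "span E0 = UNIV" using fin_dim_basis[OF fde] .
  then have fB: "finite Bs" using independent_span_bound[of E0 Bs] Bs(2) by simp
  note Bs' = fB Bs(2,3)
  define D where "D = Bs - K"
  have D: "finite D" "D \<subseteq> Bs" using fB by (auto simp: D_def)
  have inj: "inj_on ?L (span D)"
  proof (rule inj_onI)
    fix u v assume uv: "u \<in> span D" "v \<in> span D" "?L u = ?L v"
    then have w: "u - v \<in> span D" "u - v \<in> span K"
      using K(3) linear_diff[OF lin, of u v] by (auto intro: span_diff)
    have "representation Bs (u - v) b = 0" for b
      using representation_extend[OF Bs(2) w(1) D(2)] representation_extend[OF Bs(2) w(2) Bs(1)]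
        representation_ne_zero[of D "u - v" b] representation_ne_zero[of K "u - v" b] by (auto simp: D_def)
    then have "u - v = 0" using sum_representation[OF Bs', of "u - v"] by simp
    then show "u = v" by simp
  qed
  have indD: "independent D" using Bs(2) D(2) independent_mono by blast
  have ind: "independent (?L ` D)" by (rule linear_independent_injective_image[OF lin indD inj])
  have card: "card (?L ` D) = card D"
    by (rule card_image[OF inj_on_subset[OF inj span_superset]])
  have "span (?L ` D) \<noteq> UNIV"
    using not_surj linear_span_image[OF lin, of D] image_mono[OF subset_UNIV, of ?L "span D"] by auto
  then obtain F :: "'f set" where F: "finite F" "independent F" "card D < card F"
    using fin_dim_basis[OF fdf] fin_dim_independent_card[OF _ _ _ ind] card by metis
  obtain ds where ds: "set ds = D" "distinct ds" using finite_distinct_list[OF D(1)] by blast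
  obtain ks where ks: "set ks = K" "distinct ks" using finite_distinct_list[of K] Bs(1) fB finite_subset by blast
  have fixK: "act (param_prod l t) x = x" if "set l \<subseteq> K" for l t
    using that K(1) by (induction l) (auto simp: act_one act_mult one_param_fixes[OF d])
  \<comment> \<open>The last factors of the product act on \<open>x\<close> first, and they fix
    it.\<close>
  have ds_ks: "act (param_prod (ds @ ks) t) x = act (param_prod ds t) x" for t
    using fixK[of ks t] ks(1) by (simp add: param_prod_append act_mult)
  \<comment> \<open>All of \<open>'e\<close> is the parameter space of \<open>\<Theta>\<close>, so
    that calculus in normed spaces yields a Lipschitz bound; \<open>T\<close> below restricts it to
    parameters indexed by \<open>D\<close>.\<close>
  define \<Theta> where "\<Theta> u = act (param_prod ds (representation Bs u)) x" for u
  note P = param_prod_smooth[where l = ds and \<phi> = "representation Bs", OF fde bounded_linear_representation[OF Bs']]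
  note std = atlas_std[OF fde]
  have s\<Theta>: "smooth_map_on UNIV std_atlas B \<Theta>"
    unfolding \<Theta>_def
    by (rule smooth_map_on_compose[OF std atlas M.atlas open_UNIV open_UNIV P(1) smooth_act_right]) simp
  define Q where "Q = \<Theta> -` fst d"
  have sc: "std_chart \<in> std_atlas" by (simp add: std_atlas_eq)
  have Q: "open Q" "smooth_on Q (snd d \<circ> \<Theta>)"
    using smooth_map_onD(1,3)[OF std M.atlas s\<Theta> open_UNIV sc d(1)] by (simp_all add: Q_def comp_def)
  have Q0: "0 \<in> Q" using P(2) d(2) by (simp add: Q_def \<Theta>_def act_one)
  obtain \<delta> L where L: "\<delta> > 0" "L > 0" "cball 0 \<delta> \<subseteq> Q"
    "\<And>y z. y \<in> cball 0 \<delta> \<Longrightarrow> z \<in> cball 0 \<delta> \<Longrightarrow> norm ((snd d \<circ> \<Theta>) y - (snd d \<circ> \<Theta>) z) \<le> L * norm (y - z)"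
    using smooth_on_locally_lipschitz[OF fde Q(1) Q0 Q(2)] by metis
  define N where "N = (\<Sum>b\<in>D. norm b) + 1"
  have N: "N > 0" "(\<Sum>b\<in>D. norm b) \<le> N" by (simp_all add: N_def add_nonneg_pos sum_nonneg)
  \<comment> \<open>Parameters bounded by \<open>\<rho>\<close> give vectors \<open>T t\<close> of
    norm at most \<open>\<delta>\<close>, inside the ball where the Lipschitz bound holds.\<close>
  define \<rho> where "\<rho> = \<delta> / N"
  have \<rho>: "\<rho> > 0" "\<rho> * N = \<delta>" using L(1) N by (simp_all add: \<rho>_def)
  define T where "T t = (\<Sum>b\<in>D. t b *\<^sub>R b)" for t
  have T_diff: "T s - T t = T (\<lambda>b. s b - t b)" for s t
    by (simp add: T_def scaleR_diff_left sum_subtractf)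
  have T_norm: "norm (T t) \<le> e * N" if "\<And>b. b \<in> D \<Longrightarrow> \<bar>t b\<bar> \<le> e" "e \<ge> 0" for t e
  proof -
    have "norm (T t) \<le> (\<Sum>b\<in>D. e * norm b)"
      unfolding T_def by (rule sum_norm_le) (simp add: that(1) mult_right_mono)
    also have "\<dots> \<le> e * N" using that(2) N(2) by (simp add: mult_left_mono flip: sum_distrib_left)
    finally show ?thesis .
  qed
  have T_in: "T t \<in> cball 0 \<delta>" if "\<And>b. b \<in> D \<Longrightarrow> \<bar>t b\<bar> \<le> \<rho>" for t
    using T_norm[of t \<rho>, OF that] \<rho> by simp
  have rep_T: "representation Bs (T t) b = t b" if "b \<in> D" for t b
  proof -
    have "\<phi> (T t) = (\<Sum>b'\<in>D. t b' * \<phi> b')" if "linear \<phi>" for \<phi> :: "'e \<Rightarrow> real"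
      using that unfolding T_def by (simp add: linear_sum linear_scale)
    from this[OF linear_representation[OF Bs(2,3)]]
    have "representation Bs (T t) b = (\<Sum>b'\<in>D. t b' * representation Bs b' b)" .
    also have "\<dots> = (\<Sum>b'\<in>D. if b' = b then t b' else 0)"
      using D(2) Bs(2) by (intro sum.cong) (auto simp: representation_basis)
    finally show ?thesis using that D(1) by simp
  qed
  have \<Theta>_T: "\<Theta> (T t) = act (param_prod ds t) x" for t
    unfolding \<Theta>_def by (subst param_prod_cong[of ds _ t]) (simp_all add: rep_T ds(1))
  obtain C where C: "C > 0" "\<And>u b. \<bar>representation Bs u b\<bar> \<le> C * norm u"
    using representation_bound[OF Bs'] by metis
  have rep_le: "\<bar>representation Bs u b\<bar> \<le> \<rho>" if "norm u \<le> \<rho> / C" for u b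
    using C(2)[of u b] mult_left_mono[OF that, of C] C(1) by simp
  have dk: "distinct (ds @ ks)" "set (ds @ ks) = Bs" using ds ks Bs(1) by (auto simp: D_def)
  \<comment> \<open>Vectors of norm at most \<open>\<rho> / C\<close> have coordinates bounded by
    \<open>\<rho>\<close>, so the parameters needed for \<open>U\<close> lie in the cube.\<close>
  obtain U where U: "open U" "\<one> \<in> U"
    "\<And>a. a \<in> U \<Longrightarrow> \<exists>u. norm u \<le> \<rho> / C \<and> a = param_prod (ds @ ks) (representation Bs u)"
    using param_prod_local_surj[OF Bs' dk, of "\<rho> / C"] \<rho>(1) C(1) by (metis divide_pos_pos)
  define KK where "KK = (\<lambda>t. act (param_prod ds t) x) ` {t. \<forall>b\<in>D. \<bar>t b\<bar> \<le> \<rho>}"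
  have U_KK: "act a x \<in> KK" if a: "a \<in> U" for a
  proof -
    obtain u where u: "norm u \<le> \<rho> / C" "a = param_prod (ds @ ks) (representation Bs u)" using U(3)[OF a] by blast
    then have "act a x = act (param_prod ds (representation Bs u)) x" by (simp only: ds_ks)
    then show ?thesis unfolding KK_def using rep_le[OF u(1)] by (intro image_eqI) auto
  qed
  have KK_d: "KK \<subseteq> fst d"
    unfolding KK_def
  proof clarify
    fix t assume "\<forall>b\<in>D. \<bar>t b\<bar> \<le> \<rho>"
    then have "T t \<in> Q" using T_in[of t] L(3) by blast
    then show "act (param_prod ds t) x \<in> fst d" by (simp add: Q_def flip: \<Theta>_T)
  qed
  obtain J where J: "countable J" "(\<Union>g\<in>J. (\<lambda>a. g \<otimes> a) ` U) = UNIV"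
    using translates_countable_cover[OF U(1,2)] .
  have "(\<Union>g\<in>J. act g ` KK) = UNIV"
  proof (intro equalityI subsetI UNIV_I)
    fix y
    obtain a where a: "act a x = y" using trans by blast
    obtain g b where "g \<in> J" "b \<in> U" "a = g \<otimes> b" using J(2) by blast
    then show "y \<in> (\<Union>g\<in>J. act g ` KK)" using U_KK[of b] a by (auto simp: act_mult)
  qed
  from atlas_Baire[OF M.atlas J(1) this]
  obtain g O1 where O1: "open O1" "O1 \<noteq> {}" "O1 \<subseteq> closure (act g ` KK)" by blast
  have cont: "continuous_on UNIV (act h)" for h
    using smooth_act_left[of UNIV h] by (simp add: smooth_map_on_def)
  have inv_act: "act (m_inv G g) (act g p) = p" "act g (act (m_inv G g) p) = p" for p
    by (simp_all add: act_one flip: act_mult)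
  \<comment> \<open>Baire yields a translate of \<open>KK\<close> dense in an open set; translating
    back makes \<open>KK\<close> itself dense in one.\<close>
  define O2 where "O2 = act g -` O1"
  have "open O2" using O1(1) cont by (simp add: O2_def open_vimage)
  moreover have "O2 \<noteq> {}" using O1(2) inv_act(2) unfolding O2_def by (metis ex_in_conv vimageI2)
  moreover have "O2 \<subseteq> closure KK"
  proof
    fix p assume p: "p \<in> O2"
    show "p \<in> closure KK"
      unfolding closure_iff_nhds_not_empty
    proof (intro allI impI)
      fix S V assume V: "V \<subseteq> S" "open V" "p \<in> V"
      have "open (act (m_inv G g) -` V)" using V(2) cont by (simp add: open_vimage)
      moreover have "act g p \<in> act (m_inv G g) -` V" using V(3) inv_act(1) by simp
      moreover have "act g p \<in> closure (act g ` KK)" using p O1(3) by (auto simp: O2_def)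
      ultimately have "act g ` KK \<inter> act (m_inv G g) -` V \<noteq> {}"
        unfolding closure_iff_nhds_not_empty by blast
      then show "KK \<inter> S \<noteq> {}" using V(1) inv_act(1) by auto
    qed
  qed
  ultimately obtain V where V: "open V" "V \<noteq> {}" "V \<subseteq> closure (snd d ` KK)"
    using chart_image_dense[OF atlas_chart[OF M.atlas d(1)] KK_d] by blast
  then obtain p where p: "p \<in> V" by blast
  define h where "h t = snd d (act (param_prod ds t) x)" for t
  have "snd d ` KK = h ` {t. \<forall>b\<in>D. \<bar>t b\<bar> \<le> \<rho>}" by (simp add: KK_def h_def image_image)
  moreover have "\<not> V \<subseteq> closure (h ` {t. \<forall>b\<in>D. \<bar>t b\<bar> \<le> \<rho>})"
  proof (rule lipschitz_cube_not_dense[OF D(1) F \<rho>(1) _ _ V(1) p])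
    show "L * N > 0" using L(2) N(1) by simp
    fix s t e assume st: "\<And>b. b \<in> D \<Longrightarrow> \<bar>s b\<bar> \<le> \<rho>" "\<And>b. b \<in> D \<Longrightarrow> \<bar>t b\<bar> \<le> \<rho>" "\<And>b. b \<in> D \<Longrightarrow> \<bar>s b - t b\<bar> \<le> e" "0 \<le> (e::real)"
    have "norm (h s - h t) \<le> L * norm (T s - T t)"
      using L(4)[OF T_in[OF st(1)] T_in[OF st(2)]] by (simp add: h_def \<Theta>_T)
    also have "\<dots> \<le> L * (e * N)"
      unfolding T_diff using L(2) T_norm[of "\<lambda>b. s b - t b" e, OF st(3,4)] by (intro mult_left_mono) auto
    finally show "norm (h s - h t) \<le> L * N * e" by (simp add: mult_ac)
  qed
  ultimately show False using V(3) by simp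
qed

end

section \<open>Generating sets\<close>

text \<open>The coefficients are chosen orthogonal to all linear relations between the fields at the point. This
  determines them uniquely, independently of charts, so that no partition of unity is needed.\<close>

lemma spanning_fields_generating:
  fixes B :: "('m::t2_space, 'f::real_normed_vector) chart set" and X :: "'i \<Rightarrow> 'm \<Rightarrow> ('m, 'f) tangent"
  assumes B: "atlas B" and I: "finite I" and X: "\<And>i. i \<in> I \<Longrightarrow> smooth_vector_field B (X i)"
    and sp: "\<And>p d y. d \<in> B \<Longrightarrow> p \<in> fst d \<Longrightarrow> \<exists>a. y = (\<Sum>i\<in>I. a i *\<^sub>R X i p d)"
  shows "generating_set B I X"
  unfolding generating_set_def
proof (intro conjI ballI allI impI)
  fix Y assume Y: "smooth_vector_field B Y"
  note fd = atlas_fin_dim[OF B]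
  obtain F :: "'f set" where F: "finite F" "independent F" "span F = UNIV" using fin_dim_basis[OF fd] .
  \<comment> \<open>Any inner product on the model space serves; this one makes \<open>F\<close>
    orthonormal.\<close>
  define ip where "ip u w = (\<Sum>b\<in>F. representation F u b * representation F w b)" for u w
  note rep_lin = linear_representation[OF F(2,3)]
  have ip_lin: "linear (ip u)" for u
    unfolding ip_def
    by (intro linearI) (simp_all add: linear_add[OF rep_lin] linear_scale[OF rep_lin] distrib_left sum.distrib sum_distrib_left mult_ac)
  have ip_sym: "ip u w = ip w u" for u w unfolding ip_def by (simp add: mult.commute)
  have ip_0: "u = 0" if "ip u u = 0" for u
  proof -
    have "representation F u b * representation F u b = 0" if "b \<in> F" for b
      using \<open>ip u u = 0\<close> that F(1) by (simp add: ip_def sum_nonneg_eq_0_iff)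
    then show ?thesis using sum_representation[OF F, of u] by simp
  qed
  have ip_sum: "ip u (\<Sum>i\<in>I. a i *\<^sub>R v i) = (\<Sum>i\<in>I. a i * ip u (v i))" for u a v
    by (simp add: linear_sum[OF ip_lin] linear_scale[OF ip_lin])
  \<comment> \<open>\<open>R p f\<close> mentions no chart, which is why coefficients computed in
    different charts agree.\<close>
  define R where "R p f \<longleftrightarrow> Y p = lincomb I f (\<lambda>i. X i p) \<and>
    (\<forall>k. lincomb I k (\<lambda>i. X i p) = (\<lambda>_. 0) \<longrightarrow> (\<Sum>i\<in>I. k i * f i) = 0)" for p and f :: "'i \<Rightarrow> real"
  \<comment> \<open>The difference of two solutions is itself a linear relation, hence orthogonal to
    both solutions and so to itself.\<close>
  have R_unique: "f i = g i" if "R p f" "R p g" "i \<in> I" for p f g i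
  proof -
    let ?k = "\<lambda>i. f i - g i"
    have "lincomb I ?k (\<lambda>i. X i p) = (\<lambda>_. 0)"
    proof
      fix d
      have "Y p d = lincomb I f (\<lambda>i. X i p) d" "Y p d = lincomb I g (\<lambda>i. X i p) d"
        using that(1,2) by (simp_all add: R_def)
      then show "lincomb I ?k (\<lambda>i. X i p) d = 0" by (simp add: lincomb_def scaleR_diff_left sum_subtractf)
    qed
    then have "(\<Sum>i\<in>I. ?k i * f i) = 0" "(\<Sum>i\<in>I. ?k i * g i) = 0" using that(1,2) by (auto simp: R_def)
    then have "(\<Sum>i\<in>I. ?k i * ?k i) = 0" by (simp add: right_diff_distrib sum_subtractf)
    then show ?thesis using that(3) I by (simp add: sum_nonneg_eq_0_iff)
  qed
  \<comment> \<open>The frame operator of the fields at \<open>p\<close>: the map from coefficients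
    to combinations, composed with its adjoint. It is injective because the fields span.\<close>
  define S where "S p d w = (\<Sum>i\<in>I. ip (X i p d) w *\<^sub>R X i p d)" for p d w
  have S_lin: "linear (S p d)" for p d
    unfolding S_def
    by (intro linearI) (simp_all add: linear_add[OF ip_lin] linear_scale[OF ip_lin] scaleR_left_distrib sum.distrib scaleR_sum_right)
  have S_inj: "inj (S p d)" if d: "d \<in> B" "p \<in> fst d" for p d
    unfolding linear_injective_0[OF S_lin]
  proof (intro allI impI)
    fix w assume "S p d w = 0"
    then have "ip w (S p d w) = 0" by (simp add: linear_0[OF ip_lin])
    then have "(\<Sum>i\<in>I. ip (X i p d) w * ip (X i p d) w) = 0"
      unfolding S_def ip_sum by (simp add: ip_sym[of w])
    then have z: "ip w (X i p d) = 0" if "i \<in> I" for i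
      using that I by (simp add: sum_nonneg_eq_0_iff ip_sym[of w])
    obtain a where a: "w = (\<Sum>i\<in>I. a i *\<^sub>R X i p d)" using sp[OF d] by blast
    have "ip w w = (\<Sum>i\<in>I. a i * ip w (X i p d))" by (subst (2) a) (rule ip_sum)
    then have "ip w w = 0" using z by simp
    then show "w = 0" by (rule ip_0)
  qed
  have S_surj: "surj (S p d)" if "d \<in> B" "p \<in> fst d" for p d
    by (rule fin_dim_linear_inj_surj[OF fd S_lin S_inj[OF that]])
  \<comment> \<open>Solving \<open>S p d u = Y p d\<close> expresses \<open>Y p\<close> with
    coefficients \<open>ip (X i p d) u\<close>. These lie in the image of the adjoint and are
    therefore orthogonal to the kernel of the combination map, that is, to all relations.\<close>
  define u where "u p d = inv_into UNIV (S p d) (Y p d)" for p d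
  have Su: "S p d (u p d) = Y p d" if "d \<in> B" "p \<in> fst d" for p d
    unfolding u_def using S_surj[OF that] by (simp add: surj_f_inv_f)
  have tan: "X i p \<in> tangent_space B p" "Y p \<in> tangent_space B p" if "i \<in> I" for i p
    using X[OF that] Y by (simp_all add: smooth_vector_field_def)
  have R_ip: "R p (\<lambda>i. ip (X i p d) (u p d))" if d: "d \<in> B" "p \<in> fst d" for p d
    unfolding R_def
  proof (intro conjI allI impI)
    have "Y p \<in> tangent_space B p" using Y by (simp add: smooth_vector_field_def)
    then show "Y p = lincomb I (\<lambda>i. ip (X i p d) (u p d)) (\<lambda>i. X i p)"
    proof (rule tangent_space_eqI[OF _ tangent_space_lincomb[OF B] d])
      show "Y p d = lincomb I (\<lambda>i. ip (X i p d) (u p d)) (\<lambda>i. X i p) d"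
        using Su[OF d] by (simp add: lincomb_def S_def)
    qed (rule tan)
    fix k assume "lincomb I k (\<lambda>i. X i p) = (\<lambda>_. 0)"
    then have "(\<Sum>i\<in>I. k i *\<^sub>R X i p d) = 0" by (metis lincomb_def)
    then have "ip (u p d) (\<Sum>i\<in>I. k i *\<^sub>R X i p d) = 0" by (simp add: linear_0[OF ip_lin])
    then show "(\<Sum>i\<in>I. k i * ip (X i p d) (u p d)) = 0"
      unfolding ip_sum by (simp add: ip_sym[of "u p d"])
  qed
  have "\<exists>f. R p f" for p using R_ip atlas_cover[OF B] by blast
  then obtain f where f: "\<And>p. R p (f p)" by metis
  have "smooth_map B (std_atlas :: (real, real) chart set) (\<lambda>p. f p i)" if i: "i \<in> I" for i
    unfolding smooth_map_iff
  proof (rule smooth_map_onI[OF B atlas_real])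
    fix p
    obtain d where d: "d \<in> B" "p \<in> fst d" using atlas_cover[OF B] by blast
    note ch = atlas_chart[OF B d(1)]
    let ?C = "chart_image d" and ?q = "chart_inv d"
    note o = chart_open(2)[OF ch]
    have sX: "smooth_on ?C (\<lambda>z. X j (?q z) d)" if "j \<in> I" for j
      using X[OF that] d(1) by (simp add: smooth_vector_field_def)
    have s_ip: "smooth_on ?C (\<lambda>z. ip (v z) (w z))" if "smooth_on ?C v" "smooth_on ?C w" for v w
      unfolding ip_def real_scaleR_def[symmetric]
      by (intro smooth_on_sum[OF o] smooth_on_scaleR[OF o]
          smooth_on_linear_compose[OF o bounded_linear_representation[OF F]] that)
    have "smooth_on ?C (\<lambda>z. u (?q z) d)"
    proof (rule smooth_on_linear_solve[where A = "\<lambda>z. S (?q z) d" and Y = "\<lambda>z. Y (?q z) d", OF fd o])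
      show "linear (S (?q z) d)" for z by (rule S_lin)
      show "inj (S (?q z) d)" "S (?q z) d (u (?q z) d) = Y (?q z) d" if "z \<in> ?C" for z
        using S_inj[OF d(1)] Su[OF d(1)] chart_inv_in[OF ch that] by simp_all
      show "smooth_on ?C (\<lambda>z. S (?q z) d b)" for b
        unfolding S_def by (rule smooth_on_sum[OF o], rule smooth_on_scaleR[OF o s_ip[OF _ smooth_on_const]]) (rule sX, assumption)+
      show "smooth_on ?C (\<lambda>z. Y (?q z) d)" using Y d(1) by (simp add: smooth_vector_field_def)
    qed
    \<comment> \<open>By uniqueness the coefficients chosen point by point agree on the chart with
      this smooth formula.\<close>
    from s_ip[OF sX[OF i] this]
    have "smooth_on ?C (\<lambda>z. f (?q z) i)"
      by (rule smooth_on_cong[OF o, rotated])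
        (rule R_unique[OF R_ip[OF d(1) chart_inv_in[OF ch]] f i])
    then show "locally_smooth B std_atlas (\<lambda>p. f p i) p"
      unfolding locally_smooth_def
      using d chart_open(1)[OF ch]
      by (intro bexI[of _ d] bexI[of _ std_chart] exI[of _ "fst d"]) (simp_all add: std_atlas_eq chart_image_def comp_def)
  qed
  then show "\<exists>f. (\<forall>i\<in>I. smooth_map B (std_atlas :: (real, real) chart set) (f i)) \<and> (\<forall>p. Y p = lincomb I (\<lambda>i. f i p) (\<lambda>i. X i p))"
    using f by (intro exI[of _ "\<lambda>i p. f p i"]) (simp add: R_def)
qed (use I X in auto)

theorem mainTheorem5:
  fixes G :: "'g::{t2_space,second_countable_topology} monoid"
    and A :: "('g, 'e::real_normed_vector) chart set"
    and B :: "('m::{t2_space,second_countable_topology}, 'f::real_normed_vector) chart set"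
    and act :: "'g \<Rightarrow> 'm \<Rightarrow> 'm"
    and m :: nat
    and v :: "nat \<Rightarrow> ('g, 'e) tangent"
  assumes "lie_group G A"
    and "homogeneous_space G A B act"
    and "lie_algebra_basis G A {1..m} v"
  shows "generating_set B {1..m} (\<lambda>i. induced_field G A B act (v i))"
proof -
  interpret H: homogeneous_space G A B act by (rule assms(2))
  obtain c where c: "c \<in> A" "\<one>\<^bsub>G\<^esub> \<in> fst c" using atlas_cover[OF H.atlas] by blast
  have "act \<one>\<^bsub>G\<^esub> x = x" for x using H.id_eq_one by (metis UNIV_I restrict_apply')
  moreover have "act (a \<otimes>\<^bsub>G\<^esub> b) x = act a (act b x)" for a b x
    using H.composition_rule[of x a b] H.carrier_UNIV by simp
  ultimately interpret S: smooth_group_action G A c B act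
    using c H.smooth_act by unfold_locales
  have v: "v i \<in> lie_algebra G A" if "i \<in> {1..m}" for i
    using assms(3) that unfolding lie_algebra_basis_def by blast
  have trans: "\<exists>a. act a y = z" for y z using H.unique_orbit by blast
  show ?thesis
  proof (rule spanning_fields_generating[OF H.M.atlas])
    show "smooth_vector_field B (induced_field G A B act (v i))" if "i \<in> {1..m}" for i
      by (rule S.induced_field_smooth[OF v[OF that]])
    fix p d y assume d: "d \<in> B" "p \<in> fst d"
    obtain w where w: "y = S.fund p d w" using S.fund_surj[OF trans d] by blast
    \<comment> \<open>The basis hypothesis concerns tangent families, so \<open>w\<close> is
      realised as the coordinate vector in \<open>c\<close> of the velocity of a one-parameter
      subgroup.\<close>
    obtain a where a: "velocity A (S.one_param w) 0 = lincomb {1..m} a v"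
      using assms(3) S.velocity_one_param_in_lie_algebra[of w] unfolding lie_algebra_basis_def by blast
    have "w = (\<Sum>i\<in>{1..m}. a i *\<^sub>R v i c)"
      using fun_cong[OF a, of c] S.one_param(2)[of w] by (simp add: lincomb_def)
    then have "y = (\<Sum>i\<in>{1..m}. a i *\<^sub>R S.fund p d (v i c))"
      using bounded_linear.linear[OF S.fund_linear[OF d]] by (simp add: w linear_sum linear_scale)
    also have "\<dots> = (\<Sum>i\<in>{1..m}. a i *\<^sub>R induced_field G A B act (v i) p d)"
      by (rule sum.cong) (simp_all add: S.induced_field_chart[OF v d])
    finally show "\<exists>a. y = (\<Sum>i\<in>{1..m}. a i *\<^sub>R induced_field G A B act (v i) p d)" by blast
  qed simp
qed

end
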